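(* Fix a positive integer $k$. Let $q$ be a positive integer that is divisible by the cube of every prime that divides it, let $n$ be a positive integer coprime to $q$, and let $\Psi : \Gamma_0(q)\backslash\mathbb{H}\to\mathbb{C}$ be a measurable function of moderate growth. Then $$\sum_{\varphi\in\mathcal{B}^*(q)}\langle\varphi,\Psi\cdot T_n\varphi\rangle = \sum_{d,e\mid q}\mu(d)\mu(e)\sum_{\varphi\in\mathcal{B}(\frac{q}{de})}\langle\varphi|_d,\Psi\cdot T_n(\varphi|_d)\rangle.$$
   Context: For a positive integer $\ell$, $\mathcal{A}(\ell)$ is the (finite-dimensional) space of weight $k$ holomorphic cusp forms on $\Gamma_0(\ell)$, with Petersson inner product $\langle f, g\rangle = \int_{\Gamma_0(\ell)\backslash\mathbb{H}} f(z)\overline{g(z)}\, y^k \, d\mu_\ell(z)$, where $d\mu_\ell$ is a multiple of $\frac{dx\,dy}{y^2}$ normalized so that the total volume of $\Gamma_0(\ell)\backslash\mathbb{H}$ is a constant independent of $\ell$ (for instance $d\mu_\ell = \operatorname{vol}(\Gamma_0(\ell)\backslash\mathbb{H})^{-1}\frac{dx\,dy}{y^2}$). The inner products in the claim are given by the same integral over $\Gamma_0(q)\backslash\mathbb{H}$ (with $\ell = q$), applied to $f\in\mathcal{A}(q)$ and $g = \Psi\cdot h$ with $h\in\mathcal{A}(q)$. "Moderate growth" means at most polynomial growth at the cusps, so these integrals converge absolutely. For $\varphi \in \mathcal{A}(\ell)$ and a positive integer $d$, $\varphi|_d(z) := d^{k/2}\varphi(dz)$; if $d,e$ are such that $de\mid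 q$ and $\varphi\in\mathcal{A}(q/(de))$, then $\varphi|_d\in\mathcal{A}(q)$. The oldspace of $\mathcal{A}(\ell)$ is the span of the forms $\varphi|_d$ over all divisors $\ell' \neq \ell$ of $\ell$, all divisors $d$ of $\ell/\ell'$, and all $\varphi\in\mathcal{A}(\ell')$. The newspace $\mathcal{A}^*(\ell)$ is the orthogonal complement of the oldspace in $\mathcal{A}(\ell)$. $\mathcal{B}(\ell)$ and $\mathcal{B}^*(\ell)$ denote arbitrary orthonormal bases of $\mathcal{A}(\ell)$ and $\mathcal{A}^*(\ell)$. $T_n$ is the usual $n$th Hecke operator on $\mathcal{A}(q)$ for $n$ coprime to $q$, e.g. $T_n\varphi(z) = n^{-1/2}\sum_{ac=n}\sum_{b \bmod c}(a/c)^{k/2}\varphi\left(\frac{az+b}{c}\right)$ (the scalar normalization is immaterial). $\mu$ is the Möbius function. Terms with $\mu(d)\mu(e)=0$ are understood to be zero; when $d,e$ are squarefree divisors of $q$, the hypothesis on $q$ ensures $de\mid q$. *)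

theory Defs
  imports
    "HOL-Analysis.Analysis"
    "HOL-Computational_Algebra.Squarefree"
    "HOL-Library.Function_Algebras"
begin

section \<open>The upper half-plane and the groups \<open>\<Gamma>\<^sub>0(\<ell>)\<close>\<close>

definition upper_half_plane :: "complex set" where
  "upper_half_plane = {z. Im z > 0}"

definition SL2Z :: "(int^2^2) set" where
  "SL2Z = {g. det g = 1}"

definition Gamma0 :: "nat \<Rightarrow> (int^2^2) set" where
  "Gamma0 l = {g \<in> SL2Z. int l dvd g $ 2 $ 1}"

definition act :: "int^2^2 \<Rightarrow> complex \<Rightarrow> complex" where
  "act g z = moebius (of_int (g $ 1 $ 1)) (of_int (g $ 1 $ 2))
                     (of_int (g $ 2 $ 1)) (of_int (g $ 2 $ 2)) z"

definition autfactor :: "int^2^2 \<Rightarrow> complex \<Rightarrow> complex" where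
  "autfactor g z = of_int (g $ 2 $ 1) * z + of_int (g $ 2 $ 2)"


section \<open>Cusp forms\<close>

text \<open>
  Functions on the upper half-plane are represented by functions on \<^typ>\<open>complex\<close> that vanish
  off the upper half-plane, so that equality of forms is equality of HOL functions.
  Vanishing at the cusp \<open>\<gamma>\<infinity>\<close> is stated as: \<open>(f|\<^sub>k\<gamma>)(z) \<rightarrow> 0\<close> as \<open>Im z \<rightarrow> \<infinity>\<close>, uniformly in
  \<open>Re z\<close>; for holomorphic \<open>f\<close> of weight \<open>k\<close> this says that all Fourier coefficients of
  nonpositive index of \<open>f|\<^sub>k\<gamma>\<close> are zero.
\<close>

definition cusp_forms :: "nat \<Rightarrow> nat \<Rightarrow> (complex \<Rightarrow> complex) set" where
  "cusp_forms k l = {f.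
     (\<forall>z. z \<notin> upper_half_plane \<longrightarrow> f z = 0) \<and>
     f holomorphic_on upper_half_plane \<and>
     (\<forall>g\<in>Gamma0 l. \<forall>z\<in>upper_half_plane. f (act g z) = autfactor g z ^ k * f z) \<and>
     (\<forall>g\<in>SL2Z. ((\<lambda>z. f (act g z) / autfactor g z ^ k) \<longlongrightarrow> 0) (filtercomap Im at_top))}"


section \<open>Integration over \<open>\<Gamma>\<^sub>0(\<ell>)\H\<close> and the Petersson inner product\<close>

definition hyp_measure :: "complex measure" where
  "hyp_measure = density lborel (\<lambda>z. ennreal (1 / (Im z)\<^sup>2))"

definition fund_domain :: "complex set" where
  "fund_domain = {z \<in> upper_half_plane. \<bar>Re z\<bar> \<le> 1/2 \<and> cmod z \<ge> 1}"

text \<open>The set of right cosets \<open>\<Gamma>\<^sub>0(\<ell>)g\<close> in \<open>SL\<^sub>2(Z)\<close>.\<close>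

definition Gamma0_cosets :: "nat \<Rightarrow> (int^2^2) set set" where
  "Gamma0_cosets l = {(\<lambda>h. h ** g) ` Gamma0 l | g. g \<in> SL2Z}"

text \<open>
  If \<open>g\<close> runs over representatives of the cosets (as \<open>-1 \<in> \<Gamma>\<^sub>0(\<ell>)\<close>, there is no repetition
  modulo \<open>\<plusminus>1\<close>), the translates under \<open>g\<close> of the standard domain of \<open>SL\<^sub>2(Z)\<close> make up a
  fundamental domain of \<open>\<Gamma>\<^sub>0(\<ell>)\<close>. The integral over \<open>\<Gamma>\<^sub>0(\<ell>)\H\<close> with respect to \<open>dx dy / y\<^sup>2\<close> is
  the integral over that domain; it is meant for \<open>\<Gamma>\<^sub>0(\<ell>)\<close>-invariant \<open>F\<close>, for which the
  choice of representatives does not matter.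
\<close>

definition quotient_integral ::
  "nat \<Rightarrow> (complex \<Rightarrow> 'a::{banach, second_countable_topology}) \<Rightarrow> 'a" where
  "quotient_integral l F =
     (\<Sum>C\<in>Gamma0_cosets l. LINT z:fund_domain|hyp_measure. F (act (SOME g. g \<in> C) z))"

definition covolume :: "nat \<Rightarrow> real" where
  "covolume l = quotient_integral l (\<lambda>_. 1)"

text \<open>\<open>V\<close> is the total volume of \<open>\<Gamma>\<^sub>0(\<ell>)\H\<close> under the normalized measure, the same for all \<open>\<ell>\<close>.\<close>

definition petersson ::
  "real \<Rightarrow> nat \<Rightarrow> nat \<Rightarrow> (complex \<Rightarrow> complex) \<Rightarrow> (complex \<Rightarrow> complex) \<Rightarrow> complex" where
  "petersson V k l f g =
     of_real (V / covolume l) *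
     quotient_integral l (\<lambda>z. f z * cnj (g z) * of_real (Im z ^ k))"

text \<open>
  Growth is polynomial in \<open>Im z\<close> towards every cusp \<open>g\<infinity>\<close>. The bound is imposed on the whole
  translate of the standard domain, not only near the cusp, so that integrals against cusp
  forms converge absolutely.
\<close>

definition moderate_growth :: "(complex \<Rightarrow> complex) \<Rightarrow> bool" where
  "moderate_growth \<Psi> \<longleftrightarrow>
     (\<forall>g\<in>SL2Z. \<exists>(C::real) (N::nat). \<forall>z\<in>fund_domain. cmod (\<Psi> (act g z)) \<le> C * Im z ^ N)"


section \<open>Oldforms, newforms, orthonormal bases\<close>

global_interpretation cfun: vector_space "\<lambda>(c::complex) (f::complex \<Rightarrow> complex) z. c * f z"
  defines cfun_span = cfun.span
  by unfold_locales (auto simp: algebra_simps fun_eq_iff)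

definition dilate :: "nat \<Rightarrow> nat \<Rightarrow> (complex \<Rightarrow> complex) \<Rightarrow> complex \<Rightarrow> complex" where
  "dilate k d \<phi> z = of_real (real d powr (real k / 2)) * \<phi> (of_nat d * z)"

definition oldspace :: "nat \<Rightarrow> nat \<Rightarrow> (complex \<Rightarrow> complex) set" where
  "oldspace k l = cfun_span
     {dilate k d \<phi> | l' d \<phi>. l' dvd l \<and> l' \<noteq> l \<and> d dvd l div l' \<and> \<phi> \<in> cusp_forms k l'}"

definition newspace :: "real \<Rightarrow> nat \<Rightarrow> nat \<Rightarrow> (complex \<Rightarrow> complex) set" where
  "newspace V k l = {f \<in> cusp_forms k l. \<forall>g\<in>oldspace k l. petersson V k l f g = 0}"

text \<open>Bases are finite because the spaces of cusp forms are finite-dimensional.\<close>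

definition orthonormal_basis ::
  "real \<Rightarrow> nat \<Rightarrow> nat \<Rightarrow> (complex \<Rightarrow> complex) set \<Rightarrow> (complex \<Rightarrow> complex) set \<Rightarrow> bool" where
  "orthonormal_basis V k l S B \<longleftrightarrow>
     finite B \<and> cfun_span B = S \<and>
     (\<forall>f\<in>B. \<forall>g\<in>B. petersson V k l f g = (if f = g then 1 else 0))"


section \<open>Hecke operators and the Moebius function\<close>

definition hecke :: "nat \<Rightarrow> nat \<Rightarrow> (complex \<Rightarrow> complex) \<Rightarrow> complex \<Rightarrow> complex" where
  "hecke k n \<phi> z = of_real (1 / sqrt (real n)) *
     (\<Sum>(a, c) | a * c = n. \<Sum>b<c.
        of_real ((real a / real c) powr (real k / 2)) *
        \<phi> ((of_nat a * z + of_nat b) / of_nat c))"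

definition mu :: "nat \<Rightarrow> int" where
  "mu n = (if squarefree n then (-1) ^ card (prime_factors n) else 0)"

end

theory Submission
  imports Defs "HOL-Complex_Analysis.Conformal_Mappings"
begin

text \<open>
  For squarefree divisors \<open>d\<close>, \<open>e\<close> of \<open>q\<close> the forms \<open>\<phi>|\<^sub>d\<close> with \<open>\<phi>\<close> of level \<open>q/(de)\<close> are exactly the
  forms of level \<open>q\<close> that are fixed by \<open>z \<mapsto> z + 1/d\<close> and by the lower unipotent matrix with entry
  \<open>q/e\<close>. Because \<open>p\<^sup>3 | q\<close> for all \<open>p | q\<close>, the commutators of these upper and lower unipotents lie in
  \<open>\<Gamma>\<^sub>0(q)\<close>, so that averaging over \<open>z \<mapsto> z + i/d\<close> and over the lower unipotents with entries \<open>jq/e\<close>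
  are commuting orthogonal projections, whose product projects onto the old forms attached to
  \<open>(d, e)\<close>. Inclusion-exclusion turns these into the projection onto the newspace, and
  the trace of the sesquilinear form \<open>\<langle>f, \<Psi> T\<^sub>n g\<rangle>\<close> over a subspace depends linearly on the
  orthogonal projection. The old forms \<open>\<phi>|\<^sub>d\<close> form an orthonormal basis because two fundamental domains
  of one group give the same integral of an invariant function.
\<close>

section \<open>Real matrices and the slash operator\<close>

text \<open>The matrix \<open>diag(d, 1)\<close> conjugates \<open>\<Gamma>\<^sub>0(q/(de))\<close>
  to a group that contains \<open>\<Gamma>\<^sub>0(q)\<close> with index \<open>de\<close> and
  arises from it by adjoining the two unipotents. With \<open>x = i/d\<close> and
  \<open>y = jq/e\<close> the entries of their commutator involve \<open>xy\<close>,
  \<open>x^2 y\<close> and \<open>x y^2\<close>, so it lies in \<open>\<Gamma>\<^sub>0(q)\<close> as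
  soon as \<open>d^2 e\<close> and \<open>d e^2\<close> divide \<open>q\<close>; a prime dividing
  both \<open>d\<close> and \<open>e\<close> accounts for the cube. The sieve rests on one fact. If
  \<open>g\<close> is fixed by translation by \<open>1/p\<close>, then so is its projection for
  \<open>(d, e)\<close>, which by Bezout is fixed by \<open>1/(pd)\<close>. Hence the projections of
  a form for \<open>(d, e)\<close> and \<open>(pd, e)\<close> pair equally with \<open>g\<close>,
  and the signs of \<mu> cancel them. The alternating sum is therefore orthogonal to all old forms,
  while each of its terms except \<open>(1, 1)\<close> is old; this characterises the projection
  onto the newspace. Domains of the conjugated groups are never constructed. Nonnegative functions
  whose sum over the group is almost everywhere constant replace them, because pulling back, adding
  translates and enlarging the group all yield such functions again. The constant is 2 for
  \<open>SL2(Z)\<close>, as \<open>M\<close> and \<open>-M\<close> act alike.\<close>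

definition mat22 :: "real \<Rightarrow> real \<Rightarrow> real \<Rightarrow> real \<Rightarrow> real^2^2" where
  "mat22 a b c d = vector [vector [a, b], vector [c, d]]"

lemma mat22_nth [simp]:
  "mat22 a b c d $ 1 $ 1 = a" "mat22 a b c d $ 1 $ 2 = b" "mat22 a b c d $ 2 $ 1 = c" "mat22 a b c d $ 2 $ 2 = d"
  by (simp_all add: mat22_def)

lemma mat22_eta: "M = mat22 (M$1$1) (M$1$2) (M$2$1) (M$2$2)"
  by (simp add: vec_eq_iff forall_2)

lemma mat22_eq_iff [simp]: "mat22 a b c d = mat22 a' b' c' d' \<longleftrightarrow> a = a' \<and> b = b' \<and> c = c' \<and> d = d'"
  by (metis mat22_nth)

lemma matrix_mul_nth:
  fixes M N :: "'a::semiring_1^2^2"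
  shows "(M ** N) $ i $ j = M$i$1 * N$1$j + M$i$2 * N$2$j"
  by (simp add: matrix_matrix_mult_def sum_2)

lemma mat22_mult [simp]: "mat22 a b c d ** mat22 a' b' c' d' = mat22 (a*a' + b*c') (a*b' + b*d') (c*a' + d*c') (c*b' + d*d')"
  by (simp add: vec_eq_iff forall_2 matrix_mul_nth)

lemma det_mat22 [simp]: "det (mat22 a b c d) = a * d - b * c"
  by (simp add: det_2)

lemma mat_1_eq_mat22: "mat 1 = mat22 1 0 0 1"
  by (simp add: vec_eq_iff forall_2 mat_def)

text \<open>The automorphy factor \<open>j(M, z)\<close>, for real matrices since dilations and
  translations by \<open>1/d\<close> must be covered.\<close>

definition den :: "real^2^2 \<Rightarrow> complex \<Rightarrow> complex" where
  "den M z = of_real (M$2$1) * z + of_real (M$2$2)"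

definition mob :: "real^2^2 \<Rightarrow> complex \<Rightarrow> complex" where
  "mob M z = (of_real (M$1$1) * z + of_real (M$1$2)) / den M z"

lemma den_nonzero:
  assumes "det M > 0" "Im z > 0" shows "den M z \<noteq> 0"
proof
  assume "den M z = 0"
  then have "M$2$1 * Im z = 0" "M$2$1 * Re z + M$2$2 = 0"
    by (auto simp: den_def complex_eq_iff)
  with assms show False by (auto simp: det_2)
qed

text \<open>There is no hypothesis: division by zero yields 0, so both sides vanish where
  \<open>den M z = 0\<close>. This lets the formula be used off the upper half-plane too.\<close>

lemma Im_mob:
  shows "Im (mob M z) = det M * Im z / (cmod (den M z))\<^sup>2"
proof -
  have "Im (mob M z) = (M$1$1 * Im z * (M$2$1 * Re z + M$2$2) - (M$1$1 * Re z + M$1$2) * (M$2$1 * Im z)) / (cmod (den M z))\<^sup>2"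
    unfolding mob_def Im_divide cmod_power2 by (simp add: den_def)
  also have "M$1$1 * Im z * (M$2$1 * Re z + M$2$2) - (M$1$1 * Re z + M$1$2) * (M$2$1 * Im z) = det M * Im z"
    by (simp add: det_2 algebra_simps)
  finally show ?thesis .
qed

lemma Im_mob_pos:
  assumes "det M > 0" "Im z > 0" shows "Im (mob M z) > 0"
  using assms den_nonzero[OF assms] by (simp add: Im_mob)

lemma den_mult:
  assumes "den N z \<noteq> 0"
  shows "den (M ** N) z = den M (mob N z) * den N z"
proof -
  have "den M (mob N z) * den N z
      = of_real (M$2$1) * (mob N z * den N z) + of_real (M$2$2) * den N z"
    by (simp add: den_def algebra_simps)
  also have "mob N z * den N z = of_real (N$1$1) * z + of_real (N$1$2)"
    using assms by (simp add: mob_def)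
  also have "of_real (M$2$1) * \<dots> + of_real (M$2$2) * den N z = den (M ** N) z"
    by (simp add: den_def matrix_mul_nth algebra_simps)
  finally show ?thesis by simp
qed

lemma mob_mult:
  assumes "den N z \<noteq> 0" 
  shows "mob (M ** N) z = mob M (mob N z)"
proof -
  have "(of_real (M$1$1) * mob N z + of_real (M$1$2)) * den N z
      = of_real (M$1$1) * (mob N z * den N z) + of_real (M$1$2) * den N z"
    by (simp add: algebra_simps)
  also have "mob N z * den N z = of_real (N$1$1) * z + of_real (N$1$2)"
    using assms by (simp add: mob_def)
  also have "of_real (M$1$1) * \<dots> + of_real (M$1$2) * den N z
     = of_real ((M ** N)$1$1) * z + of_real ((M ** N)$1$2)"
    by (simp add: den_def matrix_mul_nth algebra_simps)
  finally have eq: "of_real ((M ** N)$1$1) * z + of_real ((M ** N)$1$2) =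
      (of_real (M$1$1) * mob N z + of_real (M$1$2)) * den N z" by simp
  show ?thesis
    unfolding mob_def[of "M ** N"] den_mult[OF assms] eq using assms
    by (simp add: mob_def[of M])
qed

lemma mob_mult_H:
  "det N > 0 \<Longrightarrow> Im z > 0 \<Longrightarrow> mob (M ** N) z = mob M (mob N z)"
  by (rule mob_mult[OF den_nonzero])

lemma mob_mat_1 [simp]: "mob (mat 1) z = z" and den_mat_1 [simp]: "den (mat 1) z = 1"
  by (simp_all add: mob_def den_def mat_1_eq_mat22)

text \<open>The factor \<open>det^(k/2)\<close> makes positive scalar matrices act trivially and
  turns \<open>dilate k d\<close> into the slash by \<open>diag(d, 1)\<close>. The cut to 0 off the
  half-plane keeps equality of forms an equality of functions.\<close>

definition slash :: "nat \<Rightarrow> real^2^2 \<Rightarrow> (complex \<Rightarrow> complex) \<Rightarrow> complex \<Rightarrow> complex" where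
  "slash k M f z =
     (if Im z > 0 then of_real (det M powr (real k / 2)) * f (mob M z) / den M z ^ k else 0)"

lemma slash_off [simp]: "\<not> Im z > 0 \<Longrightarrow> slash k M f z = 0"
  by (simp add: slash_def)

lemma slash_slash:
  assumes "det M > 0" "det N > 0"
  shows "slash k N (slash k M f) = slash k (M ** N) f"
proof
  fix z
  show "slash k N (slash k M f) z = slash k (M ** N) f z"
  proof (cases "Im z > 0")
    case True
    with assms show ?thesis
      by (simp add: slash_def Im_mob_pos mob_mult_H den_mult den_nonzero det_mul powr_mult power_mult_distrib)
  qed simp
qed

lemma slash_mat_1 [simp]: "(\<And>z. \<not> Im z > 0 \<Longrightarrow> f z = 0) \<Longrightarrow> slash k (mat 1) f = f"
  by (auto simp: slash_def fun_eq_iff)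

text \<open>The factor \<open>den^k\<close> is absorbed by the imaginary part of the image point.
  Consequently any bound for \<open>|f| y^(k/2)\<close> passes to all slashes of
  \<open>f\<close>.\<close>

lemma slash_norm:
  assumes "det M > 0" "Im z > 0"
  shows "cmod (slash k M f z) * Im z powr (real k / 2) = cmod (f (mob M z)) * Im (mob M z) powr (real k / 2)"
proof -
  have n: "cmod (den M z) > 0" using den_nonzero[OF assms] by simp
  have "((cmod (den M z))\<^sup>2) powr (real k / 2) = cmod (den M z) powr (real k)"
    using n by (simp flip: powr_numeral add: powr_powr)
  also have "\<dots> = cmod (den M z) ^ k" using n by (simp add: powr_realpow)
  finally have "Im (mob M z) powr (real k / 2) = det M powr (real k / 2) * Im z powr (real k / 2) / cmod (den M z) ^ k"
    using assms n by (simp add: Im_mob powr_divide powr_mult)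
  then show ?thesis using assms by (simp add: slash_def norm_mult norm_divide norm_power)
qed

lemma slash_hol:
  assumes "f holomorphic_on upper_half_plane" "det M > 0"
  shows "slash k M f holomorphic_on upper_half_plane"
proof -
  have "(\<lambda>z. f (mob M z)) holomorphic_on upper_half_plane"
  proof -
    have "mob M holomorphic_on upper_half_plane"
      unfolding mob_def[abs_def] den_def[abs_def]
      using den_nonzero[OF assms(2)]
      by (intro holomorphic_intros) (auto simp: upper_half_plane_def den_def)
    from holomorphic_on_compose_gen[OF this assms(1)] show ?thesis
      using Im_mob_pos[OF assms(2)] by (auto simp: upper_half_plane_def o_def)
  qed
  then have "(\<lambda>z. of_real (det M powr (real k / 2)) * f (mob M z) / den M z ^ k) holomorphic_on upper_half_plane"
    using den_nonzero[OF assms(2)]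
    by (intro holomorphic_intros) (auto simp: upper_half_plane_def den_def[abs_def] intro!: holomorphic_intros)
  then show ?thesis
    by (rule holomorphic_transform) (auto simp: slash_def upper_half_plane_def)
qed

lemma slash_add: "slash k M (\<lambda>z. f z + g z) = (\<lambda>z. slash k M f z + slash k M g z)"
  by (auto simp: slash_def fun_eq_iff algebra_simps add_divide_distrib)

lemma slash_cmult: "slash k M (\<lambda>z. c * f z) = (\<lambda>z. c * slash k M f z)"
  by (auto simp: slash_def fun_eq_iff)

lemma slash_sum: "slash k M (\<lambda>z. \<Sum>i\<in>I. f i z) = (\<lambda>z. \<Sum>i\<in>I. slash k M (f i) z)"
  by (auto simp: slash_def fun_eq_iff sum_distrib_left sum_divide_distrib)

section \<open>Integral matrices and the groups \<open>GG x y\<close>\<close>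

definition rmat :: "int^2^2 \<Rightarrow> real^2^2" where
  "rmat g = mat22 (of_int (g$1$1)) (of_int (g$1$2)) (of_int (g$2$1)) (of_int (g$2$2))"

lemma act_eq_mob: "act g = mob (rmat g)"
  by (auto simp: act_def moebius_def mob_def den_def rmat_def fun_eq_iff)

lemma autfactor_eq_den: "autfactor g = den (rmat g)"
  by (auto simp: autfactor_def den_def rmat_def fun_eq_iff)

lemma rmat_mult: "rmat (g ** h) = rmat g ** rmat h"
  by (simp add: rmat_def matrix_mul_nth)

lemma det_rmat: "det (rmat g) = of_int (det g)"
  by (simp add: rmat_def det_2)

lemma rmat_eq_iff [simp]: "rmat g = rmat h \<longleftrightarrow> g = h"
  by (simp add: rmat_def vec_eq_iff forall_2)

text \<open>
  \<open>GG x y\<close> is a group whenever \<open>y / x\<close> is an integer. The instance \<open>GG 1 q\<close> is \<open>\<Gamma>\<^sub>0(q)\<close>, and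
  \<open>GG d (q / e)\<close> is the conjugate of \<open>\<Gamma>\<^sub>0(q/(de))\<close> that fixes the forms \<open>\<phi>|\<^sub>d\<close>.
\<close>
definition GG :: "nat \<Rightarrow> nat \<Rightarrow> (real^2^2) set" where
  "GG x y = {mat22 (of_int a) (of_int b / of_nat x) (of_int c * of_nat y) (of_int d) | a b c d.
     of_int a * of_int d - (of_int b / of_nat x) * (of_int c * of_nat y) = (1::real)}"

lemma GG_det: "M \<in> GG x y \<Longrightarrow> det M = 1"
  by (auto simp: GG_def)

text \<open>The diagonal entries of the product contain the cross terms
  \<open>b * c' * (y / x)\<close>; divisibility of \<open>y\<close> by \<open>x\<close> keeps them
  integral.\<close>

lemma GG_mult:
  assumes "x > 0" "x dvd y" "M \<in> GG x y" "N \<in> GG x y" shows "M ** N \<in> GG x y"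
proof -
  from assms obtain a b c d a' b' c' d' where
    M: "M = mat22 (of_int a) (of_int b / of_nat x) (of_int c * of_nat y) (of_int d)" and
    N: "N = mat22 (of_int a') (of_int b' / of_nat x) (of_int c' * of_nat y) (of_int d')"
    unfolding GG_def by blast
  have det1: "det (M ** N) = 1" using assms by (simp add: det_mul GG_det)
  obtain r where y: "y = x * r" using assms by auto
  have MN: "M ** N = mat22 (of_int (a*a' + b*c'*int r)) (of_int (a*b' + b*d') / of_nat x)
        (of_int (c*a' + d*c') * of_nat y) (of_int (c*b'*int r + d*d'))"
    unfolding M N using assms(1) by (simp add: y field_simps)
  show ?thesis using det1 unfolding MN GG_def by (simp del: of_int_mult of_int_add) blast
qed

definition minv :: "real^2^2 \<Rightarrow> real^2^2" where
  "minv M = mat22 (M$2$2) (- M$1$2) (- M$2$1) (M$1$1)"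

lemma minv_mult: "det M = 1 \<Longrightarrow> minv M ** M = mat 1" "det M = 1 \<Longrightarrow> M ** minv M = mat 1"
  using mat22_eta[of M] by (auto simp: minv_def mat_1_eq_mat22 det_2 matrix_mul_nth vec_eq_iff forall_2 algebra_simps)

lemma det_minv [simp]: "det (minv M) = det M"
  by (simp add: minv_def det_2)

lemma minv_minv [simp]: "minv (minv M) = M"
  by (simp add: minv_def flip: mat22_eta)

lemma GG_minv: "M \<in> GG x y \<Longrightarrow> minv M \<in> GG x y"
proof -
  assume "M \<in> GG x y"
  then obtain a b c d where
    M: "M = mat22 (of_int a) (of_int b / of_nat x) (of_int c * of_nat y) (of_int d)" and
    D: "of_int a * of_int d - (of_int b / of_nat x) * (of_int c * of_nat y) = (1::real)"
    by (auto simp: GG_def)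
  have "minv M = mat22 (of_int d) (of_int (-b) / of_nat x) (of_int (-c) * of_nat y) (of_int a)"
    by (simp add: M minv_def)
  moreover have "of_int d * of_int a - (of_int (-b) / of_nat x) * (of_int (-c) * of_nat y) = (1::real)"
    using D by (simp add: mult.commute)
  ultimately show ?thesis unfolding GG_def by blast
qed

lemma GG_one: "mat 1 \<in> GG x y"
  unfolding GG_def mat_1_eq_mat22 by (rule CollectI, rule exI[of _ 1], rule exI[of _ 0], rule exI[of _ 0], rule exI[of _ 1]) simp

lemma GG_countable: "countable (GG x y)"
proof -
  have "GG x y \<subseteq> (\<lambda>(a,b,c,d). mat22 (of_int a) (of_int b / of_nat x) (of_int c * of_nat y) (of_int d)) ` (UNIV :: (int\<times>int\<times>int\<times>int) set)"
    unfolding GG_def by (force simp: image_def)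
  then show ?thesis by (rule countable_subset) simp
qed

lemma Gamma0_GG: "rmat ` Gamma0 l = GG 1 l"
proof (intro equalityI subsetI)
  fix M assume "M \<in> rmat ` Gamma0 l"
  then obtain g where g: "g \<in> Gamma0 l" "M = rmat g" by auto
  then obtain c where c: "g$2$1 = int l * c" by (auto simp: Gamma0_def)
  have d: "g$1$1 * g$2$2 - g$1$2 * g$2$1 = 1" using g by (simp add: Gamma0_def SL2Z_def det_2)
  have "M = mat22 (of_int (g$1$1)) (of_int (g$1$2) / of_nat 1) (of_int c * of_nat l) (of_int (g$2$2))"
    by (simp add: g rmat_def c)
  moreover have "of_int (g$1$1) * of_int (g$2$2) - (of_int (g$1$2) / of_nat 1) * (of_int c * of_nat l) = (1::real)"
    using arg_cong[OF d, of real_of_int] by (simp add: c mult_ac)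
  ultimately show "M \<in> GG 1 l" unfolding GG_def by blast
next
  fix M assume "M \<in> GG 1 l"
  then obtain a b c d where
    M: "M = mat22 (of_int a) (of_int b) (of_int c * of_nat l) (of_int d)" and
    D: "of_int a * of_int d - of_int b * (of_int c * of_nat l) = (1::real)"
    by (auto simp: GG_def)
  define g :: "int^2^2" where "g = vector [vector [a,b], vector [c * int l, d]]"
  have "real_of_int (a * d - b * (c * int l)) = of_int 1" using D by simp
  then have "a * d - b * (c * int l) = 1" by linarith
  then have "g \<in> Gamma0 l" by (simp add: g_def Gamma0_def SL2Z_def det_2)
  moreover have "M = rmat g" by (simp add: M g_def rmat_def)
  ultimately show "M \<in> rmat ` Gamma0 l" by blast
qed

lemma SL2Z_GG: "rmat ` SL2Z = GG 1 1"
proof -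
  have "Gamma0 1 = SL2Z" by (auto simp: Gamma0_def)
  with Gamma0_GG[of 1] show ?thesis by simp
qed

section \<open>Invariance of the hyperbolic measure\<close>

text \<open>Unlike \<open>hyp_measure\<close>, this measure has no mass off the upper half-plane, so
  that identities valid there hold almost everywhere.\<close>

definition hyp_H :: "complex measure" where
  "hyp_H = density lborel (\<lambda>z. if Im z > 0 then ennreal (1 / (Im z)\<^sup>2) else 0)"

lemma sets_hyp_H [simp, measurable_cong]: "sets hyp_H = sets borel" and space_hyp_H [simp]: "space hyp_H = UNIV"
  by (simp_all add: hyp_H_def)

lemma hyp_H_dens_meas [measurable]:
  "(\<lambda>z. if Im z > 0 then ennreal (1 / (Im z)\<^sup>2) else 0) \<in> borel_measurable borel"
  by measurable

lemma nn_integral_hyp_H: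
  "f \<in> borel_measurable borel \<Longrightarrow>
   (\<integral>\<^sup>+z. f z \<partial>hyp_H) = (\<integral>\<^sup>+z. (if Im z > 0 then ennreal (1 / (Im z)\<^sup>2) else 0) * f z \<partial>lborel)"
  unfolding hyp_H_def by (subst nn_integral_density) auto

lemma AE_hyp_H: "AE z in hyp_H. Im z > 0"
  unfolding hyp_H_def by (subst AE_density) (auto split: if_splits)

lemma mob_meas [measurable]: "mob M \<in> borel_measurable borel"
  unfolding mob_def[abs_def] den_def[abs_def] by measurable

text \<open>The Jacobian \<open>a^2\<close> of the affine map cancels the factor that
  \<open>(Im z)^2\<close> picks up.\<close>

lemma distr_hyp_H_affine:
  assumes "a > 0"
  shows "distr hyp_H borel (mob (mat22 a b 0 1)) = hyp_H"
proof (rule measure_eqI)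
  fix A assume "A \<in> sets (distr hyp_H borel (mob (mat22 a b 0 1)))"
  then have A [measurable]: "A \<in> sets borel" by simp
  let ?w = "\<lambda>z. if Im z > 0 then ennreal (1 / (Im z)\<^sup>2) else 0"
  have m: "mob (mat22 a b 0 1) z = of_real b + a *\<^sub>R z" for z
    by (simp add: mob_def den_def scaleR_conv_of_real)
  have "emeasure hyp_H A = (\<integral>\<^sup>+z. indicator A z \<partial>hyp_H)" by simp
  also have "\<dots> = (\<integral>\<^sup>+z. ?w z * indicator A z \<partial>lborel)" by (rule nn_integral_hyp_H) measurable
  also have "\<dots> = (\<integral>\<^sup>+z. ?w z * indicator A z \<partial>(density (distr lborel borel (\<lambda>x. of_real b + a *\<^sub>R x)) (\<lambda>_. \<bar>a\<bar>^DIM(complex))))"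
    using lborel_affine[of a "of_real b :: complex"] assms by simp
  also have "\<dots> = (\<integral>\<^sup>+z. ennreal (a\<^sup>2) * (?w (of_real b + a *\<^sub>R z) * indicator A (of_real b + a *\<^sub>R z)) \<partial>lborel)"
    using assms by (subst nn_integral_density) (auto simp: nn_integral_distr)
  also have "\<dots> = (\<integral>\<^sup>+z. ?w z * indicator (mob (mat22 a b 0 1) -` A) z \<partial>lborel)"
  proof (rule nn_integral_cong)
    fix z
    have "ennreal (a\<^sup>2) * ?w (of_real b + a *\<^sub>R z) = ?w z"
      using assms by (auto simp: ennreal_mult[symmetric] zero_less_mult_iff power_mult_distrib)
    then show "ennreal (a\<^sup>2) * (?w (of_real b + a *\<^sub>R z) * indicator A (of_real b + a *\<^sub>R z)) = ?w z * indicator (mob (mat22 a b 0 1) -` A) z"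
      by (simp add: m mult.assoc[symmetric] indicator_def)
  qed
  also have "\<dots> = (\<integral>\<^sup>+z. indicator (mob (mat22 a b 0 1) -` A) z \<partial>hyp_H)"
    by (rule nn_integral_hyp_H[symmetric]) (use measurable_sets[OF mob_meas A, of "mat22 a b 0 1"] in auto)
  also have "\<dots> = emeasure (distr hyp_H borel (mob (mat22 a b 0 1))) A"
    using measurable_sets[OF mob_meas A, of "mat22 a b 0 1"] by (subst emeasure_distr) auto
  finally show "emeasure (distr hyp_H borel (mob (mat22 a b 0 1))) A = emeasure hyp_H A" by simp
qed simp

text \<open>The change of variables theorem of the library needs coordinates that are indexed by a well-ordered type.\<close>
definition to_vec :: "complex \<Rightarrow> real^Enum.finite_2" where
  "to_vec z = (\<chi> i. if i = finite_2.a\<^sub>1 then Re z else Im z)"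

definition of_vec :: "real^Enum.finite_2 \<Rightarrow> complex" where
  "of_vec v = Complex (v $ finite_2.a\<^sub>1) (v $ finite_2.a\<^sub>2)"

lemma of_to_vec [simp]: "of_vec (to_vec z) = z" and to_of_vec [simp]: "to_vec (of_vec v) = v"
  subgoal by (simp add: of_vec_def to_vec_def)
  subgoal by (auto simp: of_vec_def to_vec_def vec_eq_iff)
  done

lemma Basis_vec2: "(Basis :: (real^Enum.finite_2) set) = {axis finite_2.a\<^sub>1 1, axis finite_2.a\<^sub>2 1}"
  by (auto simp: Basis_vec_def) (metis finite_2.exhaust)+

lemma of_vec_meas [measurable]: "of_vec \<in> borel_measurable borel"
proof -
  have "continuous_on UNIV (\<lambda>v::real^Enum.finite_2. Complex (v $ finite_2.a\<^sub>1) (v $ finite_2.a\<^sub>2))"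
    by (intro continuous_intros)
  then show ?thesis unfolding of_vec_def[abs_def] by (rule borel_measurable_continuous_onI)
qed

lemma to_vec_meas [measurable]: "to_vec \<in> borel_measurable borel"
proof -
  have "continuous_on UNIV (\<lambda>z. (\<chi> i. if i = finite_2.a\<^sub>1 then Re z else Im z) :: real^Enum.finite_2)"
  proof (rule continuous_on_vec_lambda)
    show "continuous_on UNIV (\<lambda>z. if i = finite_2.a\<^sub>1 then Re z else Im z)" for i :: Enum.finite_2
      by (cases "i = finite_2.a\<^sub>1") (auto intro!: continuous_intros)
  qed
  then show ?thesis unfolding to_vec_def[abs_def] by (rule borel_measurable_continuous_onI)
qed

lemma distr_of_vec: "distr lborel borel of_vec = lborel"
proof (rule lborel_eqI[symmetric])
  fix l u :: complex
  assume le: "\<And>b. b \<in> Basis \<Longrightarrow> l \<bullet> b \<le> u \<bullet> b"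
  have ne: "axis finite_2.a\<^sub>1 (1::real) \<noteq> axis finite_2.a\<^sub>2 1" by (simp add: axis_eq_axis)
  have "of_vec -` box l u = box (to_vec l) (to_vec u)"
    by (auto simp: box_def Basis_vec2 inner_axis Basis_complex_def to_vec_def of_vec_def)
  moreover have "of_vec -` box l u = of_vec -` box l u \<inter> space borel" by simp
  ultimately have "emeasure (distr lborel borel of_vec) (box l u) = emeasure lborel (box (to_vec l) (to_vec u))"
    by (subst emeasure_distr) auto
  also have "\<dots> = (\<Prod>b\<in>Basis. (to_vec u - to_vec l) \<bullet> b)"
    by (subst emeasure_lborel_box) (use le[of 1] le[of \<i>] in \<open>auto simp: Basis_vec2 inner_axis to_vec_def Basis_complex_def\<close>)
  also have "\<dots> = (\<Prod>b\<in>Basis. (u - l) \<bullet> b)"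
    using ne by (simp add: Basis_vec2 Basis_complex_def inner_axis to_vec_def)
  finally show "emeasure (distr lborel borel of_vec) (box l u) = (\<Prod>b\<in>Basis. (u - l) \<bullet> b)" .
qed simp

abbreviation "invol \<equiv> mob (mat22 0 (-1) 1 0)"

lemma det_finite_2:
  fixes A :: "real^Enum.finite_2^Enum.finite_2"
  shows "det A = A $ finite_2.a\<^sub>1 $ finite_2.a\<^sub>1 * A $ finite_2.a\<^sub>2 $ finite_2.a\<^sub>2 - A $ finite_2.a\<^sub>1 $ finite_2.a\<^sub>2 * A $ finite_2.a\<^sub>2 $ finite_2.a\<^sub>1"
proof -
  have f: "finite {finite_2.a\<^sub>2}" "finite_2.a\<^sub>1 \<notin> {finite_2.a\<^sub>2}" by auto
  have U: "(UNIV :: Enum.finite_2 set) = {finite_2.a\<^sub>1, finite_2.a\<^sub>2}" 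
    using finite_2.exhaust by auto
  show ?thesis
    unfolding det_def U
    unfolding sum_over_permutations_insert[OF f] permutes_sing
    by (simp add: sign_swap_id sign_id swap_id_eq)
qed

lemma linear_of_vec: "bounded_linear of_vec"
  by (rule linear_conv_bounded_linear[THEN iffD1], unfold_locales) (auto simp: of_vec_def complex_eq_iff)

lemma linear_to_vec: "bounded_linear to_vec"
  by (rule linear_conv_bounded_linear[THEN iffD1], unfold_locales) (auto simp: to_vec_def vec_eq_iff)

text \<open>Translates between the measure and gauge integrals over the real plane, the form in
  which the change of variables theorem delivers its result.\<close>

lemma emeasure_hyp_H_vec:
  assumes B: "B \<in> sets borel" and pos: "\<And>z. z \<in> B \<Longrightarrow> Im z > 0"
    and I: "((\<lambda>v. 1 / (v $ finite_2.a\<^sub>2)\<^sup>2) has_integral I) (of_vec -` B)"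
  shows "emeasure hyp_H B = ennreal I"
proof -
  have "emeasure hyp_H B = (\<integral>\<^sup>+z. indicator B z \<partial>hyp_H)" using B by simp
  also have "\<dots> = (\<integral>\<^sup>+z. (if Im z > 0 then ennreal (1 / (Im z)\<^sup>2) else 0) * indicator B z \<partial>lborel)"
    by (rule nn_integral_hyp_H) (use B in measurable)
  also have "\<dots> = (\<integral>\<^sup>+z. ennreal (1 / (Im z)\<^sup>2) * indicator B z \<partial>(distr lborel borel of_vec))"
    unfolding distr_of_vec by (rule nn_integral_cong) (auto simp: indicator_def dest: pos)
  also have "\<dots> = (\<integral>\<^sup>+v. ennreal (1 / (v $ finite_2.a\<^sub>2)\<^sup>2) * indicator (of_vec -` B) v \<partial>lborel)"
    by (subst nn_integral_distr) (use B in \<open>auto simp: of_vec_def indicator_def intro!: nn_integral_cong\<close>)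
  also have "\<dots> = ennreal I"
    by (rule nn_integral_has_integral_lebesgue'[OF _ I]) auto
  finally show ?thesis .
qed

lemma invol_eq: "invol z = - 1 / z"
  by (simp add: mob_def den_def)

text \<open>Change of variables under \<open>-1/z\<close>: its Jacobian is \<open>|z|^(-4)\<close>,
  and \<open>Im (-1/z) = Im z / |z|^2\<close>. The box keeps the density bounded on a set of finite
  Lebesgue measure, which gives the absolute integrability that the theorem demands.\<close>

lemma invol_measure_bounded:
  assumes A: "A \<in> sets borel" and sub: "\<And>z. z \<in> A \<Longrightarrow> \<bar>Re z\<bar> \<le> r \<and> 1 / r \<le> Im z \<and> Im z \<le> r" and r: "r > 0"
  shows "emeasure hyp_H (invol -` A \<inter> {z. Im z > 0}) = emeasure hyp_H A"
proof -
  define h where "h v = 1 / (v $ finite_2.a\<^sub>2)\<^sup>2" for v :: "real^Enum.finite_2"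
  define A' where "A' = of_vec -` A"
  define g where "g v = to_vec (invol (of_vec v))" for v
  define g' where "g' v u = to_vec (1 / (of_vec v)\<^sup>2 * of_vec u)" for v u
  \<comment> \<open>The change of variables theorem is stated for vector-valued functions, so the
    density is wrapped into dimension one.\<close>
  define f :: "real^Enum.finite_2 \<Rightarrow> real^1" where "f v = vec (h v)" for v
  have A'm [measurable]: "A' \<in> sets borel" 
    unfolding A'_def using measurable_sets[OF of_vec_meas A] by simp
  have r': "1 / r > 0" using r by simp
  have posA: "Im z > 0" if "z \<in> A" for z using sub[OF that] r' by linarith
  have pos: "v $ finite_2.a\<^sub>2 > 0" "v $ finite_2.a\<^sub>2 \<ge> 1 / r" if "v \<in> A'" for v
    using sub[of "of_vec v"] posA[of "of_vec v"] that by (auto simp: A'_def of_vec_def)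
  have bnd: "norm (h v) \<le> r\<^sup>2" if "v \<in> A'" for v
  proof -
    have "(1/r)\<^sup>2 \<le> (v $ finite_2.a\<^sub>2)\<^sup>2" using pos[OF that] r' by (intro power_mono) auto
    then have "1 / (v $ finite_2.a\<^sub>2)\<^sup>2 \<le> 1 / (1/r)\<^sup>2" using r' by (intro divide_left_mono) (auto intro!: mult_pos_pos simp: pos(1)[OF that])
    then show ?thesis by (simp add: h_def power_divide)
  qed
  have "A' \<subseteq> cbox (to_vec (Complex (-r) (1/r))) (to_vec (Complex r r))"
    using sub by (force simp: A'_def cbox_def Basis_vec2 inner_axis to_vec_def of_vec_def)
  then have "emeasure lborel A' \<le> emeasure lborel (cbox (to_vec (Complex (-r) (1/r))) (to_vec (Complex r r)))"
    by (intro emeasure_mono) auto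
  also have "\<dots> < \<infinity>" by (rule emeasure_lborel_cbox_finite)
  finally have fin: "emeasure lborel A' < \<infinity>" .
  have "integrable lborel (\<lambda>v. indicator A' v *\<^sub>R h v)"
    by (rule integrableI_bounded_set_indicator[where B="r\<^sup>2"]) (use fin bnd in \<open>auto simp: h_def\<close>)
  then have hA: "h absolutely_integrable_on A'"
    by (simp add: set_integrable_def integrable_completion)
  then obtain I where I: "(h has_integral I) A'"
    using set_lebesgue_integral_eq_integral(1) by blast
  have nz: "of_vec v \<noteq> 0" if "v \<in> A'" for v using posA[of "of_vec v"] that by (auto simp: A'_def)
  have der: "(g has_derivative g' v) (at v within A')" if "v \<in> A'" for v
  proof -
    have "(invol has_field_derivative 1 / (of_vec v)\<^sup>2) (at (of_vec v))"
      unfolding invol_eq[abs_def] using nz[OF that]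
      by (auto intro!: derivative_eq_intros simp: power2_eq_square)
    then have d: "(invol has_derivative (\<lambda>u. 1 / (of_vec v)\<^sup>2 * u)) (at (of_vec v))"
      unfolding has_field_derivative_def .
    have "((\<lambda>v. invol (of_vec v)) has_derivative (\<lambda>u. 1 / (of_vec v)\<^sup>2 * of_vec u)) (at v within A')"
      using has_derivative_compose[OF bounded_linear_imp_has_derivative[OF linear_of_vec] d] .
    from bounded_linear.has_derivative[OF linear_to_vec this]
    show ?thesis by (simp add: g_def[abs_def] g'_def[abs_def])
  qed
  have inj: "inj_on g A'"
  proof (rule inj_onI)
    fix v w assume "v \<in> A'" "w \<in> A'" "g v = g w"
    then have "invol (of_vec v) = invol (of_vec w)" by (metis g_def of_to_vec)
    then have "of_vec v = of_vec w" by (simp add: invol_eq)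
    then show "v = w" by (metis to_of_vec)
  qed
  have detg: "\<bar>det (matrix (g' v))\<bar> *\<^sub>R f (g v) = f v" if "v \<in> A'" for v
  proof -
    define z where "z = of_vec v"
    define w where "w = 1 / z\<^sup>2"
    have z: "z \<noteq> 0" "Im z > 0" using nz[OF that] posA[of z] that by (auto simp: z_def A'_def)
    have ax: "of_vec (axis finite_2.a\<^sub>1 1) = 1" "of_vec (axis finite_2.a\<^sub>2 1) = \<i>"
      by (auto simp: of_vec_def axis_def complex_eq_iff)
    \<comment> \<open>Multiplication by a complex number \<open>w\<close>, as a real linear map, has
      determinant \<open>|w|^2\<close>.\<close>
    have "det (matrix (g' v)) = (cmod w)\<^sup>2"
      by (simp add: det_finite_2 matrix_def g'_def ax to_vec_def flip: z_def w_def)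
         (simp only: cmod_power2, simp add: power2_eq_square)
    also have "\<dots> = 1 / (cmod z)^4" by (simp add: w_def norm_divide norm_power power_divide)
    finally have d: "det (matrix (g' v)) = 1 / (cmod z)^4" .
    have "(g v) $ finite_2.a\<^sub>2 = Im z / (cmod z)\<^sup>2"
      unfolding g_def z_def[symmetric] to_vec_def Im_mob by (simp add: den_def)
    then have "h (g v) = (cmod z)^4 / (Im z)\<^sup>2" by (simp add: h_def power_divide)
    moreover have "h v = 1 / (Im z)\<^sup>2" by (simp add: h_def z_def of_vec_def)
    ultimately have "\<bar>det (matrix (g' v))\<bar> * h (g v) = h v" using z by (simp add: d)
    then show ?thesis by (simp add: f_def vec_eq_iff)
  qed
  have "(\<lambda>v. \<bar>det (matrix (g' v))\<bar> *\<^sub>R f (g v)) absolutely_integrable_on A' \<and>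
        integral A' (\<lambda>v. \<bar>det (matrix (g' v))\<bar> *\<^sub>R f (g v)) = vec I
       \<longleftrightarrow> f absolutely_integrable_on g ` A' \<and> integral (g ` A') f = vec I"
    by (rule has_absolute_integral_change_of_variables[OF _ der inj]) auto
  moreover have "(\<lambda>v. \<bar>det (matrix (g' v))\<bar> *\<^sub>R f (g v)) absolutely_integrable_on A' \<longleftrightarrow> f absolutely_integrable_on A'"
    by (rule set_integrable_cong) (auto simp: detg)
  moreover have "integral A' (\<lambda>v. \<bar>det (matrix (g' v))\<bar> *\<^sub>R f (g v)) = integral A' f"
    by (rule Henstock_Kurzweil_Integration.integral_cong) (auto simp: detg)
  moreover have fh: "(\<lambda>v. f v $ 1) = h" by (auto simp: f_def)
  moreover have "f absolutely_integrable_on A'" using hA by (simp add: absolutely_integrable_on_1_iff fh)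
  moreover have "integral A' f = vec I"
    using hA I by (subst integral_on_1_eq) (auto simp: fh)
  ultimately have *: "f absolutely_integrable_on g ` A'" "integral (g ` A') f = vec I" by auto
  then have "f integrable_on g ` A'" using set_lebesgue_integral_eq_integral(1) by blast
  then have "h integrable_on g ` A'" "integral (g ` A') h = I"
    using * by (auto simp: integrable_on_1_iff integral_on_1_eq fh vec_eq_iff)
  then have "(h has_integral I) (g ` A')" by (simp add: has_integral_iff)
  moreover have "g ` A' = of_vec -` (invol -` A \<inter> {z. Im z > 0})"
  proof (intro equalityI subsetI)
    fix u assume "u \<in> g ` A'"
    then obtain v where v: "v \<in> A'" "u = g v" by auto
    have "invol (invol (of_vec v)) = of_vec v" by (simp add: invol_eq)
    then show "u \<in> of_vec -` (invol -` A \<inter> {z. Im z > 0})"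
      using v posA[of "of_vec v"] by (auto simp: g_def A'_def intro!: Im_mob_pos)
  next
    fix u assume "u \<in> of_vec -` (invol -` A \<inter> {z. Im z > 0})"
    then have "to_vec (invol (of_vec u)) \<in> A'" "g (to_vec (invol (of_vec u))) = u"
      by (auto simp: A'_def g_def invol_eq)
    then show "u \<in> g ` A'" by (metis imageI)
  qed
  ultimately have I2: "(h has_integral I) (of_vec -` (invol -` A \<inter> {z. Im z > 0}))" by simp
  have "{z. Im z > 0} \<in> sets borel" by measurable
  then have m: "invol -` A \<inter> {z. Im z > 0} \<in> sets borel" using measurable_sets[OF mob_meas A, of "mat22 0 (-1) 1 0"] by auto
  have "emeasure hyp_H (invol -` A \<inter> {z. Im z > 0}) = ennreal I"
    by (rule emeasure_hyp_H_vec[OF m]) (use I2 in \<open>auto simp: h_def[abs_def]\<close>)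
  moreover have "emeasure hyp_H A = ennreal I"
    by (rule emeasure_hyp_H_vec[OF A posA]) (use I in \<open>auto simp: h_def[abs_def] A'_def\<close>)
  ultimately show ?thesis by simp
qed

lemma emeasure_hyp_H_H: "A \<in> sets borel \<Longrightarrow> emeasure hyp_H (A \<inter> {z. Im z > 0}) = emeasure hyp_H A"
  using AE_hyp_H by (intro emeasure_eq_AE) auto

text \<open>Exhaustion: the boxes \<open>K n\<close> increase to the upper half-plane, and on each
  the bounded case applies with \<open>r = n + 1\<close>.\<close>

lemma distr_hyp_H_invol: "distr hyp_H borel invol = hyp_H"
proof (rule measure_eqI)
  fix A assume "A \<in> sets (distr hyp_H borel invol)"
  then have A [measurable]: "A \<in> sets borel" by simp
  define K where "K n = {z. \<bar>Re z\<bar> \<le> real (Suc n) \<and> 1 / real (Suc n) \<le> Im z \<and> Im z \<le> real (Suc n)}" for n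
  have Km [measurable]: "K n \<in> sets borel" for n unfolding K_def by measurable
  have Hm [measurable]: "{z. Im z > 0} \<in> sets borel" by measurable
  have inc: "incseq K"
  proof (rule incseq_SucI, rule subsetI)
    fix n z assume "z \<in> K n"
    moreover have "1 / real (Suc (Suc n)) \<le> 1 / real (Suc n)" by (simp add: field_simps)
    ultimately show "z \<in> K (Suc n)" by (auto simp: K_def)
  qed
  have UK: "(\<Union>n. K n) = {z. Im z > 0}"
  proof (intro equalityI subsetI)
    fix z assume "z \<in> (\<Union>n. K n)"
    then obtain n where "1 / real (Suc n) \<le> Im z" by (auto simp: K_def)
    moreover have "1 / real (Suc n) > 0" by simp
    ultimately have "Im z > 0" by linarith
    then show "z \<in> {z. Im z > 0}" by simp
  next
    fix z assume "z \<in> {z. Im z > 0}"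
    then have z: "Im z > 0" by simp
    obtain n where n: "max (\<bar>Re z\<bar>) (max (Im z) (1 / Im z)) < real n" using reals_Archimedean2 by blast
    then have "1 / real (Suc n) \<le> Im z" using z by (simp add: field_simps)
    with n show "z \<in> (\<Union>n. K n)" by (auto simp: K_def intro!: exI[of _ n])
  qed
  have ivm: "invol -` X \<in> sets borel" if "X \<in> sets borel" for X
    using measurable_sets[OF mob_meas that, of "mat22 0 (-1) 1 0"] by simp
  have incK: "z \<in> K n" if "z \<in> K m" "m \<le> n" for z m n using incseqD[OF inc that(2)] that(1) by blast
  have ivn: "emeasure hyp_H (invol -` (A \<inter> K n) \<inter> {z. Im z > 0}) = emeasure hyp_H (A \<inter> K n)" for n
    by (rule invol_measure_bounded[where r="real (Suc n)"]) (auto simp: K_def)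
  have "emeasure hyp_H (invol -` A) = emeasure hyp_H (invol -` A \<inter> {z. Im z > 0})"
    by (rule emeasure_hyp_H_H[symmetric]) (rule ivm[OF A])
  also have "invol -` A \<inter> {z. Im z > 0} = (\<Union>n. invol -` (A \<inter> K n) \<inter> {z. Im z > 0})"
    using UK Im_mob_pos[of "mat22 0 (-1) 1 0"] by (auto simp: set_eq_iff)
  also have "emeasure hyp_H \<dots> = (SUP n. emeasure hyp_H (invol -` (A \<inter> K n) \<inter> {z. Im z > 0}))"
    by (rule SUP_emeasure_incseq[symmetric]) (use ivm incK in \<open>auto simp: incseq_def intro!: sets.Int\<close>)
  also have "\<dots> = (SUP n. emeasure hyp_H (A \<inter> K n))"
    by (simp only: ivn)
  also have "\<dots> = emeasure hyp_H (\<Union>n. A \<inter> K n)"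
    by (rule SUP_emeasure_incseq) (use incK in \<open>auto simp: incseq_def\<close>)
  also have "(\<Union>n. A \<inter> K n) = A \<inter> {z. Im z > 0}" using UK by blast
  also have "emeasure hyp_H \<dots> = emeasure hyp_H A" by (rule emeasure_hyp_H_H) (rule A)
  finally show "emeasure (distr hyp_H borel invol) A = emeasure hyp_H A"
    by (subst emeasure_distr) auto
qed simp

lemma distr_hyp_H_comp:
  assumes "distr hyp_H borel f = hyp_H" "distr hyp_H borel g = hyp_H" and [measurable]: "f \<in> borel_measurable borel" "g \<in> borel_measurable borel"
  shows "distr hyp_H borel (\<lambda>z. f (g z)) = hyp_H"
proof -
  have "distr hyp_H borel (\<lambda>z. f (g z)) = distr (distr hyp_H borel g) borel f"
    by (subst distr_distr) (auto simp: o_def)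
  then show ?thesis using assms by simp
qed

text \<open>Bruhat decomposition: if the lower left entry is nonzero, the map is an affine map after
  the inversion after a translation; otherwise it is affine already.\<close>

lemma distr_hyp_H_mob:
  assumes "det M > 0"
  shows "distr hyp_H borel (mob M) = hyp_H"
proof (cases "M $ 2 $ 1 = 0")
  case True
  with assms have d: "M$1$1 / M$2$2 > 0" "M$2$2 \<noteq> 0" 
    by (auto simp: det_2 zero_less_mult_iff zero_less_divide_iff)
  have "mob M = mob (mat22 (M$1$1 / M$2$2) (M$1$2 / M$2$2) 0 1)"
    using d(2) by (auto simp: fun_eq_iff mob_def den_def True field_simps)
  then show ?thesis using distr_hyp_H_affine[OF d(1)] by simp
next
  case False
  define c d where "c = M$2$1" and "d = M$2$2"
  have c: "c \<noteq> 0" using False by (simp add: c_def)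
  define N1 where "N1 = mat22 (det M / c\<^sup>2) (M$1$1 / c) 0 1"
  define N2 where "N2 = mat22 1 (d / c) 0 1"
  have "mob M z = mob N1 (invol (mob N2 z))" if "Im z > 0" for z
  proof -
    \<comment> \<open>The scalar matrix with entry \<open>c\<close> acts trivially; it only makes
      the matrix identity exact.\<close>
    have "M = N1 ** (mat22 0 (-1) 1 0 ** (mat22 c 0 0 c ** N2))"
      using c by (subst mat22_eta[of M]) (auto simp: N1_def N2_def det_2 c_def d_def field_simps power2_eq_square)
    moreover have pos: "Im (mob N2 z) > 0" "Im (mob (mat22 c 0 0 c ** N2) z) > 0" using that c 
      by (auto intro!: Im_mob_pos simp: N2_def det_mul simp flip: power2_eq_square)
    moreover have "det N2 > 0" "det (mat22 c 0 0 c) > 0" using c by (auto simp: N2_def simp flip: power2_eq_square)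
    moreover have "mob (mat22 c 0 0 c) u = u" for u using c by (simp add: mob_def den_def)
    ultimately show ?thesis using that by (simp add: mob_mult_H det_mul)
  qed
  then have "distr hyp_H borel (mob M) = distr hyp_H borel (\<lambda>z. mob N1 (invol (mob N2 z)))"
    using AE_hyp_H by (intro distr_cong_AE) auto
  also have "\<dots> = hyp_H"
  proof (rule distr_hyp_H_comp[of "mob N1" "\<lambda>z. invol (mob N2 z)"])
    show "distr hyp_H borel (mob N1) = hyp_H" using assms c distr_hyp_H_affine by (simp add: N1_def)
    show "distr hyp_H borel (\<lambda>z. invol (mob N2 z)) = hyp_H"
      using distr_hyp_H_affine[of 1] distr_hyp_H_invol by (intro distr_hyp_H_comp[of invol "mob N2"]) (simp_all add: N2_def)
  qed auto
  finally show ?thesis .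
qed

section \<open>Weights for groups acting on the upper half-plane\<close>

lemma nn_integral_hyp_H_mob:
  assumes "f \<in> borel_measurable borel" "det M > 0"
  shows "(\<integral>\<^sup>+z. f (mob M z) \<partial>hyp_H) = (\<integral>\<^sup>+z. f z \<partial>hyp_H)"
  using nn_integral_distr[of "mob M" hyp_H borel f] assms by (simp add: distr_hyp_H_mob)

lemma AE_hyp_H_mob:
  assumes "AE z in hyp_H. P z" "det M > 0"
  shows "AE z in hyp_H. P (mob M z)"
proof -
  from assms(1) obtain N where N: "{z. \<not> P z} \<subseteq> N" "emeasure hyp_H N = 0" "N \<in> sets borel"
    by (auto elim!: AE_E)
  have "emeasure hyp_H (mob M -` N) = emeasure (distr hyp_H borel (mob M)) N"
    using N(3) by (subst emeasure_distr) auto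
  then have "emeasure hyp_H (mob M -` N) = 0" using N distr_hyp_H_mob[OF assms(2)] by simp
  moreover have "mob M -` N \<in> sets hyp_H" using measurable_sets[OF mob_meas N(3), of M] by simp
  ultimately show ?thesis using N(1) by (intro AE_I[of _ _ "mob M -` N"]) auto
qed

lemma integral_hyp_H_mob:
  fixes F :: "complex \<Rightarrow> 'a::{banach, second_countable_topology}"
  assumes "F \<in> borel_measurable borel" "det M > 0"
  shows "(\<integral>z. F (mob M z) \<partial>hyp_H) = (\<integral>z. F z \<partial>hyp_H)"
    and "integrable hyp_H (\<lambda>z. F (mob M z)) \<longleftrightarrow> integrable hyp_H F"
  using integral_distr[of "mob M" hyp_H borel F] integrable_distr_eq[of "mob M" hyp_H borel F] assms
  by (simp_all add: distr_hyp_H_mob)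

text \<open>
  A weight of total mass \<open>c\<close> plays the role of (the indicator function of) a fundamental domain.
  Sums over the group are integrals for the counting measure.
\<close>
definition weight :: "(real^2^2) set \<Rightarrow> real \<Rightarrow> (complex \<Rightarrow> real) \<Rightarrow> bool" where
  "weight G c w \<longleftrightarrow> w \<in> borel_measurable borel \<and> (\<forall>z. 0 \<le> w z) \<and>
     (AE z in hyp_H. (\<integral>\<^sup>+M. ennreal (w (mob M z)) \<partial>count_space G) = ennreal c)"

text \<open>What the unfolding of integrals uses: countability to exchange sum and integral,
  inverses to reindex the sum, and determinant 1 so that inverses are given by
  \<open>minv\<close>.\<close>

definition invgroup :: "(real^2^2) set \<Rightarrow> bool" where
  "invgroup G \<longleftrightarrow> countable G \<and> (\<forall>M\<in>G. det M = 1 \<and> minv M \<in> G)"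

lemma invgroup_GG: "invgroup (GG x y)"
  by (auto simp: invgroup_def GG_countable GG_det GG_minv)

lemma mob_minv: "det M = 1 \<Longrightarrow> Im z > 0 \<Longrightarrow> mob (minv M) (mob M z) = z" "det M = 1 \<Longrightarrow> Im z > 0 \<Longrightarrow> mob M (mob (minv M) z) = z"
  by (simp_all flip: mob_mult_H add: minv_mult)

lemma bij_minv: "invgroup G \<Longrightarrow> bij_betw minv G G"
  by (rule bij_betwI[where g=minv]) (auto simp: invgroup_def)

text \<open>Unfolding: insert the sum of \<open>w'\<close> over the group into the integral of
  \<open>w\<close>, exchange sum and integral, substitute the inverse matrix in each term by
  invariance of measure and set, and fold back with \<open>w\<close> and \<open>w'\<close>
  interchanged.\<close>

lemma weight_set:
  assumes G: "invgroup G" and c: "c > 0" and w: "weight G c w" and w': "weight G c w'"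
    and A: "A \<in> sets borel" and inv: "\<And>M z. M \<in> G \<Longrightarrow> Im z > 0 \<Longrightarrow> mob M z \<in> A \<longleftrightarrow> z \<in> A"
  shows "(\<integral>\<^sup>+z. ennreal (w z) * indicator A z \<partial>hyp_H) = (\<integral>\<^sup>+z. ennreal (w' z) * indicator A z \<partial>hyp_H)"
proof -
  note [measurable] = A
  have [measurable]: "w \<in> borel_measurable borel" "w' \<in> borel_measurable borel"
    using w w' by (auto simp: weight_def)
  have cG: "countable G" using G by (simp add: invgroup_def)
  have D: "det M = 1" "minv M \<in> G" if "M \<in> G" for M using G that by (auto simp: invgroup_def)
  have AEw: "AE z in hyp_H. ennreal c * f z = (\<integral>\<^sup>+M. f z * ennreal (v (mob M z)) \<partial>count_space G)" if "weight G c v" for v f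
    using that[unfolded weight_def, THEN conjunct2, THEN conjunct2]
    by eventually_elim (simp add: nn_integral_cmult mult.commute)
  have "ennreal c * (\<integral>\<^sup>+z. ennreal (w z) * indicator A z \<partial>hyp_H) = (\<integral>\<^sup>+z. ennreal c * (ennreal (w z) * indicator A z) \<partial>hyp_H)"
    by (subst nn_integral_cmult) auto
  also have "\<dots> = (\<integral>\<^sup>+z. \<integral>\<^sup>+M. (ennreal (w z) * indicator A z) * ennreal (w' (mob M z)) \<partial>count_space G \<partial>hyp_H)"
    by (rule nn_integral_cong_AE) (rule AEw[OF w'])
  also have "\<dots> = (\<integral>\<^sup>+M. \<integral>\<^sup>+z. (ennreal (w z) * indicator A z) * ennreal (w' (mob M z)) \<partial>hyp_H \<partial>count_space G)"
    by (rule nn_integral_count_space_nn_integral[OF cG]) measurable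
  also have "\<dots> = (\<integral>\<^sup>+M. \<integral>\<^sup>+z. (ennreal (w' z) * indicator A z) * ennreal (w (mob (minv M) z)) \<partial>hyp_H \<partial>count_space G)"
  proof (rule nn_integral_cong)
    fix M assume "M \<in> space (count_space G)"
    then have M: "M \<in> G" by simp
    have "(\<integral>\<^sup>+z. (ennreal (w z) * indicator A z) * ennreal (w' (mob M z)) \<partial>hyp_H) =
       (\<integral>\<^sup>+z. (\<lambda>u. (ennreal (w' u) * indicator A u) * ennreal (w (mob (minv M) u))) (mob M z) \<partial>hyp_H)"
    proof (rule nn_integral_cong_AE)
      show "AE z in hyp_H. ennreal (w z) * indicator A z * ennreal (w' (mob M z)) =
                ennreal (w' (mob M z)) * indicator A (mob M z) * ennreal (w (mob (minv M) (mob M z)))"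
        using AE_hyp_H by eventually_elim (use inv M D in \<open>auto simp: mob_minv indicator_def mult_ac\<close>)
    qed
    also have "\<dots> = (\<integral>\<^sup>+z. (ennreal (w' z) * indicator A z) * ennreal (w (mob (minv M) z)) \<partial>hyp_H)"
      by (rule nn_integral_hyp_H_mob) (use D[OF M] in \<open>auto\<close>)
    finally show "(\<integral>\<^sup>+z. (ennreal (w z) * indicator A z) * ennreal (w' (mob M z)) \<partial>hyp_H) = \<dots>" .
  qed
  also have "\<dots> = (\<integral>\<^sup>+M. \<integral>\<^sup>+z. (ennreal (w' z) * indicator A z) * ennreal (w (mob M z)) \<partial>hyp_H \<partial>count_space G)"
    by (rule nn_integral_bij_count_space[OF bij_minv[OF G]])
  also have "\<dots> = (\<integral>\<^sup>+z. \<integral>\<^sup>+M. (ennreal (w' z) * indicator A z) * ennreal (w (mob M z)) \<partial>count_space G \<partial>hyp_H)"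
    by (rule nn_integral_count_space_nn_integral[OF cG, symmetric]) measurable
  also have "\<dots> = (\<integral>\<^sup>+z. ennreal c * (ennreal (w' z) * indicator A z) \<partial>hyp_H)"
    by (rule nn_integral_cong_AE[symmetric]) (rule AEw[OF w])
  also have "\<dots> = ennreal c * (\<integral>\<^sup>+z. ennreal (w' z) * indicator A z \<partial>hyp_H)"
    by (subst nn_integral_cmult) auto
  finally show ?thesis using c by (simp add: ennreal_mult_cancel_left)
qed

definition weighted_int :: "(complex \<Rightarrow> real) \<Rightarrow> (complex \<Rightarrow> complex) \<Rightarrow> complex" where
  "weighted_int w F = (\<integral>z. w z *\<^sub>R F z \<partial>hyp_H)"

text \<open>
  Proved by transporting both measures to the \<open>\<sigma>\<close>-algebra of invariant sets, where they coincide; \<open>F\<close> may fail to be integrable.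
\<close>
lemma weight_weighted_int_unique:
  assumes G: "invgroup G" and c: "c > 0" and w: "weight G c w" and w': "weight G c w'"
    and F: "F \<in> borel_measurable borel" and inv: "\<And>M z. M \<in> G \<Longrightarrow> Im z > 0 \<Longrightarrow> F (mob M z) = F z"
  shows "weighted_int w F = weighted_int w' F"
proof -
  define I where "I = {A \<in> sets borel. \<forall>M\<in>G. \<forall>z. Im z > 0 \<longrightarrow> (mob M z \<in> A \<longleftrightarrow> z \<in> A)}"
  have "sigma_algebra UNIV I"
    unfolding sigma_algebra_iff2 I_def by auto
  define N where "N = sigma UNIV I"
  have sN: "sets N = I" unfolding N_def using \<open>sigma_algebra UNIV I\<close>
    by (simp add: sets_measure_of_conv sigma_algebra.sigma_sets_eq)
  have spN: "space N = UNIV" by (simp add: N_def space_measure_of_conv)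
  have FN: "F \<in> borel_measurable N"
  proof (rule measurableI)
    fix A assume A: "A \<in> sets (borel :: complex measure)"
    then have "F -` A \<in> sets borel" using measurable_sets[OF F A] by simp
    then show "F -` A \<inter> space N \<in> sets N" using inv by (auto simp: sN spN I_def)
  qed simp
  define m where "m v = density hyp_H (\<lambda>z. ennreal (v z))" for v :: "complex \<Rightarrow> real"
  have idm: "(\<lambda>z. z) \<in> measurable (m v) N" for v
    by (rule measurableI) (auto simp: sN spN I_def m_def)
  have *: "weighted_int v F = integral\<^sup>L (distr (m v) N (\<lambda>z. z)) F" if "weight G c v" for v
  proof -
    have "integral\<^sup>L (distr (m v) N (\<lambda>z. z)) F = integral\<^sup>L (m v) F"
      by (rule integral_distr[OF idm FN])
    also have "\<dots> = weighted_int v F" unfolding m_def weighted_int_def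
      by (rule integral_density) (use that F in \<open>auto simp: weight_def\<close>)
    finally show ?thesis by simp
  qed
  have "distr (m w) N (\<lambda>z. z) = distr (m w') N (\<lambda>z. z)"
  proof (rule measure_eqI)
    fix A assume "A \<in> sets (distr (m w) N (\<lambda>z. z))"
    then have A: "A \<in> I" by (simp add: sN)
    then have Ab: "A \<in> sets borel" by (simp add: I_def)
    have e: "emeasure (distr (m v) N (\<lambda>z. z)) A = (\<integral>\<^sup>+z. ennreal (v z) * indicator A z \<partial>hyp_H)" if "weight G c v" for v
      using A Ab that by (subst emeasure_distr[OF idm]) (auto simp: sN m_def emeasure_density weight_def)
    show "emeasure (distr (m w) N (\<lambda>z. z)) A = emeasure (distr (m w') N (\<lambda>z. z)) A"
      unfolding e[OF w] e[OF w'] by (rule weight_set[OF G c w w' Ab]) (use A in \<open>auto simp: I_def\<close>)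
  qed simp
  then show ?thesis using *[OF w] *[OF w'] by simp
qed

lemma weight_scale: "weight G c w \<Longrightarrow> m \<ge> 0 \<Longrightarrow> weight G (m * c) (\<lambda>z. m * w z)"
proof -
  assume w: "weight G c w" and m: "m \<ge> 0"
  have "AE z in hyp_H. (\<integral>\<^sup>+M. ennreal (w (mob M z)) \<partial>count_space G) = ennreal c" using w by (simp add: weight_def)
  then have "AE z in hyp_H. (\<integral>\<^sup>+M. ennreal (m * w (mob M z)) \<partial>count_space G) = ennreal (m * c)"
    by eventually_elim (use m w in \<open>simp add: weight_def ennreal_mult' nn_integral_cmult\<close>)
  then show ?thesis using w m unfolding weight_def by (auto intro: borel_measurable_times)
qed

lemma weight_weighted_int_scale:
  assumes G: "invgroup G" and c: "c > 0" "m > 0" and w: "weight G c w" and w': "weight G (m * c) w'"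
    and F: "F \<in> borel_measurable borel" and inv: "\<And>M z. M \<in> G \<Longrightarrow> Im z > 0 \<Longrightarrow> F (mob M z) = F z"
  shows "weighted_int w' F = of_real m * weighted_int w F"
proof -
  have "weighted_int w' F = weighted_int (\<lambda>z. m * w z) F"
    by (rule weight_weighted_int_unique[OF G _ w' weight_scale[OF w]]) (use c F inv in auto)
  also have "\<dots> = (\<integral>z. m *\<^sub>R (w z *\<^sub>R F z) \<partial>hyp_H)" by (simp add: weighted_int_def)
  also have "\<dots> = of_real m * weighted_int w F" unfolding weighted_int_def by (simp only: integral_scaleR_right) (simp add: scaleR_conv_of_real)
  finally show ?thesis .
qed

section \<open>Change of group: weights for subgroups and supergroups of finite index\<close>

lemma nn_count_space_bij:
  assumes R: "finite R" and b: "bij_betw (\<lambda>(r,x). \<phi> r x) (R \<times> H) G"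
  shows "(\<integral>\<^sup>+M. f M \<partial>count_space G) = (\<Sum>r\<in>R. \<integral>\<^sup>+x. f (\<phi> r x) \<partial>count_space H)"
proof -
  have "(\<integral>\<^sup>+M. f M \<partial>count_space G) = (\<integral>\<^sup>+p. f (case p of (r,x) \<Rightarrow> \<phi> r x) \<partial>count_space (R \<times> H))"
    by (rule nn_integral_bij_count_space[OF b, symmetric])
  also have "\<dots> = (\<integral>\<^sup>+p. f (case p of (r,x) \<Rightarrow> \<phi> r x) * indicator (R \<times> H) p \<partial>count_space UNIV)"
    by (subst nn_integral_count_space_indicator) auto
  also have "\<dots> = (\<integral>\<^sup>+r. \<integral>\<^sup>+x. f (\<phi> r x) * indicator (R \<times> H) (r,x) \<partial>count_space UNIV \<partial>count_space UNIV)"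
    by (subst nn_integral_fst_count_space[symmetric]) simp
  also have "\<dots> = (\<integral>\<^sup>+r. (\<integral>\<^sup>+x. f (\<phi> r x) \<partial>count_space H) * indicator R r \<partial>count_space UNIV)"
  proof (rule nn_integral_cong)
    fix r
    have "(\<integral>\<^sup>+x. f (\<phi> r x) * indicator (R \<times> H) (r,x) \<partial>count_space UNIV) = (\<integral>\<^sup>+x. (f (\<phi> r x) * indicator H x) * indicator R r \<partial>count_space UNIV)"
      by (rule nn_integral_cong) (auto simp: indicator_def)
    also have "\<dots> = (\<integral>\<^sup>+x. f (\<phi> r x) \<partial>count_space H) * indicator R r"
      by (subst nn_integral_multc) (auto simp: nn_integral_count_space_indicator)
    finally show "(\<integral>\<^sup>+x. f (\<phi> r x) * indicator (R \<times> H) (r,x) \<partial>count_space UNIV) = \<dots>" .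
  qed
  also have "\<dots> = (\<integral>\<^sup>+r. (\<integral>\<^sup>+x. f (\<phi> r x) \<partial>count_space H) \<partial>count_space R)"
    by (subst nn_integral_count_space_indicator) auto
  also have "\<dots> = (\<Sum>r\<in>R. \<integral>\<^sup>+x. f (\<phi> r x) \<partial>count_space H)"
    by (rule nn_integral_count_space_finite[OF R])
  finally show ?thesis .
qed

text \<open>Representatives of the right cosets \<open>H r\<close> in \<open>G\<close>. The
  formulation as a bijection lets a sum over \<open>G\<close> split into sums over \<open>H\<close>
  without a quotient set.\<close>

definition transversal :: "(real^2^2) set \<Rightarrow> (real^2^2) set \<Rightarrow> (real^2^2) set \<Rightarrow> bool" where
  "transversal H R G \<longleftrightarrow> finite R \<and> (\<forall>r\<in>R. det r = 1) \<and> bij_betw (\<lambda>(r,x). x ** r) (R \<times> H) G"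

text \<open>The coset \<open>H r\<close> contributes the \<open>H\<close>-sum of \<open>w\<close> at
  the point \<open>r z\<close>, which is \<open>c\<close> for almost every \<open>z\<close>. The
  function stays the same and only the mass grows by the index.\<close>

lemma weight_supgroup:
  assumes G: "invgroup H" and t: "transversal H R G" and w: "weight H c w" and c: "c \<ge> 0"
  shows "weight G (real (card R) * c) w"
proof -
  have fR: "finite R" and b: "bij_betw (\<lambda>(r,x). x ** r) (R \<times> H) G" and d: "\<And>r. r \<in> R \<Longrightarrow> det r = 1"
    using t by (auto simp: transversal_def)
  have wc: "AE z in hyp_H. (\<integral>\<^sup>+M. ennreal (w (mob M z)) \<partial>count_space H) = ennreal c" using w by (simp add: weight_def)
  have "AE z in hyp_H. \<forall>r\<in>R. (\<integral>\<^sup>+M. ennreal (w (mob M (mob r z))) \<partial>count_space H) = ennreal c"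
    using AE_hyp_H_mob[OF wc] d fR by (subst AE_finite_all) auto
  then have "AE z in hyp_H. (\<integral>\<^sup>+M. ennreal (w (mob M z)) \<partial>count_space G) = ennreal (real (card R) * c)"
    using AE_hyp_H
  proof eventually_elim
    case (elim z)
    have "(\<integral>\<^sup>+M. ennreal (w (mob M z)) \<partial>count_space G) = (\<Sum>r\<in>R. \<integral>\<^sup>+x. ennreal (w (mob (x ** r) z)) \<partial>count_space H)"
      by (rule nn_count_space_bij[OF fR b])
    also have "\<dots> = (\<Sum>r\<in>R. ennreal c)"
      using elim d by (intro sum.cong refl) (simp add: mob_mult_H)
    also have "\<dots> = ennreal (real (card R) * c)" using c by (simp add: ennreal_mult ennreal_of_nat_eq_real_of_nat)
    finally show ?case .
  qed
  then show ?thesis using w by (simp add: weight_def)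
qed

text \<open>The weight analogue of building a domain for \<open>H\<close> as the union of the
  translates by \<open>r\<close> of a domain for \<open>G\<close>; the inverse appears because
  functions are translated rather than sets.\<close>

lemma weight_subgroup:
  assumes G: "invgroup H" "invgroup G" and t: "transversal H R G" and w: "weight G c w"
  shows "weight H c (\<lambda>z. \<Sum>r\<in>R. w (mob (minv r) z))"
proof -
  have fR: "finite R" and b: "bij_betw (\<lambda>(r,x). x ** r) (R \<times> H) G" and d: "\<And>r. r \<in> R \<Longrightarrow> det r = 1"
    using t by (auto simp: transversal_def)
  have minv_mul: "minv (minv x ** r) = minv r ** x" if "det x = 1" "det r = 1" for x r
    by (simp add: minv_def vec_eq_iff forall_2 matrix_mul_nth)
  have m: "bij_betw (\<lambda>(r,x). (r, minv x)) (R \<times> H) (R \<times> H)"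
    by (rule bij_betwI[where g="\<lambda>(r,x). (r, minv x)"]) (use G in \<open>auto simp: invgroup_def\<close>)
  \<comment> \<open>Inverting both sides turns \<open>G = H R\<close> into a factorisation with the
    inverses of \<open>R\<close> on the left, the order in which the translated weights are
    evaluated.\<close>
  have "bij_betw (minv \<circ> ((\<lambda>(r,x). x ** r) \<circ> (\<lambda>(r,x). (r, minv x)))) (R \<times> H) G"
    by (rule bij_betw_trans[OF bij_betw_trans[OF m b] bij_minv[OF G(2)]])
  then have b': "bij_betw (\<lambda>(r,x). minv r ** x) (R \<times> H) G"
    by (rule bij_betw_cong[THEN iffD1, rotated]) (use G d in \<open>auto simp: minv_mul invgroup_def\<close>)
  have wc: "AE z in hyp_H. (\<integral>\<^sup>+M. ennreal (w (mob M z)) \<partial>count_space G) = ennreal c" using w by (simp add: weight_def)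
  have wn: "0 \<le> w z" for z using w by (simp add: weight_def)
  have "AE z in hyp_H. (\<integral>\<^sup>+M. ennreal (\<Sum>r\<in>R. w (mob (minv r) (mob M z))) \<partial>count_space H) = ennreal c"
    using wc AE_hyp_H
  proof eventually_elim
    case (elim z)
    have "(\<integral>\<^sup>+M. ennreal (\<Sum>r\<in>R. w (mob (minv r) (mob M z))) \<partial>count_space H)
       = (\<integral>\<^sup>+M. (\<Sum>r\<in>R. ennreal (w (mob (minv r ** M) z))) \<partial>count_space H)"
    proof (rule nn_integral_cong)
      fix M assume "M \<in> space (count_space H)"
      then have "det M = 1" using G by (auto simp: invgroup_def)
      then show "ennreal (\<Sum>r\<in>R. w (mob (minv r) (mob M z))) = (\<Sum>r\<in>R. ennreal (w (mob (minv r ** M) z)))"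
        using elim wn by (simp add: mob_mult_H sum_ennreal)
    qed
    also have "\<dots> = (\<Sum>r\<in>R. \<integral>\<^sup>+M. ennreal (w (mob (minv r ** M) z)) \<partial>count_space H)"
      by (rule nn_integral_sum) simp
    also have "\<dots> = (\<integral>\<^sup>+M. ennreal (w (mob M z)) \<partial>count_space G)"
      by (rule nn_count_space_bij[OF fR b', symmetric])
    finally show ?case using elim by simp
  qed
  moreover have "(\<lambda>z. \<Sum>r\<in>R. w (mob (minv r) z)) \<in> borel_measurable borel"
    using w by (intro borel_measurable_sum) (auto simp: weight_def)
  ultimately show ?thesis using wn by (simp add: weight_def sum_nonneg)
qed

lemma weighted_int_mob:
  assumes "F \<in> borel_measurable borel" "w \<in> borel_measurable borel" "det r = 1"
  shows "weighted_int w (\<lambda>z. F (mob r z)) = weighted_int (\<lambda>z. w (mob (minv r) z)) F"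
    and "integrable hyp_H (\<lambda>z. w z *\<^sub>R F (mob r z)) \<longleftrightarrow> integrable hyp_H (\<lambda>z. w (mob (minv r) z) *\<^sub>R F z)"
proof -
  note [measurable] = assms(1,2)
  let ?h = "\<lambda>z. w (mob (minv r) z) *\<^sub>R F z"
  have AE: "AE z in hyp_H. w z *\<^sub>R F (mob r z) = ?h (mob r z)"
    using AE_hyp_H by eventually_elim (use assms in \<open>simp add: mob_minv\<close>)
  have "weighted_int w (\<lambda>z. F (mob r z)) = (\<integral>z. ?h (mob r z) \<partial>hyp_H)" unfolding weighted_int_def
    by (rule integral_cong_AE[OF _ _ AE]) auto
  also have "\<dots> = weighted_int (\<lambda>z. w (mob (minv r) z)) F" unfolding weighted_int_def
    by (rule integral_hyp_H_mob(1)) (use assms in auto)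
  finally show "weighted_int w (\<lambda>z. F (mob r z)) = weighted_int (\<lambda>z. w (mob (minv r) z)) F" .
  have "integrable hyp_H (\<lambda>z. w z *\<^sub>R F (mob r z)) \<longleftrightarrow> integrable hyp_H (\<lambda>z. ?h (mob r z))"
    by (rule integrable_cong_AE[OF _ _ AE]) auto
  also have "\<dots> \<longleftrightarrow> integrable hyp_H ?h"
    by (rule integral_hyp_H_mob(2)) (use assms in auto)
  finally show "integrable hyp_H (\<lambda>z. w z *\<^sub>R F (mob r z)) \<longleftrightarrow> integrable hyp_H ?h" .
qed

text \<open>Invariance of the measure moves the sum over \<open>R\<close> from \<open>F\<close> to the weight, and the summed weight is again a weight for \<open>H\<close>.\<close>
lemma weighted_int_average:
  assumes G: "invgroup H" "invgroup G" and t: "transversal H R G" "R \<noteq> {}" and w: "weight H c w" and c: "c > 0"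
    and F: "F \<in> borel_measurable borel" and inv: "\<And>M z. M \<in> H \<Longrightarrow> Im z > 0 \<Longrightarrow> F (mob M z) = F z"
    and int: "\<And>r. r \<in> R \<Longrightarrow> integrable hyp_H (\<lambda>z. w z *\<^sub>R F (mob r z))"
  shows "weighted_int w (\<lambda>z. \<Sum>r\<in>R. F (mob r z)) = of_nat (card R) * weighted_int w F"
proof -
  have fR: "finite R" and d: "\<And>r. r \<in> R \<Longrightarrow> det r = 1"
    using t by (auto simp: transversal_def)
  have wm: "w \<in> borel_measurable borel" using w by (simp add: weight_def)
  have cR: "card R > 0" using t(2) fR by (simp add: card_gt_0_iff)
  have "weighted_int w (\<lambda>z. \<Sum>r\<in>R. F (mob r z)) = (\<Sum>r\<in>R. weighted_int w (\<lambda>z. F (mob r z)))"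
    unfolding weighted_int_def scaleR_sum_right by (rule Bochner_Integration.integral_sum) (rule int)
  also have "\<dots> = (\<Sum>r\<in>R. weighted_int (\<lambda>z. w (mob (minv r) z)) F)"
    by (rule sum.cong[OF refl], rule weighted_int_mob(1)) (use F wm d in auto)
  also have "\<dots> = weighted_int (\<lambda>z. \<Sum>r\<in>R. w (mob (minv r) z)) F"
    unfolding weighted_int_def scaleR_sum_left
    by (rule Bochner_Integration.integral_sum[symmetric]) (use int weighted_int_mob(2)[OF F wm] d in auto)
  also have "\<dots> = of_real (card R) * weighted_int w F"
  proof (rule weight_weighted_int_scale[OF G(1) c _ w _ F inv])
    show "weight H (real (card R) * c) (\<lambda>z. \<Sum>r\<in>R. w (mob (minv r) z))"
      using weight_subgroup[OF G t(1) weight_supgroup[OF G(1) t(1) w]] c by simp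
  qed (use cR in auto)
  finally show ?thesis by simp
qed

section \<open>The standard fundamental domain\<close>

text \<open>The sharp bound would be \<open>sqrt 3 / 2\<close>; the value \<open>1/2\<close> matches
  the lower edge of the first dyadic strip in the volume estimate.\<close>

lemma fund_domain_Im_ge: "z \<in> fund_domain \<Longrightarrow> Im z \<ge> 1/2"
proof -
  assume "z \<in> fund_domain"
  then have z: "Im z > 0" "\<bar>Re z\<bar> \<le> 1/2" "cmod z \<ge> 1" by (auto simp: fund_domain_def upper_half_plane_def)
  have "1 \<le> (cmod z)\<^sup>2" using power_mono[OF z(3), of 2] by simp
  moreover have "(Re z)\<^sup>2 \<le> (1/2)\<^sup>2" using z(2) by (metis abs_ge_zero power2_abs power_mono)
  ultimately have "(1/2)\<^sup>2 \<le> (Im z)\<^sup>2" unfolding cmod_power2 by (simp add: power2_eq_square)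
  then show ?thesis using z(1) power2_le_imp_le[of "1/2" "Im z"] by simp
qed

lemma fund_meas [measurable]: "fund_domain \<in> sets borel"
  unfolding fund_domain_def upper_half_plane_def by measurable

lemma fund_domain_Im_pos: "z \<in> fund_domain \<Longrightarrow> Im z > 0"
  by (simp add: fund_domain_def upper_half_plane_def)

text \<open>Dyadic strips of height between \<open>2^n / 2\<close> and \<open>2^n\<close>: the
  density is at most \<open>4 / 4^n\<close> and the area is \<open>2^n / 2\<close>, so the measures
  are dominated by a geometric series.\<close>

lemma emeasure_fund: "emeasure hyp_H fund_domain < \<infinity>"
proof -
  define S where "S n = cbox (Complex (-1/2) (2^n/2)) (Complex (1/2) (2^n))" for n :: nat
  have Sm [measurable]: "S n \<in> sets borel" for n by (simp add: S_def)
  have "fund_domain \<subseteq> (\<Union>n. S n)"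
  proof
    fix z assume z: "z \<in> fund_domain"
    define n where "n = (LEAST n::nat. Im z \<le> 2^n)"
    obtain m :: nat where "Im z < 2 ^ m" using real_arch_pow[of 2 "Im z"] by auto
    then have n1: "Im z \<le> 2^n" using LeastI[of "\<lambda>n. Im z \<le> 2^n" m] by (simp add: n_def)
    have "Im z \<ge> 2^n / 2"
    proof (cases n)
      case 0 then show ?thesis using fund_domain_Im_ge[OF z] by simp
    next
      case (Suc k)
      then have "\<not> Im z \<le> 2 ^ k" using not_less_Least[of k "\<lambda>n. Im z \<le> 2^n"] by (simp add: n_def)
      then show ?thesis using Suc by simp
    qed
    moreover have "\<bar>Re z\<bar> \<le> 1/2" using z by (simp add: fund_domain_def)
    ultimately have "z \<in> S n" using n1 by (auto simp: S_def cbox_def Basis_complex_def)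
    then show "z \<in> (\<Union>n. S n)" by blast
  qed
  then have "emeasure hyp_H fund_domain \<le> emeasure hyp_H (\<Union>n. S n)" by (intro emeasure_mono) auto
  also have "\<dots> \<le> (\<Sum>n. emeasure hyp_H (S n))" by (rule emeasure_subadditive_countably) auto
  also have "\<dots> \<le> (\<Sum>n. ennreal (2 * (1/2)^n))"
  proof (rule suminf_le)
    fix n
    have "emeasure hyp_H (S n) = (\<integral>\<^sup>+z. indicator (S n) z \<partial>hyp_H)" by simp
    also have "\<dots> = (\<integral>\<^sup>+z. (if Im z > 0 then ennreal (1 / (Im z)\<^sup>2) else 0) * indicator (S n) z \<partial>lborel)"
      by (rule nn_integral_hyp_H) measurable
    also have "\<dots> \<le> (\<integral>\<^sup>+z. ennreal (4 / 4^n) * indicator (S n) z \<partial>lborel)"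
    proof (rule nn_integral_mono)
      fix z
      have "1 / (Im z)\<^sup>2 \<le> 4 / 4^n" if "z \<in> S n" "Im z > 0"
      proof -
        have "2^n/2 \<le> Im z" using that by (simp add: S_def cbox_def Basis_complex_def)
        then have "(2^n/2)\<^sup>2 \<le> (Im z)\<^sup>2" by (intro power_mono) auto
        moreover have "(4::real)^n = 2^n * 2^n" by (simp flip: power_mult_distrib)
        then have "((2::real)^n/2)\<^sup>2 = 4^n/4" by (simp add: power2_eq_square)
        ultimately show ?thesis using that by (simp add: field_simps)
      qed
      then show "(if Im z > 0 then ennreal (1 / (Im z)\<^sup>2) else 0) * indicator (S n) z \<le> ennreal (4 / 4^n) * indicator (S n) z"
        by (auto simp: indicator_def intro: ennreal_leI)
    qed
    also have "\<dots> = ennreal (4 / 4^n) * emeasure lborel (S n)"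
      by (rule nn_integral_cmult_indicator) simp
    also have "emeasure lborel (S n) = ennreal (2^n / 2)"
      unfolding S_def by (subst emeasure_lborel_cbox) (auto simp: Basis_complex_def)
    also have "ennreal (4 / 4^n) * ennreal (2^n / 2) = ennreal (2 * (1/2)^n)"
    proof -
      have "(4::real)^n = 2^n * 2^n" by (simp flip: power_mult_distrib)
      then have "(4 / 4^n) * (2^n / 2) = 2 * (1/2::real)^n" by (simp add: field_simps power_one_over)
      then show ?thesis by (simp flip: ennreal_mult)
    qed
    finally show "emeasure hyp_H (S n) \<le> ennreal (2 * (1/2)^n)" .
  qed auto
  also have "\<dots> = ennreal (\<Sum>n. 2 * (1/2)^n)"
    by (rule suminf_ennreal2) (auto intro!: summable_mult summable_geometric)
  also have "\<dots> < \<infinity>" by simp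
  finally show ?thesis .
qed

lemma GG_1_1E:
  assumes "M \<in> GG 1 1"
  obtains a b c d :: int where "M = mat22 (of_int a) (of_int b) (of_int c) (of_int d)" "a * d - b * c = 1"
proof -
  from assms obtain a b c d :: int where M: "M = mat22 (of_int a) (of_int b) (of_int c) (of_int d)"
    and "of_int a * of_int d - of_int b * of_int c = (1::real)"
    by (auto simp: GG_def)
  then have "real_of_int (a * d - b * c) = of_int 1" by simp
  then have "a * d - b * c = 1" by linarith
  with M that show ?thesis by blast
qed

lemma GG_1_1I: "a * d - b * c = 1 \<Longrightarrow> mat22 (of_int a) (of_int b) (of_int c) (of_int d) \<in> GG 1 1"
proof -
  assume "a * d - b * c = (1::int)"
  then have "real_of_int (a * d - b * c) = 1" by simp
  then show ?thesis unfolding GG_def by (intro CollectI exI[of _ a] exI[of _ b] exI[of _ c] exI[of _ d]) simp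
qed

text \<open>Reduction theory: choose \<open>M\<close> with \<open>|cz + d|\<close> minimal, that is,
  with the highest image point, and translate it into the strip. If the result had modulus below 1,
  the inversion would lower the minimum. The minimum exists because only finitely many
  \<open>(c, d)\<close> give a value at most 1, and the identity gives exactly 1.\<close>

lemma fund_covering:
  assumes z: "Im z > 0"
  obtains M where "M \<in> GG 1 1" "mob M z \<in> fund_domain"
proof -
  define D where "D = {(c::int,d::int). cmod (of_int c * z + of_int d) \<le> 1}"
  have "D \<subseteq> {-\<lceil>1 / Im z\<rceil>..\<lceil>1 / Im z\<rceil>} \<times> {-\<lceil>1 + 1 / Im z * cmod z\<rceil>..\<lceil>1 + 1 / Im z * cmod z\<rceil>}"
  proof
    fix p assume "p \<in> D"
    then obtain c d where p: "p = (c,d)" and le: "cmod (of_int c * z + of_int d) \<le> 1" by (auto simp: D_def)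
    have "\<bar>real_of_int c * Im z\<bar> \<le> 1" using abs_Im_le_cmod[of "of_int c * z + of_int d"] le by simp
    then have c: "\<bar>real_of_int c\<bar> \<le> 1 / Im z" using z by (simp add: abs_mult field_simps)
    have "cmod (of_int d) = cmod ((of_int c * z + of_int d) - of_int c * z)" by simp
    also have "\<dots> \<le> cmod (of_int c * z + of_int d) + cmod (of_int c * z)" by (rule norm_triangle_ineq4)
    also have "\<dots> \<le> 1 + 1 / Im z * cmod z"
      using le mult_right_mono[OF c norm_ge_zero[of z]] by (simp add: norm_mult)
    finally have d: "\<bar>real_of_int d\<bar> \<le> 1 + 1 / Im z * cmod z" by simp
    show "p \<in> {-\<lceil>1 / Im z\<rceil>..\<lceil>1 / Im z\<rceil>} \<times> {-\<lceil>1 + 1 / Im z * cmod z\<rceil>..\<lceil>1 + 1 / Im z * cmod z\<rceil>}"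
      using c d le_of_int_ceiling[of "1 / Im z"] le_of_int_ceiling[of "1 + 1 / Im z * cmod z"] unfolding p by simp linarith
  qed
  then have fD: "finite D" by (rule finite_subset) simp
  define S where "S = {cmod (den M z) | M. M \<in> GG 1 1 \<and> cmod (den M z) \<le> 1}"
  have "S \<subseteq> (\<lambda>(c,d). cmod (of_int c * z + of_int d)) ` D"
  proof
    fix s assume "s \<in> S"
    then obtain M where M: "M \<in> GG 1 1" "cmod (den M z) \<le> 1" "s = cmod (den M z)" unfolding S_def by blast
    obtain a b c d where e: "M = mat22 (of_int a) (of_int b) (of_int c) (of_int d)" by (rule GG_1_1E[OF M(1)])
    have "(c,d) \<in> D" "s = cmod (of_int c * z + of_int d)" using M by (auto simp: D_def e den_def)
    then show "s \<in> (\<lambda>(c,d). cmod (of_int c * z + of_int d)) ` D" by force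
  qed
  then have fS: "finite S" using fD by (metis finite_imageI finite_subset)
  have 1: "1 \<in> S" unfolding S_def by (rule CollectI, rule exI[of _ "mat 1"]) (simp add: GG_one)
  then have "Min S \<in> S" using fS by (intro Min_in) auto
  then obtain M where M: "M \<in> GG 1 1" "cmod (den M z) = Min S" unfolding S_def by force
  have min: "cmod (den M z) \<le> cmod (den N z)" if "N \<in> GG 1 1" for N
  proof (cases "cmod (den N z) \<le> 1")
    case True then show ?thesis using that fS M(2) by (auto simp: S_def intro!: Min_le)
  next
    case False
    then show ?thesis using M(2) Min_le[OF fS 1] by simp
  qed
  define w where "w = mob M z"
  have wp: "Im w > 0" using Im_mob_pos[of M z] GG_det[OF M(1)] z by (simp add: w_def)
  define n where "n = - \<lfloor>Re w + 1/2\<rfloor>"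
  define T where "T = mat22 1 (of_int n) 0 1"
  have T: "T \<in> GG 1 1" unfolding T_def using GG_1_1I[of 1 1 n 0] by simp
  have TM: "T ** M \<in> GG 1 1" by (intro GG_mult T M) auto
  have mT: "mob (T ** M) z = w + of_int n"
    using z GG_det[OF M(1)] by (simp add: mob_mult_H w_def) (simp add: T_def mob_def[of "mat22 1 _ 0 1"] den_def)
  have dT: "den (T ** M) z = den M z" by (simp add: den_def matrix_mul_nth T_def)
  have Re: "\<bar>Re (w + of_int n)\<bar> \<le> 1/2"
    using of_int_floor_le[of "Re w + 1/2"] floor_correct[of "Re w + 1/2"] unfolding n_def abs_le_iff by simp linarith
  have "cmod (w + of_int n) \<ge> 1"
  proof (rule ccontr)
    assume less: "\<not> cmod (w + of_int n) \<ge> 1"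
    have S': "mat22 0 (-1) 1 0 \<in> GG 1 1" using GG_1_1I[of 0 0 "-1" 1] by simp
    have "cmod (den M z) \<le> cmod (den (mat22 0 (-1) 1 0 ** (T ** M)) z)"
      by (rule min) (intro GG_mult S' TM, auto)
    also have "den (mat22 0 (-1) 1 0 ** (T ** M)) z = (w + of_int n) * den M z"
      using z GG_det[OF TM] by (subst den_mult[OF den_nonzero]) (simp_all only: mT dT, simp_all add: den_def)
    finally have "cmod (den M z) * 1 \<le> cmod (den M z) * cmod (w + of_int n)" by (simp add: norm_mult mult.commute)
    moreover have "cmod (den M z) > 0" using den_nonzero[of M z] GG_det[OF M(1)] z by simp
    ultimately show False using less by simp
  qed
  then have "mob (T ** M) z \<in> fund_domain" using Re wp by (simp add: mT fund_domain_def upper_half_plane_def)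
  with TM that show ?thesis by blast
qed

text \<open>The height comparison gives \<open>|cz + d| \<le> 1\<close>. For
  \<open>c \<noteq> 0\<close> the strict inequalities on \<open>z\<close> make
  \<open>|cz + d|^2\<close> larger than the positive integer \<open>c^2 - |cd| + d^2\<close>, a
  contradiction. With \<open>c = 0\<close> the map is an integral translation between points of the
  open strip, so it is trivial.\<close>

lemma fund_interior_unique:
  assumes z: "Im z > 0" "\<bar>Re z\<bar> < 1/2" "cmod z > 1" and M: "M \<in> GG 1 1"
    and z': "\<bar>Re (mob M z)\<bar> < 1/2" and le: "Im z \<le> Im (mob M z)"
  shows "M = mat 1 \<or> M = mat22 (-1) 0 0 (-1)"
proof -
  obtain a b c d where e: "M = mat22 (of_int a) (of_int b) (of_int c) (of_int d)" and det: "a * d - b * c = 1" by (rule GG_1_1E[OF M])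
  have n: "den M z \<noteq> 0" using den_nonzero[of M z] GG_det[OF M] z by simp
  have "Im z * (cmod (den M z))\<^sup>2 \<le> Im z * 1"
    using le n by (simp add: Im_mob GG_det[OF M] pos_le_divide_eq)
  then have n1: "(cmod (den M z))\<^sup>2 \<le> 1" using z(1) by (simp add: mult_le_cancel_left)
  have n2: "(cmod (den M z))\<^sup>2 = of_int (c\<^sup>2) * (cmod z)\<^sup>2 + 2 * (of_int c * of_int d) * Re z + of_int (d\<^sup>2)"
    unfolding cmod_power2 by (simp add: e den_def power2_eq_square algebra_simps)
  have le1: "of_int (c\<^sup>2) * (cmod z)\<^sup>2 + 2 * (of_int c * of_int d) * Re z + of_int (d\<^sup>2) \<le> 1" using n1 unfolding n2 .
  have c0: "c = 0"
  proof (rule ccontr)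
    assume c: "c \<noteq> 0"
    have "1 < (cmod z)\<^sup>2" using z(3) by (simp add: one_less_power)
    moreover have "real_of_int (c\<^sup>2) > 0" using c by simp
    ultimately have "real_of_int (c\<^sup>2) < of_int (c\<^sup>2) * (cmod z)\<^sup>2" by simp
    moreover have "\<bar>2 * (of_int c * of_int d) * Re z\<bar> \<le> \<bar>of_int c * of_int d\<bar>"
    proof -
      have "\<bar>2 * (of_int c * of_int d) * Re z\<bar> = \<bar>of_int c * of_int d\<bar> * (2 * \<bar>Re z\<bar>)" by (simp add: abs_mult)
      also have "\<dots> \<le> \<bar>of_int c * of_int d\<bar> * 1" using z(2) by (intro mult_left_mono) auto
      finally show ?thesis by simp
    qed
    ultimately have "real_of_int (c\<^sup>2) - \<bar>of_int c * of_int d\<bar> + of_int (d\<^sup>2) < 1" using le1 by linarith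
    then have "real_of_int (c\<^sup>2 - \<bar>c * d\<bar> + d\<^sup>2) < of_int 1" by simp
    then have lt: "c\<^sup>2 - \<bar>c * d\<bar> + d\<^sup>2 < 1" by (simp only: of_int_less_iff)
    have "(\<bar>c\<bar> - \<bar>d\<bar>)\<^sup>2 = c\<^sup>2 - 2 * \<bar>c * d\<bar> + d\<^sup>2"
      by (simp add: power2_diff abs_mult)
    then have "c\<^sup>2 - 2 * \<bar>c * d\<bar> + d\<^sup>2 \<ge> 0" by (metis zero_le_power2)
    then have "2 * (c\<^sup>2 - \<bar>c * d\<bar> + d\<^sup>2) \<ge> c\<^sup>2 + d\<^sup>2" by (simp add: algebra_simps)
    moreover have "c\<^sup>2 > 0" "d\<^sup>2 \<ge> 0" using c by auto
    ultimately have "2 * (c\<^sup>2 - \<bar>c * d\<bar> + d\<^sup>2) > 0" by (metis add_pos_nonneg less_le_trans)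
    then show False using lt by (simp only: zero_less_mult_iff) auto
  qed
  with det have "a * d = 1" by simp
  then have ad: "a = 1 \<and> d = 1 \<or> a = -1 \<and> d = -1" by (rule zmult_eq_1_iff[THEN iffD1])
  have "Re (mob M z) = Re z + of_int (a * b)"
    using ad by (auto simp: e c0 mob_def den_def)
  then have "\<bar>real_of_int (a * b)\<bar> < 1" using z(2) z' by linarith
  then have "a * b = 0" by linarith
  then have "b = 0" using ad by auto
  then show ?thesis using ad by (auto simp: e c0 mat_1_eq_mat22)
qed

text \<open>Whole lines and the whole circle instead of the bounding arcs: still a null set, and
  easier to recognise as one.\<close>

definition fund_boundary :: "complex set" where "fund_boundary = {z. \<bar>Re z\<bar> = 1/2 \<or> cmod z = 1}"

lemma AE_not_fund_boundary: "AE z in hyp_H. z \<notin> fund_boundary"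
proof -
  have eq: "fund_boundary = {z. z \<bullet> 1 = 1/2} \<union> {z. z \<bullet> 1 = -1/2} \<union> sphere 0 1"
    by (auto simp: fund_boundary_def abs_if split: if_splits)
  have "negligible fund_boundary" unfolding eq
    by (intro negligible_Un negligible_standard_hyperplane negligible_sphere) (auto simp: Basis_complex_def)
  then have "fund_boundary \<in> null_sets lebesgue" by (simp add: negligible_iff_null_sets)
  moreover have "fund_boundary \<in> sets borel" unfolding fund_boundary_def by measurable
  ultimately have "fund_boundary \<in> null_sets lborel" by (simp add: null_sets_completion_iff)
  then have "AE z in lborel. z \<notin> fund_boundary" by (rule AE_not_in)
  then show ?thesis unfolding hyp_H_def by (subst AE_density) auto
qed

text \<open>Outside the countably many preimages of \<open>fund_boundary\<close>, exactly two
  matrices \<open>M0\<close> and \<open>-M0\<close> move \<open>z\<close> into the domain, hence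
  mass 2. Given two candidates, the one with the lower image point takes the first role in
  \<open>fund_interior_unique\<close>.\<close>

lemma weight_SL2Z: "weight (GG 1 1) 2 (indicator fund_domain)"
proof -
  have "AE z in hyp_H. \<forall>M\<in>GG 1 1. mob M z \<notin> fund_boundary"
    by (subst AE_ball_countable[OF GG_countable]) (auto intro!: AE_hyp_H_mob[OF AE_not_fund_boundary] simp: GG_det)
  then have "AE z in hyp_H. (\<integral>\<^sup>+M. ennreal (indicator fund_domain (mob M z)) \<partial>count_space (GG 1 1)) = ennreal 2"
    using AE_hyp_H
  proof eventually_elim
    case (elim z)
    obtain M0 where M0: "M0 \<in> GG 1 1" "mob M0 z \<in> fund_domain" by (rule fund_covering[OF elim(2)])
    let ?m = "mat22 (-1) 0 0 (-1)"
    have m: "?m \<in> GG 1 1" using GG_1_1I[of "-1" "-1" 0 0] by simp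
    have intr: "\<bar>Re (mob M z)\<bar> < 1/2" "cmod (mob M z) > 1" "Im (mob M z) > 0" if "M \<in> GG 1 1" "mob M z \<in> fund_domain" for M
      using elim(1) that by (auto simp: fund_boundary_def fund_domain_def upper_half_plane_def less_le)
    have key: "N = M \<or> N = ?m ** M"
      if "M \<in> GG 1 1" "mob M z \<in> fund_domain" "N \<in> GG 1 1" "mob N z \<in> fund_domain" "Im (mob M z) \<le> Im (mob N z)" for M N
    proof -
      have NM: "N ** minv M \<in> GG 1 1" by (intro GG_mult GG_minv that) auto
      have d: "det M = 1" "det N = 1" using that GG_det by auto
      have e: "(N ** minv M) ** M = N" by (simp add: matrix_mul_assoc[symmetric] minv_mult d)
      have "mob (N ** minv M) (mob M z) = mob N z"
        using elim(2) d by (subst mob_mult_H[symmetric]) (simp_all add: e)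
      then have "N ** minv M = mat 1 \<or> N ** minv M = ?m"
        using intr[OF that(1,2)] intr[OF that(3,4)] that(5) NM by (intro fund_interior_unique[of "mob M z"]) auto
      then show ?thesis using e by auto
    qed
    have mm: "?m ** (?m ** N) = N" for N :: "real^2^2"
      by (simp add: vec_eq_iff forall_2 matrix_mul_nth)
    have "{M \<in> GG 1 1. mob M z \<in> fund_domain} = {M0, ?m ** M0}"
    proof (intro equalityI subsetI)
      fix N assume "N \<in> {M \<in> GG 1 1. mob M z \<in> fund_domain}"
      then have N: "N \<in> GG 1 1" "mob N z \<in> fund_domain" by auto
      consider "Im (mob M0 z) \<le> Im (mob N z)" | "Im (mob N z) \<le> Im (mob M0 z)" by linarith
      then show "N \<in> {M0, ?m ** M0}"
      proof cases
        case 1 then show ?thesis using key[OF M0 N] by auto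
      next
        case 2 then show ?thesis using key[OF N M0] mm by auto
      qed
    next
      fix N assume "N \<in> {M0, ?m ** M0}"
      moreover have "mob (?m ** M0) z = mob M0 z"
        using elim(2) GG_det[OF M0(1)] by (simp add: mob_mult_H) (simp add: mob_def[of ?m] den_def)
      moreover have "?m ** M0 \<in> GG 1 1" by (intro GG_mult m M0) auto
      ultimately show "N \<in> {M \<in> GG 1 1. mob M z \<in> fund_domain}" using M0 by auto
    qed
    moreover have "M0 \<noteq> ?m ** M0"
    proof
      assume "M0 = ?m ** M0"
      then have "M0 = - M0" by (simp add: vec_eq_iff forall_2 matrix_mul_nth)
      then have "M0 = 0" by (simp add: vec_eq_iff)
      then show False using GG_det[OF M0(1)] by (simp add: det_2)
    qed
    ultimately have card: "card {M \<in> GG 1 1. mob M z \<in> fund_domain} = 2" "finite {M \<in> GG 1 1. mob M z \<in> fund_domain}" by auto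
    have "(\<integral>\<^sup>+M. ennreal (indicator fund_domain (mob M z)) \<partial>count_space (GG 1 1)) =
      (\<integral>\<^sup>+M. indicator {M \<in> GG 1 1. mob M z \<in> fund_domain} M \<partial>count_space (GG 1 1))"
      by (rule nn_integral_cong) (auto simp: indicator_def)
    also have "\<dots> = ennreal 2" using card by (simp add: ennreal_numeral)
    finally show ?case .
  qed
  then show ?thesis by (simp add: weight_def)
qed

section \<open>Integration over quotients by congruence subgroups\<close>

text \<open>The same choice as in \<open>quotient_integral\<close>, so that the sums agree literally
  and independence of the representatives need not be argued.\<close>

definition coset_rep :: "(int^2^2) set \<Rightarrow> int^2^2" where "coset_rep C = (SOME g. g \<in> C)"

definition coset_reps :: "nat \<Rightarrow> (real^2^2) set" where
  "coset_reps l = (\<lambda>C. rmat (coset_rep C)) ` Gamma0_cosets l"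

lemma GG_memI:
  assumes "x > 0" "y > 0" "det M = 1" "M$1$1 \<in> \<int>" "M$1$2 * of_nat x \<in> \<int>" "M$2$1 / of_nat y \<in> \<int>" "M$2$2 \<in> \<int>"
  shows "M \<in> GG x y"
proof -
  obtain a b c d :: int where e: "M$1$1 = of_int a" "M$1$2 * of_nat x = of_int b" "M$2$1 / of_nat y = of_int c" "M$2$2 = of_int d"
    using assms(4-7) by (auto elim!: Ints_cases)
  have M: "M = mat22 (of_int a) (of_int b / of_nat x) (of_int c * of_nat y) (of_int d)"
    using e assms(1,2) by (subst mat22_eta[of M]) (simp add: field_simps)
  have "of_int a * of_int d - (of_int b / of_nat x) * (of_int c * of_nat y) = (1::real)"
    using assms(3) unfolding M by (simp add: mult_ac)
  with M show ?thesis unfolding GG_def by blast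
qed

lemma GG_memD:
  assumes "x > 0" "y > 0" "M \<in> GG x y"
  shows "M$1$1 \<in> \<int>" "M$1$2 * of_nat x \<in> \<int>" "M$2$1 / of_nat y \<in> \<int>" "M$2$2 \<in> \<int>"
  using assms by (auto simp: GG_def)

lemma GG_mono: "x > 0 \<Longrightarrow> y > 0 \<Longrightarrow> x' > 0 \<Longrightarrow> y' > 0 \<Longrightarrow> x dvd x' \<Longrightarrow> y' dvd y \<Longrightarrow> GG x y \<subseteq> GG x' y'"
proof
  fix M assume pos: "x > 0" "y > 0" "x' > 0" "y' > 0" and d: "x dvd x'" "y' dvd y" and M: "M \<in> GG x y"
  note D = GG_memD[OF pos(1,2) M]
  obtain u v where u: "x' = x * u" and v: "y = y' * v" using d by (auto elim!: dvdE)
  show "M \<in> GG x' y'"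
  proof (rule GG_memI[OF pos(3,4) GG_det[OF M] D(1) _ _ D(4)])
    have "M$1$2 * of_nat x' = (M$1$2 * of_nat x) * of_nat u" by (simp add: u)
    then show "M$1$2 * of_nat x' \<in> \<int>" using D(2) by (simp only: Ints_mult Ints_of_nat)
    have "M$2$1 / of_nat y' = (M$2$1 / of_nat y) * of_nat v" using pos v by simp
    then show "M$2$1 / of_nat y' \<in> \<int>" using D(3) by (simp only: Ints_mult Ints_of_nat)
  qed
qed

lemma GG_dvd: "M \<in> GG 1 l \<Longrightarrow> M \<in> GG 1 1"
proof -
  assume "M \<in> GG 1 l"
  then obtain g where "g \<in> Gamma0 l" "M = rmat g" using Gamma0_GG by blast
  then show ?thesis using SL2Z_GG by (auto simp: Gamma0_def)
qed

lemma coset_eq_translates: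
  assumes "C \<in> Gamma0_cosets l" "g \<in> C"
  shows "g \<in> SL2Z" "C = (\<lambda>h. h ** g) ` Gamma0 l"
proof -
  obtain g0 where C: "C = (\<lambda>h. h ** g0) ` Gamma0 l" and g0: "g0 \<in> SL2Z" using assms(1) by (auto simp: Gamma0_cosets_def)
  then obtain h0 where h0: "h0 \<in> Gamma0 l" and g: "g = h0 ** g0" using assms(2) by auto
  show "g \<in> SL2Z" using h0 g0 by (simp add: g SL2Z_def Gamma0_def det_mul)
  have "minv (rmat h0) \<in> GG 1 l" using h0 by (intro GG_minv) (simp flip: Gamma0_GG del: One_nat_def)
  then obtain hi where hi: "hi \<in> Gamma0 l" "minv (rmat h0) = rmat hi" using Gamma0_GG by blast
  have one: "rmat (mat 1) = mat 1" unfolding mat_1_eq_mat22 by (simp add: rmat_def mat_def)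
  have d: "det (rmat h0) = 1" using h0 by (simp add: det_rmat Gamma0_def SL2Z_def)
  have "rmat (hi ** h0) = rmat (mat 1)" by (simp add: rmat_mult one minv_mult d flip: hi(2))
  then have hih: "hi ** h0 = mat 1" by (simp only: rmat_eq_iff)
  have mul: "a ** b \<in> Gamma0 l" if "a \<in> Gamma0 l" "b \<in> Gamma0 l" for a b
  proof -
    have "rmat (a ** b) \<in> GG 1 l" unfolding rmat_mult using that by (intro GG_mult) (auto simp flip: Gamma0_GG simp del: One_nat_def)
    then show ?thesis unfolding Gamma0_GG[symmetric] by auto
  qed
  show "C = (\<lambda>h. h ** g) ` Gamma0 l"
  proof (intro equalityI subsetI)
    fix x assume "x \<in> C"
    then obtain h where h: "h \<in> Gamma0 l" "x = h ** g0" using C by auto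
    have "(h ** hi) ** g = h ** ((hi ** h0) ** g0)" unfolding g by (simp only: matrix_mul_assoc)
    then have "x = (h ** hi) ** g" by (simp add: hih h)
    then show "x \<in> (\<lambda>h. h ** g) ` Gamma0 l" using mul[OF h(1) hi(1)] by blast
  next
    fix x assume "x \<in> (\<lambda>h. h ** g) ` Gamma0 l"
    then obtain h where h: "h \<in> Gamma0 l" "x = h ** g" by auto
    then have "x = (h ** h0) ** g0" by (simp add: g matrix_mul_assoc)
    then show "x \<in> C" using mul[OF h(1) h0] C by blast
  qed
qed

lemma one_Gamma0: "mat 1 \<in> Gamma0 l"
  by (simp add: Gamma0_def SL2Z_def mat_def det_2)

lemma coset_rep_in: "C \<in> Gamma0_cosets l \<Longrightarrow> coset_rep C \<in> C"
proof -
  assume "C \<in> Gamma0_cosets l"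
  then obtain g where "C = (\<lambda>h. h ** g) ` Gamma0 l" by (auto simp: Gamma0_cosets_def)
  then have "mat 1 ** g \<in> C" using one_Gamma0 by blast
  then show ?thesis unfolding coset_rep_def by (rule someI)
qed

lemma coset_rep_unique:
  assumes "C \<in> Gamma0_cosets l" "C' \<in> Gamma0_cosets l" "rmat (coset_rep C') ** minv (rmat (coset_rep C)) \<in> GG 1 l"
  shows "C = C'"
proof -
  note c = coset_eq_translates[OF assms(1) coset_rep_in[OF assms(1)]] and c' = coset_eq_translates[OF assms(2) coset_rep_in[OF assms(2)]]
  obtain h where h: "h \<in> Gamma0 l" "rmat (coset_rep C') ** minv (rmat (coset_rep C)) = rmat h" using assms(3) Gamma0_GG by blast
  have d: "det (rmat (coset_rep C)) = 1" using c(1) by (simp add: det_rmat SL2Z_def)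
  have "rmat (h ** coset_rep C) = rmat (coset_rep C')" unfolding rmat_mult h(2)[symmetric] by (simp add: matrix_mul_assoc[symmetric] minv_mult d)
  then have "coset_rep C' = h ** coset_rep C" by simp
  then have "coset_rep C' \<in> C" using c(2) h(1) by blast
  from coset_eq_translates(2)[OF assms(1) this] c'(2) show ?thesis by simp
qed

text \<open>A coset is determined by the bottom row of a representative modulo \<open>l\<close>: the
  lower left entry of \<open>g' g^(-1)\<close> is \<open>c'd - cd'\<close>, which is divisible by
  \<open>l\<close> for congruent rows.\<close>

lemma finite_cosets: 
  assumes "l > 0" shows "finite (Gamma0_cosets l)"
proof (rule finite_imageD)
  let ?f = "\<lambda>C. (coset_rep C $ 2 $ 1 mod int l, coset_rep C $ 2 $ 2 mod int l)"
  have "?f ` Gamma0_cosets l \<subseteq> {0..<int l} \<times> {0..<int l}" using assms by auto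
  then show "finite (?f ` Gamma0_cosets l)" by (rule finite_subset) simp
  show "inj_on ?f (Gamma0_cosets l)"
  proof (rule inj_onI)
    fix C C' assume C: "C \<in> Gamma0_cosets l" "C' \<in> Gamma0_cosets l" "?f C = ?f C'"
    define g g' where "g = coset_rep C" and "g' = coset_rep C'"
    have dets: "g \<in> SL2Z" "g' \<in> SL2Z" unfolding g_def g'_def using C coset_eq_translates coset_rep_in by blast+
    have "g' $ 2 $ 1 * g $ 2 $ 2 mod int l = g $ 2 $ 1 * g' $ 2 $ 2 mod int l"
      using C(3) by (intro mod_mult_cong) (auto simp: g_def g'_def)
    then have "int l dvd g' $ 2 $ 1 * g $ 2 $ 2 - g $ 2 $ 1 * g' $ 2 $ 2" by (simp only: mod_eq_dvd_iff)
    then obtain t where t: "g' $ 2 $ 1 * g $ 2 $ 2 - g $ 2 $ 1 * g' $ 2 $ 2 = int l * t" by (auto elim: dvdE)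
    have "real_of_int (g' $ 2 $ 1 * g $ 2 $ 2 - g $ 2 $ 1 * g' $ 2 $ 2) = real l * of_int t" unfolding t by simp
    then have r: "(rmat g' ** minv (rmat g)) $ 2 $ 1 / of_nat l = of_int t" using assms
      by (simp add: matrix_mul_nth rmat_def minv_def field_simps)
    have "rmat g' ** minv (rmat g) \<in> GG 1 l"
    proof (rule GG_memI)
      show "det (rmat g' ** minv (rmat g)) = 1" using dets by (simp add: det_mul det_rmat SL2Z_def)
      show "(rmat g' ** minv (rmat g)) $ 2 $ 1 / of_nat l \<in> \<int>" unfolding r by simp
    qed (use assms in \<open>auto simp: matrix_mul_nth rmat_def minv_def\<close>)
    then show "C = C'" using coset_rep_unique C by (simp add: g_def g'_def)
  qed
qed

lemma coset_reps_SL2Z: "r \<in> coset_reps l \<Longrightarrow> r \<in> GG 1 1"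
  unfolding coset_reps_def SL2Z_GG[symmetric] using coset_eq_translates(1) coset_rep_in by blast

lemma coset_rep_inj: "inj_on (\<lambda>C. rmat (coset_rep C)) (Gamma0_cosets l)"
proof (rule inj_onI)
  fix C C' assume C: "C \<in> Gamma0_cosets l" "C' \<in> Gamma0_cosets l" "rmat (coset_rep C) = rmat (coset_rep C')"
  then have "det (rmat (coset_rep C)) = 1" using coset_eq_translates(1)[OF C(1) coset_rep_in[OF C(1)]] by (simp add: det_rmat SL2Z_def)
  then have "rmat (coset_rep C') ** minv (rmat (coset_rep C)) = mat 1" using C(3) by (simp add: minv_mult)
  then show "C = C'" using coset_rep_unique[OF C(1,2)] GG_one by simp
qed

lemma transversal_coset_reps:
  assumes l: "l > 0" shows "transversal (GG 1 l) (coset_reps l) (GG 1 1)"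
  unfolding transversal_def
proof (intro conjI ballI)
  show "finite (coset_reps l)" unfolding coset_reps_def using finite_cosets[OF l] by simp
  show "det r = 1" if "r \<in> coset_reps l" for r using coset_reps_SL2Z[OF that] GG_det by blast
  show "bij_betw (\<lambda>(r, x). x ** r) (coset_reps l \<times> GG 1 l) (GG 1 1)"
    unfolding bij_betw_def
  proof
    show "inj_on (\<lambda>(r, x). x ** r) (coset_reps l \<times> GG 1 l)"
    proof (rule inj_onI, clarify)
      fix r x r' x' assume r: "r \<in> coset_reps l" "r' \<in> coset_reps l" and x: "x \<in> GG 1 l" "x' \<in> GG 1 l" and e: "x ** r = x' ** r'"
      obtain C C' where C: "C \<in> Gamma0_cosets l" "r = rmat (coset_rep C)" "C' \<in> Gamma0_cosets l" "r' = rmat (coset_rep C')" using r by (auto simp: coset_reps_def)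
      have d: "det r = 1" "det r' = 1" "det x' = 1" using coset_reps_SL2Z r x GG_det by blast+
      have "minv x' ** x = minv x' ** ((x ** r) ** minv r)" by (simp add: matrix_mul_assoc[symmetric] minv_mult d)
      also have "\<dots> = ((minv x' ** x') ** r') ** minv r" unfolding e by (simp only: matrix_mul_assoc)
      also have "\<dots> = r' ** minv r" by (simp add: minv_mult d)
      finally have "r' ** minv r \<in> GG 1 l" using GG_mult[of 1 l "minv x'" x] GG_minv x by simp
      then have "C = C'" using coset_rep_unique C by simp
      then have "r = r'" using C by simp
      moreover have "x = (x ** r) ** minv r" "x' = (x' ** r') ** minv r'" by (simp_all add: matrix_mul_assoc[symmetric] minv_mult d)
      ultimately show "r = r' \<and> x = x'" using e by simp
    qed
    show "(\<lambda>(r, x). x ** r) ` (coset_reps l \<times> GG 1 l) = GG 1 1"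
    proof (intro equalityI subsetI)
      fix M assume "M \<in> (\<lambda>(r, x). x ** r) ` (coset_reps l \<times> GG 1 l)"
      then obtain r x where "r \<in> coset_reps l" "x \<in> GG 1 l" "M = x ** r" by auto
      then show "M \<in> GG 1 1" using GG_mult[of 1 1 x r] coset_reps_SL2Z GG_dvd by simp
    next
      fix M assume "M \<in> GG 1 1"
      then obtain g where g: "g \<in> SL2Z" "M = rmat g" using SL2Z_GG by blast
      define C where "C = (\<lambda>h. h ** g) ` Gamma0 l"
      have C: "C \<in> Gamma0_cosets l" unfolding C_def Gamma0_cosets_def using g by blast
      have "mat 1 ** g \<in> C" unfolding C_def using one_Gamma0 by blast
      then have "g \<in> (\<lambda>h. h ** coset_rep C) ` Gamma0 l" using coset_eq_translates(2)[OF C coset_rep_in[OF C]] by simp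
      then obtain h where "h \<in> Gamma0 l" "g = h ** coset_rep C" by auto
      then have "M = rmat h ** rmat (coset_rep C)" "rmat h \<in> GG 1 l" using g Gamma0_GG by (auto simp: rmat_mult)
      moreover have "rmat (coset_rep C) \<in> coset_reps l" using C by (auto simp: coset_reps_def)
      ultimately show "M \<in> (\<lambda>(r, x). x ** r) ` (coset_reps l \<times> GG 1 l)" by force
    qed
  qed
qed

text \<open>Up to a null set this is the indicator function of the union of the translated standard
  domains, a fundamental domain of \<open>\<Gamma>\<^sub>0(l)\<close>.\<close>

definition gamma0_weight :: "nat \<Rightarrow> complex \<Rightarrow> real" where
  "gamma0_weight l z = (\<Sum>r\<in>coset_reps l. indicator fund_domain (mob (minv r) z))"

lemma weight_gamma0_weight: "l > 0 \<Longrightarrow> weight (GG 1 l) 2 (gamma0_weight l)"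
  unfolding gamma0_weight_def[abs_def] by (rule weight_subgroup[OF invgroup_GG invgroup_GG transversal_coset_reps weight_SL2Z])

lemma gamma0_weight_meas [measurable]: "gamma0_weight l \<in> borel_measurable borel"
  unfolding gamma0_weight_def[abs_def] by measurable

lemma set_integral_hyp:
  fixes F :: "complex \<Rightarrow> 'a::{banach, second_countable_topology}"
  assumes [measurable]: "F \<in> borel_measurable borel"
  shows "(LINT z:fund_domain|hyp_measure. F z) = (\<integral>z. indicator fund_domain z *\<^sub>R F z \<partial>hyp_H)"
proof -
  have "(LINT z:fund_domain|hyp_measure. F z) = (\<integral>z. (1 / (Im z)\<^sup>2) *\<^sub>R (indicator fund_domain z *\<^sub>R F z) \<partial>lborel)"
    unfolding set_lebesgue_integral_def hyp_measure_def by (rule integral_density) auto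
  also have "\<dots> = (\<integral>z. (if Im z > 0 then 1 / (Im z)\<^sup>2 else 0) *\<^sub>R (indicator fund_domain z *\<^sub>R F z) \<partial>lborel)"
    by (rule Bochner_Integration.integral_cong) (auto simp: indicator_def dest: fund_domain_Im_pos)
  also have "\<dots> = (\<integral>z. indicator fund_domain z *\<^sub>R F z \<partial>density lborel (\<lambda>z. ennreal (if Im z > 0 then 1 / (Im z)\<^sup>2 else 0)))"
    by (rule integral_density[symmetric]) auto
  also have "density lborel (\<lambda>z. ennreal (if Im z > 0 then 1 / (Im z)\<^sup>2 else 0)) = hyp_H"
    unfolding hyp_H_def by (rule density_cong) auto
  finally show ?thesis .
qed

lemma quotient_integral_coset_reps:
  fixes F :: "complex \<Rightarrow> 'a::{banach, second_countable_topology}"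
  assumes [measurable]: "F \<in> borel_measurable borel"
  shows "quotient_integral l F = (\<Sum>r\<in>coset_reps l. \<integral>z. indicator fund_domain z *\<^sub>R F (mob r z) \<partial>hyp_H)"
  unfolding quotient_integral_def coset_reps_def
  by (subst sum.reindex[OF coset_rep_inj]) (auto simp: act_eq_mob set_integral_hyp coset_rep_def intro!: sum.cong)

text \<open>Integrability is asked on each translate: a non-integrable function has Bochner integral
  0, so otherwise a sum of integrals might differ from the integral of the sum.\<close>

lemma quotient_integral_weighted_int:
  fixes F :: "complex \<Rightarrow> complex"
  assumes F [measurable]: "F \<in> borel_measurable borel" and int: "\<And>r. r \<in> coset_reps l \<Longrightarrow> integrable hyp_H (\<lambda>z. indicator fund_domain z *\<^sub>R F (mob r z))"
  shows "quotient_integral l F = weighted_int (gamma0_weight l) F" "integrable hyp_H (\<lambda>z. gamma0_weight l z *\<^sub>R F z)"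
proof -
  have d: "det r = 1" if "r \<in> coset_reps l" for r using coset_reps_SL2Z[OF that] GG_det by blast
  have ind: "(indicator fund_domain :: complex \<Rightarrow> real) \<in> borel_measurable borel" by measurable
  have i: "integrable hyp_H (\<lambda>z. indicator fund_domain (mob (minv r) z) *\<^sub>R F z)" if "r \<in> coset_reps l" for r
    using weighted_int_mob(2)[OF F ind d[OF that]] int[OF that] by blast
  have "quotient_integral l F = (\<Sum>r\<in>coset_reps l. weighted_int (indicator fund_domain) (\<lambda>z. F (mob r z)))"
    by (simp add: quotient_integral_coset_reps weighted_int_def)
  also have "\<dots> = (\<Sum>r\<in>coset_reps l. weighted_int (\<lambda>z. indicator fund_domain (mob (minv r) z)) F)"
    by (rule sum.cong[OF refl], rule weighted_int_mob(1)[OF F ind d])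
  also have "\<dots> = weighted_int (gamma0_weight l) F"
    unfolding weighted_int_def gamma0_weight_def scaleR_sum_left by (rule Bochner_Integration.integral_sum[symmetric]) (rule i)
  finally show "quotient_integral l F = weighted_int (gamma0_weight l) F" .
  show "integrable hyp_H (\<lambda>z. gamma0_weight l z *\<^sub>R F z)"
    unfolding gamma0_weight_def scaleR_sum_left by (rule Bochner_Integration.integrable_sum) (rule i)
qed

lemma integrable_fund_bounded:
  fixes F :: "complex \<Rightarrow> complex"
  assumes [measurable]: "F \<in> borel_measurable borel" and b: "\<And>z. z \<in> fund_domain \<Longrightarrow> cmod (F z) \<le> C"
  shows "integrable hyp_H (\<lambda>z. indicator fund_domain z *\<^sub>R F z)"
  by (rule integrableI_bounded_set_indicator[where B=C]) (use emeasure_fund b in auto)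

lemma covolume_weighted_int:
  assumes "l > 0"
  shows "complex_of_real (covolume l) = weighted_int (gamma0_weight l) (\<lambda>_. 1)"
proof -
  have "integrable hyp_H (\<lambda>z. indicator fund_domain z *\<^sub>R (1::complex))" by (rule integrable_fund_bounded[where C=1]) auto
  then have "weighted_int (gamma0_weight l) (\<lambda>_. 1) = quotient_integral l (\<lambda>_. 1)"
    by (intro quotient_integral_weighted_int(1)[symmetric]) auto
  also have "\<dots> = complex_of_real (covolume l)"
  proof -
    have "(\<integral>z. indicator fund_domain z *\<^sub>R (1::complex) \<partial>hyp_H) = of_real (\<integral>z. indicator fund_domain z *\<^sub>R 1 \<partial>hyp_H)"
      by (subst integral_complex_of_real[symmetric], rule Bochner_Integration.integral_cong) (auto simp: indicator_def)
    then show ?thesis unfolding covolume_def by (simp add: quotient_integral_coset_reps del: scaleR_one real_scaleR_def)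
  qed
  finally show ?thesis by simp
qed

section \<open>Unipotent representatives of cosets\<close>

definition up :: "nat \<Rightarrow> nat \<Rightarrow> real^2^2" where "up d i = mat22 1 (of_nat i / of_nat d) 0 1"
definition lo :: "nat \<Rightarrow> nat \<Rightarrow> real^2^2" where "lo y j = mat22 1 0 (of_nat j * of_nat y) 1"

lemma det_up [simp]: "det (up d i) = 1" and det_lo [simp]: "det (lo y i) = 1"
  by (simp_all add: up_def lo_def)

lemma inj_up: "d > 0 \<Longrightarrow> inj_on (up d) A" and inj_lo: "y > 0 \<Longrightarrow> inj_on (lo y) A"
  by (auto simp: inj_on_def up_def lo_def)

lemma GG_intE:
  assumes "M \<in> GG x y" "x > 0"
  obtains a b c d :: int where "M = mat22 (of_int a) (of_int b / of_nat x) (of_int c * of_nat y) (of_int d)"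
    "int x * (a * d) - b * c * int y = int x"
proof -
  from assms obtain a b c d :: int where M: "M = mat22 (of_int a) (of_int b / of_nat x) (of_int c * of_nat y) (of_int d)"
    and e: "of_int a * of_int d - (of_int b / of_nat x) * (of_int c * of_nat y) = (1::real)"
    unfolding GG_def by blast
  from e have "real_of_int (int x * (a * d) - b * c * int y) = of_int (int x)" using assms(2) by (simp add: field_simps)
  then have "int x * (a * d) - b * c * int y = int x" by (simp only: of_int_eq_iff)
  with M that show ?thesis by blast
qed

text \<open>Coset representatives taken from the powers of one element: \<open>s i\<close> and
  \<open>s j\<close> lie in the same coset only if \<open>s (j - i)\<close> is in \<open>H\<close>,
  hence only if \<open>d\<close> divides \<open>j - i\<close>, which is smaller than
  \<open>d\<close>.\<close>

lemma transversal_cyclic: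
  fixes s :: "nat \<Rightarrow> real^2^2"
  assumes s: "\<And>i j. s i ** s j = s (i + j)" "\<And>i. det (s i) = 1"
    and H: "invgroup H" "\<And>x y. x \<in> H \<Longrightarrow> y \<in> H \<Longrightarrow> x ** y \<in> H"
    and G: "\<And>x y. x \<in> G \<Longrightarrow> y \<in> G \<Longrightarrow> x ** y \<in> G" "H \<subseteq> G" "\<And>i. s i \<in> G"
    and inj: "\<And>i. s i \<in> H \<Longrightarrow> d dvd i"
    and surj: "\<And>M. M \<in> G \<Longrightarrow> \<exists>i<d. M ** minv (s i) \<in> H"
  shows "transversal H (s ` {..<d}) G"
  unfolding transversal_def
proof (intro conjI ballI)
  show "finite (s ` {..<d})" by simp
  show "det r = 1" if "r \<in> s ` {..<d}" for r using that s by auto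
  have dH: "det x = 1" "minv x \<in> H" if "x \<in> H" for x using H(1) that by (auto simp: invgroup_def)
  have key: "i = j" if ij: "i \<le> j" "j < d" "x \<in> H" "x' \<in> H" "x ** s i = x' ** s j" for i j x x'
  proof -
    have "s j = s (j - i) ** s i" using ij(1) by (simp add: s)
    then have "(minv x' ** (x ** s i)) ** minv (s i) = (minv x' ** (x' ** (s (j - i) ** s i))) ** minv (s i)"
      using ij(5) by simp
    then have "minv x' ** (x ** (s i ** minv (s i))) = (minv x' ** x') ** (s (j - i) ** (s i ** minv (s i)))"
      by (simp only: matrix_mul_assoc)
    then have "minv x' ** x = s (j - i)" using dH(1)[OF ij(4)] s by (simp add: minv_mult)
    then have "s (j - i) \<in> H" using H(2)[OF dH(2)[OF ij(4)] ij(3)] by simp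
    then have "d dvd j - i" by (rule inj)
    then show ?thesis using ij(1,2) by (meson diff_less_mono2 dvd_imp_le le_antisym less_imp_diff_less not_less zero_less_diff)
  qed
  show "bij_betw (\<lambda>(r, x). x ** r) (s ` {..<d} \<times> H) G"
    unfolding bij_betw_def
  proof
    show "inj_on (\<lambda>(r, x). x ** r) (s ` {..<d} \<times> H)"
    proof (rule inj_onI, clarify)
      fix x x' i j assume x: "x \<in> H" "x' \<in> H" "x ** s i = x' ** s j" "i < d" "j < d"
      have "i = j" using key[of i j x x'] key[of j i x' x] x by (metis nat_le_linear)
      moreover have "(x ** s i) ** minv (s i) = (x' ** s j) ** minv (s i)" using x by simp
      ultimately show "s i = s j \<and> x = x'" using s by (simp add: matrix_mul_assoc[symmetric] minv_mult)
    qed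
    show "(\<lambda>(r, x). x ** r) ` (s ` {..<d} \<times> H) = G"
    proof (intro equalityI subsetI)
      fix M assume "M \<in> (\<lambda>(r, x). x ** r) ` (s ` {..<d} \<times> H)"
      then show "M \<in> G" using G by auto
    next
      fix M assume "M \<in> G"
      then obtain i where i: "i < d" "M ** minv (s i) \<in> H" using surj by blast
      have "M = (M ** minv (s i)) ** s i" using s by (simp add: matrix_mul_assoc[symmetric] minv_mult)
      then show "M \<in> (\<lambda>(r, x). x ** r) ` (s ` {..<d} \<times> H)" using i by force
    qed
  qed
qed

text \<open>In both cases the representative is found by inverting a diagonal entry, \<open>aa' \<equiv> 1\<close> modulo \<open>d\<close> (or \<open>e\<close>).\<close>

lemma transversal_up:
  assumes d: "d > 0" and y: "y > 0" and dy: "d * d dvd y"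
  shows "transversal (GG 1 y) (up d ` {..<d}) (GG d y)"
proof -
  obtain m where m: "y = d * (d * m)" using dy by (metis dvdE mult.assoc)
  then have dvdy: "d dvd y" by simp
  show ?thesis
  proof (rule transversal_cyclic[OF _ det_up invgroup_GG GG_mult GG_mult[OF d dvdy]])
    show "up d i ** up d j = up d (i + j)" for i j by (simp add: up_def add_divide_distrib)
    show "GG 1 y \<subseteq> GG d y" using d y by (intro GG_mono) auto
    show "up d i \<in> GG d y" for i by (rule GG_memI) (use d y in \<open>auto simp: up_def\<close>)
    show "d dvd i" if "up d i \<in> GG 1 y" for i
    proof -
      have "real i / real d \<in> \<int>" using GG_memD(2)[OF _ y that] by (simp add: up_def)
      then obtain t :: int where "real i / real d = of_int t" by (auto elim: Ints_cases)
      then have "real_of_int (int i) = of_int (int d * t)" using d by (simp add: field_simps)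
      then have "int i = int d * t" by (simp only: of_int_eq_iff)
      then show "d dvd i" by (metis dvd_triv_left int_dvd_int_iff)
    qed
    fix M assume M: "M \<in> GG d y"
    obtain a b c a' :: int where e: "M = mat22 (of_int a) (of_int b / of_nat d) (of_int c * of_nat y) (of_int a')"
      and D: "int d * (a * a') - b * c * int y = int d" by (rule GG_intE[OF M d])
    have "int d * (a * a' - b * c * (int d * int m)) = int d * 1" using D by (simp add: m algebra_simps)
    \<comment> \<open>Divisibility of \<open>y\<close> by \<open>d * d\<close> leaves a factor
      \<open>d\<close> in the off-diagonal product, which is what makes \<open>a\<close> invertible
      modulo \<open>d\<close>.\<close>
    then have D': "a * a' - b * c * (int d * int m) = 1" using d by (simp only: mult_cancel_left) simp
    define i where "i = nat (b * a' mod int d)"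
    have i: "int i = b * a' mod int d" "i < d" using d by (auto simp: i_def nat_less_iff)
    have "a * int i mod int d = a * (b * a') mod int d" unfolding i(1) by (rule mod_mult_right_eq)
    also have "a * (b * a') = b * (a * a')" by (simp add: mult_ac)
    also have "a * a' = 1 + b * c * (int d * int m)" using D' by (simp add: algebra_simps)
    also have "b * (1 + b * c * (int d * int m)) mod int d = b mod int d" by (simp add: mod_eq_dvd_iff algebra_simps)
    finally have "int d dvd b - a * int i" by (simp only: mod_eq_dvd_iff dvd_diff_commute)
    then obtain t where t: "b - a * int i = int d * t" by (auto elim: dvdE)
    then have t': "real_of_int b = of_int a * of_nat i + of_nat d * of_int t"
      using arg_cong[OF t, of real_of_int] by (simp add: algebra_simps)
    define x where "x = M ** minv (up d i)"
    have "x \<in> GG 1 y"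
    proof (rule GG_memI)
      show "det x = 1" using GG_det[OF M] by (simp add: x_def det_mul)
      show "x $ 1 $ 1 \<in> \<int>" "x $ 1 $ 2 * of_nat 1 \<in> \<int>" "x $ 2 $ 1 / of_nat y \<in> \<int>" "x $ 2 $ 2 \<in> \<int>"
      proof -
        show "x $ 1 $ 1 \<in> \<int>" by (simp add: x_def e up_def minv_def)
        have "x $ 1 $ 2 = of_int t" using d t' by (simp add: x_def e up_def minv_def field_simps)
        then show "x $ 1 $ 2 * of_nat 1 \<in> \<int>" by simp
        show "x $ 2 $ 1 / of_nat y \<in> \<int>" using y by (simp add: x_def e up_def minv_def)
        have "x $ 2 $ 2 = of_int (a' - int i * c * (int d * int m))" using d by (simp add: x_def e up_def minv_def m field_simps)
        then show "x $ 2 $ 2 \<in> \<int>" by (metis Ints_of_int)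
      qed
    qed (use y in auto)
    then show "\<exists>i<d. M ** minv (up d i) \<in> GG 1 y" using i(2) unfolding x_def by blast
  qed simp_all
qed

lemma transversal_lo:
  assumes e: "e > 0" and y: "y > 0" and ey: "e dvd y"
  shows "transversal (GG 1 (e * y)) (lo y ` {..<e}) (GG 1 y)"
proof -
  obtain m where m: "y = e * m" using ey by (auto elim!: dvdE)
  have ey0: "e * y > 0" using e y by simp
  show ?thesis
  proof (rule transversal_cyclic[OF _ det_lo invgroup_GG GG_mult GG_mult])
    show "lo y i ** lo y j = lo y (i + j)" for i j by (simp add: lo_def algebra_simps)
    show "GG 1 (e * y) \<subseteq> GG 1 y" using e y by (intro GG_mono) auto
    show "lo y i \<in> GG 1 y" for i by (rule GG_memI) (use y in \<open>auto simp: lo_def\<close>)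
    show "e dvd i" if "lo y i \<in> GG 1 (e * y)" for i
    proof -
      have "real i * real y / real (e * y) \<in> \<int>" using GG_memD(3)[OF _ ey0 that] by (simp add: lo_def)
      then obtain t :: int where "real i * real y / real (e * y) = of_int t" by (auto elim: Ints_cases)
      then have "real_of_int (int i) = of_int (int e * t)" using e y by (simp add: field_simps)
      then have "int i = int e * t" by (simp only: of_int_eq_iff)
      then show "e dvd i" by (metis dvd_triv_left int_dvd_int_iff)
    qed
    fix M assume M: "M \<in> GG 1 y"
    obtain a b c a' :: int where eM: "M = mat22 (of_int a) (of_int b / of_nat 1) (of_int c * of_nat y) (of_int a')"
      and D: "int 1 * (a * a') - b * c * int y = int 1" by (rule GG_intE[OF M zero_less_one])
    have D': "a * a' = 1 + b * c * (int e * int m)" using D by (simp add: m algebra_simps)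
    define i where "i = nat (c * a mod int e)"
    have i: "int i = c * a mod int e" "i < e" using e by (auto simp: i_def nat_less_iff)
    have "a' * int i mod int e = a' * (c * a) mod int e" unfolding i(1) by (rule mod_mult_right_eq)
    also have "a' * (c * a) = c * (a * a')" by (simp add: mult_ac)
    also have "a * a' = 1 + b * c * (int e * int m)" using D' by (simp add: algebra_simps)
    also have "c * (1 + b * c * (int e * int m)) mod int e = c mod int e" by (simp add: mod_eq_dvd_iff algebra_simps)
    finally have "int e dvd c - a' * int i" by (simp only: mod_eq_dvd_iff dvd_diff_commute)
    then obtain t where t: "c - a' * int i = int e * t" by (auto elim: dvdE)
    then have t': "real_of_int c = of_int a' * of_nat i + of_nat e * of_int t"
      using arg_cong[OF t, of real_of_int] by (simp add: algebra_simps)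
    define x where "x = M ** minv (lo y i)"
    have "x \<in> GG 1 (e * y)"
    proof (rule GG_memI[OF zero_less_one ey0])
      show "det x = 1" using GG_det[OF M] by (simp add: x_def det_mul)
      have "x $ 1 $ 1 = of_int (a - b * int i * int y)" by (simp add: x_def eM lo_def minv_def)
      then show "x $ 1 $ 1 \<in> \<int>" by (metis Ints_of_int)
      show "x $ 1 $ 2 * of_nat 1 \<in> \<int>" by (simp add: x_def eM lo_def minv_def)
      have "x $ 2 $ 1 / of_nat (e * y) = of_int t" using e y t' by (simp add: x_def eM lo_def minv_def field_simps)
      then show "x $ 2 $ 1 / of_nat (e * y) \<in> \<int>" by simp
      show "x $ 2 $ 2 \<in> \<int>" by (simp add: x_def eM lo_def minv_def)
    qed
    then show "\<exists>i<e. M ** minv (lo y i) \<in> GG 1 (e * y)" using i(2) unfolding x_def by blast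
  qed simp_all
qed

section \<open>Conjugation by dilations\<close>

definition dilation :: "nat \<Rightarrow> real^2^2" where "dilation d = mat22 (of_nat d) 0 0 1"

lemma mob_dilation: "mob (dilation d) z = of_nat d * z" by (simp add: mob_def den_def dilation_def)

lemma det_dilation [simp]: "det (dilation d) = of_nat d" by (simp add: dilation_def)

text \<open>For \<open>d > 0\<close> this is the conjugate of \<open>M\<close> by
  \<open>dilation d\<close>, written out so that membership in the groups \<open>GG\<close> can be
  read off the entries.\<close>

definition conj_dilation :: "nat \<Rightarrow> real^2^2 \<Rightarrow> real^2^2" where
  "conj_dilation d M = mat22 (M$1$1) (M$1$2 * of_nat d) (M$2$1 / of_nat d) (M$2$2)"

lemma dilation_conj_dilation: "d > 0 \<Longrightarrow> dilation d ** M = conj_dilation d M ** dilation d"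
  by (simp add: vec_eq_iff forall_2 matrix_mul_nth dilation_def conj_dilation_def)

lemma det_conj_dilation: "d > 0 \<Longrightarrow> det (conj_dilation d M) = det M"
  by (simp add: conj_dilation_def det_2)

lemma bij_conj_dilation:
  assumes "d > 0" "L > 0"
  shows "bij_betw (conj_dilation d) (GG d (d * L)) (GG 1 L)"
proof (rule bij_betwI[where g="\<lambda>M. mat22 (M$1$1) (M$1$2 / of_nat d) (M$2$1 * of_nat d) (M$2$2)"])
  have p: "d * L > 0" using assms by simp
  show "conj_dilation d \<in> GG d (d * L) \<rightarrow> GG 1 L"
  proof
    fix M assume M: "M \<in> GG d (d * L)"
    note D = GG_memD[OF assms(1) p M]
    show "conj_dilation d M \<in> GG 1 L"
      by (rule GG_memI) (use assms D GG_det[OF M] in \<open>auto simp: det_conj_dilation, auto simp: conj_dilation_def field_simps\<close>)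
  qed
  show "(\<lambda>M. mat22 (M$1$1) (M$1$2 / of_nat d) (M$2$1 * of_nat d) (M$2$2)) \<in> GG 1 L \<rightarrow> GG d (d * L)"
  proof
    fix M assume M: "M \<in> GG 1 L"
    note D = GG_memD[OF zero_less_one assms(2) M]
    have "M$1$1 * M$2$2 - M$1$2 * M$2$1 = 1" using GG_det[OF M] by (simp add: det_2)
    then show "mat22 (M$1$1) (M$1$2 / of_nat d) (M$2$1 * of_nat d) (M$2$2) \<in> GG d (d * L)"
      by (intro GG_memI) (use assms D in \<open>auto simp: field_simps\<close>)
  qed
  fix M show "mat22 (conj_dilation d M$1$1) (conj_dilation d M$1$2 / of_nat d) (conj_dilation d M$2$1 * of_nat d) (conj_dilation d M$2$2) = M"
    using assms by (simp add: conj_dilation_def flip: mat22_eta)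
  show "conj_dilation d (mat22 (M$1$1) (M$1$2 / of_nat d) (M$2$1 * of_nat d) (M$2$2)) = M"
    using assms by (simp add: conj_dilation_def flip: mat22_eta)
qed

lemma weight_conj:
  assumes d: "d > 0" "L > 0" and w: "weight (GG 1 L) c w"
  shows "weight (GG d (d * L)) c (\<lambda>z. w (mob (dilation d) z))"
proof -
  have wm [measurable]: "w \<in> borel_measurable borel" using w by (simp add: weight_def)
  have "AE z in hyp_H. (\<integral>\<^sup>+M. ennreal (w (mob M z)) \<partial>count_space (GG 1 L)) = ennreal c" using w by (simp add: weight_def)
  then have "AE z in hyp_H. (\<integral>\<^sup>+M. ennreal (w (mob M (mob (dilation d) z))) \<partial>count_space (GG 1 L)) = ennreal c"
    by (rule AE_hyp_H_mob) (use d in simp)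
  then have "AE z in hyp_H. (\<integral>\<^sup>+M. ennreal (w (mob (dilation d) (mob M z))) \<partial>count_space (GG d (d * L))) = ennreal c"
    using AE_hyp_H
  proof eventually_elim
    case (elim z)
    have "(\<integral>\<^sup>+M. ennreal (w (mob (dilation d) (mob M z))) \<partial>count_space (GG d (d * L))) =
      (\<integral>\<^sup>+M. ennreal (w (mob (conj_dilation d M) (mob (dilation d) z))) \<partial>count_space (GG d (d * L)))"
    proof (rule nn_integral_cong)
      fix M assume "M \<in> space (count_space (GG d (d * L)))"
      then have "det M = 1" by (simp add: GG_det)
      then have "mob (dilation d) (mob M z) = mob (dilation d ** M) z" "mob (conj_dilation d M) (mob (dilation d) z) = mob (conj_dilation d M ** dilation d) z"
        using elim(2) d by (simp_all add: mob_mult_H)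
      then show "ennreal (w (mob (dilation d) (mob M z))) = ennreal (w (mob (conj_dilation d M) (mob (dilation d) z)))"
        using d by (simp add: dilation_conj_dilation)
    qed
    also have "\<dots> = (\<integral>\<^sup>+M. ennreal (w (mob M (mob (dilation d) z))) \<partial>count_space (GG 1 L))"
      by (rule nn_integral_bij_count_space[OF bij_conj_dilation[OF d]])
    finally show ?case using elim by simp
  qed
  then show ?thesis using w by (simp add: weight_def)
qed

text \<open>Both integrands live on \<open>GG d (d * L)\<close>. The weight of level
  \<open>e * (d * L)\<close> has mass \<open>2de\<close> there, the index being \<open>e\<close> for
  the lower and \<open>d\<close> for the upper unipotents; the pulled back weight of level
  \<open>L\<close> has mass 2. Uniqueness up to mass gives the factor \<open>de\<close>.\<close>

lemma weighted_int_dilate: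
  assumes pos: "d > 0" "e > 0" "L > 0" and dvd: "d dvd L" "e dvd d * L"
    and F [measurable]: "F \<in> borel_measurable borel" and inv: "\<And>M z. M \<in> GG 1 L \<Longrightarrow> Im z > 0 \<Longrightarrow> F (mob M z) = F z"
  shows "weighted_int (gamma0_weight (e * (d * L))) (\<lambda>z. F (mob (dilation d) z)) = of_nat (d * e) * weighted_int (gamma0_weight L) F"
proof -
  let ?y = "d * L"
  have y: "?y > 0" "e * ?y > 0" using pos by auto
  have c1: "card (lo ?y ` {..<e}) = e" using inj_lo[OF y(1)] by (simp add: card_image)
  have c2: "card (up d ` {..<d}) = d" using inj_up[OF pos(1)] by (simp add: card_image)
  have "weight (GG 1 ?y) (real e * 2) (gamma0_weight (e * ?y))"
    using weight_supgroup[OF invgroup_GG transversal_lo[OF pos(2) y(1) dvd(2)] weight_gamma0_weight[OF y(2)]] c1 by simp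
  then have w1: "weight (GG d ?y) (real (d * e) * 2) (gamma0_weight (e * ?y))"
    using weight_supgroup[OF invgroup_GG transversal_up[OF pos(1) y(1)], of "real e * 2"] dvd c2 by (simp add: mult.assoc)
  have w2: "weight (GG d ?y) 2 (\<lambda>z. gamma0_weight L (mob (dilation d) z))"
    by (rule weight_conj[OF pos(1,3) weight_gamma0_weight[OF pos(3)]])
  have "weighted_int (gamma0_weight (e * ?y)) (\<lambda>z. F (mob (dilation d) z)) = of_real (real (d * e)) * weighted_int (\<lambda>z. gamma0_weight L (mob (dilation d) z)) (\<lambda>z. F (mob (dilation d) z))"
  proof (rule weight_weighted_int_scale[OF invgroup_GG _ _ w2 w1])
    fix M z assume M: "M \<in> GG d ?y" and z: "Im z > 0"
    have "conj_dilation d M \<in> GG 1 L" using bij_conj_dilation[OF pos(1,3)] M by (auto simp: bij_betw_def)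
    moreover have "mob (dilation d) (mob M z) = mob (conj_dilation d M) (mob (dilation d) z)"
      using z pos GG_det[OF M] by (simp add: dilation_conj_dilation flip: mob_mult_H)
    moreover have "Im (mob (dilation d) z) > 0" using z pos by (simp add: mob_dilation)
    ultimately show "F (mob (dilation d) (mob M z)) = F (mob (dilation d) z)" using inv by simp
  qed (use pos in auto)
  also have "weighted_int (\<lambda>z. gamma0_weight L (mob (dilation d) z)) (\<lambda>z. F (mob (dilation d) z)) = weighted_int (gamma0_weight L) F"
    unfolding weighted_int_def using integral_hyp_H_mob(1)[of "\<lambda>z. gamma0_weight L z *\<^sub>R F z" "dilation d"] pos by simp
  finally show ?thesis by simp
qed

lemma covolume_dilate:
  assumes pos: "d > 0" "e > 0" "L > 0" and dvd: "d dvd L" "e dvd d * L"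
  shows "covolume (e * (d * L)) = of_nat (d * e) * covolume L"
proof -
  have "complex_of_real (covolume (e * (d * L))) = of_nat (d * e) * of_real (covolume L)"
    using weighted_int_dilate[OF assms, of "\<lambda>_. 1"] pos by (simp add: covolume_weighted_int)
  then show ?thesis by (metis of_real_eq_iff of_real_mult of_real_of_nat_eq)
qed

section \<open>Growth of cusp forms\<close>

text \<open>Raise \<open>1 + cy/N \<le> exp (cy/N)\<close> to the power \<open>N\<close>.\<close>

lemma pow_exp_bound:
  fixes c :: real assumes "c > 0"
  obtains K where "K \<ge> 0" "\<And>y. y \<ge> 0 \<Longrightarrow> y ^ N * exp (- c * y) \<le> K"
proof (cases "N = 0")
  case True
  then show ?thesis using that[of 1] assms by simp
next
  case False
  have "y ^ N * exp (- c * y) \<le> (real N / c) ^ N" if "y \<ge> 0" for y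
  proof -
    have "(c * y / real N) ^ N \<le> (1 + c * y / real N) ^ N" using assms that by (intro power_mono) auto
    also have "\<dots> \<le> exp (c * y)" using assms that False by (intro exp_ge_one_plus_x_over_n_power_n) (auto intro: order_trans[of _ 0])
    finally have "(real N / c) ^ N * (c * y / real N) ^ N \<le> (real N / c) ^ N * exp (c * y)" using assms by (intro mult_left_mono) auto
    moreover have "(real N / c) ^ N * (c * y / real N) ^ N = y ^ N" using assms False by (simp flip: power_mult_distrib)
    ultimately show ?thesis by (simp add: exp_minus field_simps)
  qed
  then show ?thesis using that[of "(real N / c) ^ N"] assms by simp
qed

text \<open>
  The \<open>q\<close>-expansion argument: \<open>G\<close> is a function of \<open>exp (2\<pi>iz/l)\<close> that extends holomorphically
  to the unit disc and vanishes at \<open>0\<close>; then apply the Schwarz lemma.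
\<close>
lemma periodic_decay:
  assumes hol: "G holomorphic_on upper_half_plane" and l: "l > (0::real)"
    and per: "\<And>z. Im z > 0 \<Longrightarrow> G (z + of_real l) = G z" and lim: "(G \<longlongrightarrow> 0) (filtercomap Im at_top)"
  obtains c C where "c > 0" "C \<ge> 0" "\<And>z. Im z \<ge> 1/2 \<Longrightarrow> cmod (G z) \<le> C * exp (- c * Im z)"
proof -
  \<comment> \<open>With \<open>w = exp (2 pi i z / l)\<close> one has
    \<open>z = \<kappa> log w\<close>, up to a multiple of the period \<open>l\<close>.\<close>
  define \<kappa> where "\<kappa> = of_real (l / (2 * pi)) * (- \<i>)"
  define \<Phi> where "\<Phi> w = (if w = 0 then 0 else G (\<kappa> * Ln w))" for w
  have Im\<kappa>: "Im (\<kappa> * u) = - (l / (2 * pi)) * Re u" for u by (simp add: \<kappa>_def)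
  have Im\<kappa>pos: "Im (\<kappa> * u) > 0" if "Re u < 0" for u
    using mult_pos_neg[of "l / (2 * pi)" "Re u"] that l unfolding Im\<kappa> by simp
  have per_nat: "G (z + of_nat n * of_real l) = G z" if "Im z > 0" for z n
  proof (induction n)
    case (Suc n)
    have "G (z + of_nat (Suc n) * of_real l) = G ((z + of_nat n * of_real l) + of_real l)" by (simp add: algebra_simps)
    also have "\<dots> = G (z + of_nat n * of_real l)" using that by (intro per) simp
    finally show ?case using Suc by simp
  qed simp
  have per_int: "G (z + of_int n * of_real l) = G z" if "Im z > 0" for z n
  proof (cases "n \<ge> 0")
    case True then show ?thesis using per_nat[OF that, of "nat n"] by simp
  next
    case False
    then show ?thesis using per_nat[of "z + of_int n * of_real l" "nat (- n)"] that by simp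
  qed
  have \<Phi>_exp: "\<Phi> (exp u) = G (\<kappa> * u)" if "Re u < 0" for u
  proof -
    have "exp (Ln (exp u)) = exp u" by simp
    then obtain n :: int where n: "Ln (exp u) = u + (of_int (2 * n) * pi) * \<i>" unfolding exp_eq by blast
    have "\<kappa> * Ln (exp u) = \<kappa> * u + of_int n * of_real l"
      unfolding n \<kappa>_def by (simp add: field_simps)
    then show ?thesis using per_int[OF Im\<kappa>pos[OF that], of n] by (simp add: \<Phi>_def)
  qed
  have \<Phi>_hol: "\<Phi> holomorphic_on (ball 0 1 - {0})"
  proof (rule holomorphic_onI)
    fix w0 :: complex assume w0: "w0 \<in> ball 0 1 - {0}"
    \<comment> \<open>On this ball \<open>w / w0\<close> stays in the right half-plane, so
      \<open>Ln (w / w0) + Ln w0\<close> is a holomorphic logarithm even where the principal branch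
      jumps; periodicity makes the choice of branch irrelevant.\<close>
    define B where "B = ball w0 (min (cmod w0) (1 - cmod w0))"
    have w0B: "w0 \<in> B" using w0 by (simp add: B_def)
    have B: "Re (w / w0) > 0" "w \<noteq> 0" "cmod w < 1" if "w \<in> B" for w
    proof -
      have d: "cmod (w - w0) < cmod w0" "cmod (w - w0) < 1 - cmod w0" using that by (auto simp: B_def dist_norm norm_minus_commute)
      have "w / w0 - 1 = (w - w0) / w0" using w0 by (simp add: field_simps)
      then have "cmod (w / w0 - 1) < 1" using d(1) w0 by (simp add: norm_divide)
      then have "\<bar>Re (w / w0 - 1)\<bar> < 1" using abs_Re_le_cmod le_less_trans by blast
      then show "Re (w / w0) > 0" by simp
      then show "w \<noteq> 0" by auto
      show "cmod w < 1" using d(2) norm_triangle_ineq[of "w - w0" w0] by simp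
    qed
    have Rneg: "Re (Ln (w / w0) + Ln w0) < 0" and ew: "exp (Ln (w / w0) + Ln w0) = w" if "w \<in> B" for w
    proof -
      have nz: "w / w0 \<noteq> 0" using B(2)[OF that] w0 by simp
      show "exp (Ln (w / w0) + Ln w0) = w" using nz w0 by (simp add: exp_add exp_Ln)
      then have "exp (Re (Ln (w / w0) + Ln w0)) = cmod w" by (metis norm_exp_eq_Re)
      also have "\<dots> < 1" by (rule B[OF that])
      finally show "Re (Ln (w / w0) + Ln w0) < 0" by simp
    qed
    have "(\<lambda>w. G (\<kappa> * (Ln (w / w0) + Ln w0))) holomorphic_on B"
    proof (rule holomorphic_on_compose_gen[of "\<lambda>w. \<kappa> * (Ln (w / w0) + Ln w0)" B G upper_half_plane, unfolded o_def, OF _ hol])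
      show "(\<lambda>w. \<kappa> * (Ln (w / w0) + Ln w0)) holomorphic_on B"
        using B(1) w0 by (intro holomorphic_intros) (force simp: complex_nonpos_Reals_iff)+
      show "(\<lambda>w. \<kappa> * (Ln (w / w0) + Ln w0)) ` B \<subseteq> upper_half_plane"
        using Im\<kappa>pos Rneg by (auto simp: upper_half_plane_def simp del: times_complex.sel plus_complex.sel)
    qed
    then have "\<Phi> holomorphic_on B"
      by (rule holomorphic_transform) (metis \<Phi>_exp Rneg ew)
    then have "\<Phi> field_differentiable at w0"
      using w0B by (intro holomorphic_on_imp_differentiable_at[of _ B]) (auto simp: B_def)
    then show "\<Phi> field_differentiable at w0 within ball 0 1 - {0}"
      by (rule field_differentiable_at_within)
  qed
  have small: "\<exists>\<delta>>0. \<forall>w. w \<noteq> 0 \<and> cmod w < \<delta> \<longrightarrow> cmod (\<Phi> w) < \<epsilon>" if "\<epsilon> > 0" for \<epsilon>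
  proof -
    have "eventually (\<lambda>z. dist (G z) 0 < \<epsilon>) (filtercomap Im at_top)" using tendstoD[OF lim that] .
    then obtain Y where Y: "\<And>z. Im z > Y \<Longrightarrow> cmod (G z) < \<epsilon>" unfolding eventually_filtercomap_at_top_dense by auto
    have "cmod (\<Phi> w) < \<epsilon>" if w: "w \<noteq> 0" "cmod w < exp (- (2 * pi / l) * Y)" for w
    proof -
      have "ln (cmod w) < - (2 * pi / l) * Y" using w by (metis exp_less_cancel_iff exp_ln zero_less_norm_iff)
      then have "Y < - (l / (2 * pi)) * ln (cmod w)" using l by (simp add: field_simps)
      then have "Im (\<kappa> * Ln w) > Y" unfolding Im\<kappa> using w(1) by simp
      then show ?thesis using Y w(1) by (simp add: \<Phi>_def)
    qed
    then show ?thesis by (intro exI[of _ "exp (- (2 * pi / l) * Y)"]) auto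
  qed
  have \<Phi>_hol': "\<Phi> holomorphic_on ball 0 1"
  proof (rule no_isolated_singularity'[OF _ \<Phi>_hol])
    fix z :: complex assume "z \<in> {0}"
    then have z: "z = 0" by simp
    have "(\<Phi> \<longlongrightarrow> 0) (at 0)"
      unfolding LIM_eq using small by simp
    then show "(\<Phi> \<longlongrightarrow> \<Phi> z) (at z within ball 0 1)"
      unfolding z by (simp add: \<Phi>_def tendsto_within_subset[OF _ subset_UNIV])
  qed auto
  \<comment> \<open>The half-plane \<open>Im z \<ge> 1/2\<close> corresponds to
    \<open>|w| \<le> exp (-pi/l)\<close>, which lies strictly inside the disc of radius
    \<open>r\<close>, itself strictly inside the unit disc.\<close>
  define r where "r = exp (- pi / (2 * l))"
  have r: "0 < r" "r < 1" using l by (auto simp: r_def)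
  have "compact (\<Phi> ` cball 0 r)"
    using r holomorphic_on_imp_continuous_on[OF \<Phi>_hol'] by (intro compact_continuous_image) (auto intro: continuous_on_subset)
  then obtain m where m: "\<And>w. cmod w \<le> r \<Longrightarrow> cmod (\<Phi> w) \<le> m"
    using compact_imp_bounded bounded_iff by (metis imageI mem_cball_0)
  \<comment> \<open>The added 1 provides the strict bound, and the positivity, that the Schwarz
    lemma requires.\<close>
  define m' where "m' = \<bar>m\<bar> + 1"
  have m': "m' > 0" "\<And>w. cmod w \<le> r \<Longrightarrow> cmod (\<Phi> w) < m'" using m by (force simp: m'_def)+
  have schw: "cmod (\<Phi> w) \<le> m' / r * cmod w" if "cmod w < r" for w
  proof -
    have "cmod (\<Phi> (of_real r * (w / of_real r)) / of_real m') \<le> cmod (w / of_real r)"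
    proof (rule Schwarz_Lemma(1)[of "\<lambda>v. \<Phi> (of_real r * v) / of_real m'"])
      have "(\<lambda>v. \<Phi> (of_real r * v)) holomorphic_on ball 0 1"
      proof (rule holomorphic_on_compose_gen[of "\<lambda>v. of_real r * v" "ball 0 1" \<Phi> "ball 0 1", unfolded o_def, OF _ \<Phi>_hol'])
        show "(\<lambda>v. of_real r * v) ` ball 0 1 \<subseteq> ball (0::complex) 1"
        proof clarsimp
          fix v :: complex assume "cmod v < 1"
          then show "cmod (of_real r * v) < 1"
            using mult_right_mono[of r 1 "cmod v"] r by (simp add: norm_mult)
        qed
      qed (intro holomorphic_intros)
      then show "(\<lambda>v. \<Phi> (of_real r * v) / of_real m') holomorphic_on ball 0 1"
        using m'(1) by (intro holomorphic_intros) auto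
      show "\<Phi> (of_real r * 0) / of_real m' = 0" by (simp add: \<Phi>_def)
      show "cmod (\<Phi> (of_real r * v) / of_real m') < 1" if "cmod v < 1" for v
        using m'(2)[of "of_real r * v"] m'(1) r that by (simp add: norm_divide norm_mult)
      show "cmod (w / of_real r) < 1" using that r by (simp add: norm_divide)
    qed
    then show ?thesis using r m'(1) by (simp add: norm_divide field_simps)
  qed
  show thesis
  proof (rule that[of "2 * pi / l" "m' / r"])
    show "2 * pi / l > 0" using l by simp
    show "m' / r \<ge> 0" using m' r by simp
    fix z :: complex assume z: "Im z \<ge> 1/2"
    define u where "u = of_real (2 * pi / l) * \<i> * z"
    have u: "\<kappa> * u = z" "Re u = - (2 * pi / l) * Im z" using l by (simp_all add: \<kappa>_def u_def)
    have neg: "Re u < 0" using z l by (simp add: u(2))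
    have le: "Re u \<le> - pi / l" using z l by (simp add: u(2) field_simps)
    have "- pi / l < - pi / (2 * l)" using l by (simp add: field_simps)
    then have "cmod (exp u) < r" using le by (simp add: r_def)
    then have "cmod (G z) \<le> m' / r * cmod (exp u)" using schw \<Phi>_exp[OF neg] u(1) by metis
    then show "cmod (G z) \<le> m' / r * exp (- (2 * pi / l) * Im z)" by (simp add: u(2))
  qed
qed

lemma GG_1_rmatE:
  assumes "M \<in> GG 1 l" obtains g where "g \<in> Gamma0 l" "M = rmat g"
proof -
  from assms have "M \<in> rmat ` Gamma0 l" by (simp only: Gamma0_GG)
  with that show thesis by blast
qed

lemma GG_1_1_rmatE:
  assumes "M \<in> GG 1 1" obtains g where "g \<in> SL2Z" "M = rmat g"
proof -
  from assms have "M \<in> rmat ` SL2Z" by (simp only: SL2Z_GG)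
  with that show thesis by blast
qed

definition growth_bounded :: "nat \<Rightarrow> (complex \<Rightarrow> complex) \<Rightarrow> bool" where
  "growth_bounded k f \<longleftrightarrow> (\<exists>C. \<forall>z. Im z > 0 \<longrightarrow> cmod (f z) * Im z powr (real k / 2) \<le> C)"

text \<open>Cusp forms for an arbitrary set of matrices, with boundedness in place of vanishing at
  the cusps. The case \<open>forms k {}\<close> retains only the analytic conditions and serves as
  an ambient space stable under all slashes of positive determinant.\<close>

definition forms :: "nat \<Rightarrow> (real^2^2) set \<Rightarrow> (complex \<Rightarrow> complex) set" where
  "forms k G = {f. (\<forall>z. \<not> Im z > 0 \<longrightarrow> f z = 0) \<and> f holomorphic_on upper_half_plane \<and> growth_bounded k f \<and>
     (\<forall>M\<in>G. slash k M f = f)}"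

lemma cusp_formsD:
  assumes "f \<in> cusp_forms k l"
  shows "\<And>z. \<not> Im z > 0 \<Longrightarrow> f z = 0" "f holomorphic_on upper_half_plane"
    "\<And>M. M \<in> GG 1 l \<Longrightarrow> slash k M f = f"
    "\<And>M. M \<in> GG 1 1 \<Longrightarrow> (slash k M f \<longlongrightarrow> 0) (filtercomap Im at_top)"
proof -
  note f = assms[unfolded cusp_forms_def upper_half_plane_def mem_Collect_eq]
  show off: "f z = 0" if "\<not> Im z > 0" for z using f that by blast
  show "f holomorphic_on upper_half_plane" using assms unfolding cusp_forms_def by blast
  have fA: "f (act g z) = autfactor g z ^ k * f z" if "g \<in> Gamma0 l" "Im z > 0" for g z using f that by blast
  show "slash k M f = f" if M: "M \<in> GG 1 l" for M
  proof
    fix z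
    obtain g where g: "g \<in> Gamma0 l" "M = rmat g" by (rule GG_1_rmatE[OF M])
    show "slash k M f z = f z"
    proof (cases "Im z > 0")
      case True
      then have "f (mob M z) = den M z ^ k * f z" using fA[OF g(1)] unfolding g(2) act_eq_mob autfactor_eq_den by blast
      moreover have "den M z \<noteq> 0" using den_nonzero[of M z] GG_det[OF that] True by simp
      ultimately show ?thesis using True GG_det[OF that] by (simp add: slash_def)
    qed (simp add: off)
  qed
  show "(slash k M f \<longlongrightarrow> 0) (filtercomap Im at_top)" if M: "M \<in> GG 1 1" for M
  proof -
    obtain g where g: "g \<in> SL2Z" "M = rmat g" by (rule GG_1_1_rmatE[OF M])
    have "((\<lambda>z. f (act g z) / autfactor g z ^ k) \<longlongrightarrow> 0) (filtercomap Im at_top)" using f g by blast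
    moreover have "eventually (\<lambda>z. f (act g z) / autfactor g z ^ k = slash k M f z) (filtercomap Im at_top)"
      unfolding eventually_filtercomap_at_top_dense
      by (rule exI[of _ 0]) (use GG_det[OF that] g in \<open>auto simp: slash_def act_eq_mob autfactor_eq_den\<close>)
    ultimately show ?thesis by (rule Lim_transform_eventually)
  qed
qed

text \<open>Conjugating translation by \<open>l\<close> with any \<open>M\<close> in
  \<open>SL2(Z)\<close> gives an element of \<open>\<Gamma>\<^sub>0(l)\<close>, so
  \<open>slash k M f\<close> has period \<open>l\<close>, whatever the width of the cusp is.\<close>

lemma cusp_slash_decay:
  assumes f: "f \<in> cusp_forms k l" and l: "l > 0" and M: "M \<in> GG 1 1"
  obtains c C where "c > 0" "C \<ge> 0" "\<And>z. Im z \<ge> 1/2 \<Longrightarrow> cmod (slash k M f z) \<le> C * exp (- c * Im z)"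
proof (rule periodic_decay[of "slash k M f" "real l"])
  show "slash k M f holomorphic_on upper_half_plane"
    using cusp_formsD(2)[OF f] GG_det[OF M] by (intro slash_hol) auto
  show "(slash k M f \<longlongrightarrow> 0) (filtercomap Im at_top)" by (rule cusp_formsD(4)[OF f M])
  show "real l > 0" using l by simp
  fix z assume z: "Im z > 0"
  obtain a b c d :: int where e: "M = mat22 (of_int a) (of_int b) (of_int c) (of_int d)" and det: "a * d - b * c = 1" by (rule GG_1_1E[OF M])
  define T where "T = mat22 1 (real l) 0 1"
  define N where "N = M ** T ** minv M"
  have dM: "det M = 1" by (rule GG_det[OF M])
  have dT: "det T = 1" by (simp add: T_def)
  have "real_of_int (a * d) = of_int (1 + b * c)" using det by (simp add: algebra_simps)
  then have rdet: "real_of_int a * of_int d = 1 + of_int b * of_int c" by simp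
  have N: "N \<in> GG 1 l"
  proof (rule GG_memI)
    show "det N = 1" by (simp add: N_def det_mul dM dT)
    have "N $ 1 $ 1 = of_int (1 - a * c * int l)" using rdet by (simp add: N_def T_def minv_def e algebra_simps)
    then show "N $ 1 $ 1 \<in> \<int>" by (metis Ints_of_int)
    have "N $ 1 $ 2 = of_int (a * a * int l)" by (simp add: N_def T_def minv_def e algebra_simps)
    then show "N $ 1 $ 2 * of_nat 1 \<in> \<int>" by (metis Ints_of_int mult.right_neutral of_nat_1)
    have "N $ 2 $ 1 / of_nat l = of_int (- c * c)" using l by (simp add: N_def T_def minv_def e algebra_simps)
    then show "N $ 2 $ 1 / of_nat l \<in> \<int>" by (metis Ints_of_int)
    have "N $ 2 $ 2 = of_int (1 + a * c * int l)" using rdet by (simp add: N_def T_def minv_def e algebra_simps)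
    then show "N $ 2 $ 2 \<in> \<int>" by (metis Ints_of_int)
  qed (use l in auto)
  have NM: "N ** M = M ** T" by (simp add: N_def matrix_mul_assoc[symmetric] minv_mult dM)
  have "slash k T (slash k M f) = slash k (N ** M) f" using dM dT by (simp add: slash_slash NM)
  also have "\<dots> = slash k M (slash k N f)" using dM GG_det[OF N] by (simp add: slash_slash)
  also have "slash k N f = f" by (rule cusp_formsD(3)[OF f N])
  finally have "slash k T (slash k M f) z = slash k M f z" by simp
  moreover have "slash k T (slash k M f) z = slash k M f (z + of_real (real l))"
    using z by (subst slash_def) (simp add: T_def mob_def den_def)
  ultimately show "slash k M f (z + of_real (real l)) = slash k M f z" by simp
next
  fix c C :: real assume "c > 0" "C \<ge> 0" "\<And>z. Im z \<ge> 1/2 \<Longrightarrow> cmod (slash k M f z) \<le> C * exp (- c * Im z)"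
  then show thesis by (rule that)
qed

text \<open>Trades the real exponent for a natural one, to fit \<open>pow_exp_bound\<close>.
  Doubling \<open>y\<close> makes the base at least 1, so that the exponent may be
  increased.\<close>

lemma powr_half_le: "y \<ge> 1/2 \<Longrightarrow> y powr (real k / 2) \<le> 2 ^ k * y ^ k"
proof -
  assume y: "y \<ge> 1/2"
  have "y powr (real k / 2) \<le> (2 * y) powr (real k / 2)" using y by (intro powr_mono2) auto
  also have "\<dots> \<le> (2 * y) powr (real k)" using y by (intro powr_mono) auto
  also have "\<dots> = 2 ^ k * y ^ k" using y by (simp add: powr_realpow power_mult_distrib)
  finally show ?thesis .
qed

text \<open>Hecke's bound: move \<open>z\<close> into the standard domain by \<open>M\<close> and
  write \<open>minv M = x ** r\<close> with \<open>x\<close> in \<open>\<Gamma>\<^sub>0(l)\<close>.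
  Only the finitely many \<open>slash k r f\<close> then matter, and each is controlled by its
  exponential decay.\<close>

lemma cusp_growth_bounded:
  assumes f: "f \<in> cusp_forms k l" and l: "l > 0"
  shows "growth_bounded k f"
proof -
  have ex: "\<exists>C\<ge>0. \<forall>z. Im z \<ge> 1/2 \<longrightarrow> cmod (slash k r f z) * Im z powr (real k / 2) \<le> C" if r: "r \<in> GG 1 1" for r
  proof -
    obtain c C where C: "c > 0" "C \<ge> 0" "\<And>z. Im z \<ge> 1/2 \<Longrightarrow> cmod (slash k r f z) \<le> C * exp (- c * Im z)"
      by (rule cusp_slash_decay[OF f l r]) (rule that; assumption)
    obtain K where K: "K \<ge> 0" "\<And>y. y \<ge> 0 \<Longrightarrow> y ^ k * exp (- c * y) \<le> K" by (rule pow_exp_bound[OF C(1)]) (rule that; assumption)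
    have "cmod (slash k r f z) * Im z powr (real k / 2) \<le> C * (2 ^ k * K)" if z: "Im z \<ge> 1/2" for z
    proof -
      have "cmod (slash k r f z) * Im z powr (real k / 2) \<le> (C * exp (- c * Im z)) * (2 ^ k * Im z ^ k)"
        using C(3)[OF z] powr_half_le[OF z, of k] z C(2) by (intro mult_mono) auto
      also have "\<dots> = (C * 2 ^ k) * (Im z ^ k * exp (- c * Im z))" by simp
      also have "\<dots> \<le> (C * 2 ^ k) * K" using K(2)[of "Im z"] z C(2) by (intro mult_left_mono) auto
      finally show ?thesis by (simp add: mult_ac)
    qed
    then show ?thesis using K(1) C(2) by (intro exI[of _ "C * (2 ^ k * K)"]) auto
  qed
  define Cf where "Cf r = (SOME C. C \<ge> 0 \<and> (\<forall>z. Im z \<ge> 1/2 \<longrightarrow> cmod (slash k r f z) * Im z powr (real k / 2) \<le> C))" for r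
  have Cf: "Cf r \<ge> 0" "\<And>z. Im z \<ge> 1/2 \<Longrightarrow> cmod (slash k r f z) * Im z powr (real k / 2) \<le> Cf r" if "r \<in> GG 1 1" for r
    using someI_ex[OF ex[OF that]] unfolding Cf_def by blast+
  have tr: "transversal (GG 1 l) (coset_reps l) (GG 1 1)" by (rule transversal_coset_reps[OF l])
  then have fin: "finite (coset_reps l)" and bij: "bij_betw (\<lambda>(r, x). x ** r) (coset_reps l \<times> GG 1 l) (GG 1 1)" by (auto simp: transversal_def)
  have "cmod (f z) * Im z powr (real k / 2) \<le> (\<Sum>r\<in>coset_reps l. Cf r)" if z: "Im z > 0" for z
  proof -
    obtain M where M: "M \<in> GG 1 1" "mob M z \<in> fund_domain" by (rule fund_covering[OF z])
    define z0 where "z0 = mob M z"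
    have dM: "det M = 1" by (rule GG_det[OF M(1)])
    have z0: "Im z0 \<ge> 1/2" using fund_domain_Im_ge M(2) by (simp add: z0_def)
    have "minv M \<in> GG 1 1" by (rule GG_minv[OF M(1)])
    then obtain r x where rx: "r \<in> coset_reps l" "x \<in> GG 1 l" "minv M = x ** r" using bij unfolding bij_betw_def by force
    have zz: "z = mob (minv M) z0" unfolding z0_def using z dM by (simp add: mob_minv)
    have dr: "det r = 1" "det x = 1" using GG_det rx(2) coset_reps_SL2Z[OF rx(1)] by blast+
    have "slash k (minv M) f = slash k r (slash k x f)" using dr by (simp add: rx(3) slash_slash)
    also have "slash k x f = f" by (rule cusp_formsD(3)[OF f rx(2)])
    finally have s: "slash k (minv M) f = slash k r f" .
    have "cmod (f z) * Im z powr (real k / 2) = cmod (slash k (minv M) f z0) * Im z0 powr (real k / 2)"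
      using slash_norm[of "minv M" z0 k f] dM z0 zz by simp
    also have "\<dots> \<le> Cf r" unfolding s by (rule Cf(2)[OF coset_reps_SL2Z[OF rx(1)] z0])
    also have "\<dots> \<le> (\<Sum>r\<in>coset_reps l. Cf r)" using fin rx(1) Cf(1) coset_reps_SL2Z by (intro member_le_sum) auto
    finally show ?thesis .
  qed
  then show ?thesis unfolding growth_bounded_def by blast
qed

lemma growth_bounded_slash: "growth_bounded k f \<Longrightarrow> det M > 0 \<Longrightarrow> growth_bounded k (slash k M f)"
  unfolding growth_bounded_def using Im_mob_pos slash_norm by metis

text \<open>Boundedness of \<open>|f| y\<^bsup>k/2\<^esup>\<close> is invariant under slashing by every matrix of positive determinant, vanishing at the cusps is not visibly so.\<close>
lemma cusp_forms_eq:
  assumes k: "k > 0" and l: "l > 0"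
  shows "cusp_forms k l = forms k (GG 1 l)"
proof (intro equalityI subsetI)
  fix f assume "f \<in> cusp_forms k l"
  then show "f \<in> forms k (GG 1 l)" using cusp_formsD cusp_growth_bounded[OF _ l] by (auto simp: forms_def)
next
  fix f assume f: "f \<in> forms k (GG 1 l)"
  have inv: "f (act g z) = autfactor g z ^ k * f z" if g: "g \<in> Gamma0 l" and z: "z \<in> upper_half_plane" for g z
  proof -
    have M: "rmat g \<in> GG 1 l" using Gamma0_GG g by blast
    then have "slash k (rmat g) f z = f z" using f by (auto simp: forms_def)
    moreover have "den (rmat g) z \<noteq> 0" using den_nonzero[of "rmat g" z] GG_det[OF M] z by (simp add: upper_half_plane_def)
    ultimately show ?thesis using z GG_det[OF M] by (simp add: slash_def upper_half_plane_def act_eq_mob autfactor_eq_den field_simps)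
  qed
  have lim: "((\<lambda>z. f (act g z) / autfactor g z ^ k) \<longlongrightarrow> 0) (filtercomap Im at_top)" if g: "g \<in> SL2Z" for g
  proof (rule tendstoI)
    fix \<epsilon> :: real assume \<epsilon>: "\<epsilon> > 0"
    have M: "rmat g \<in> GG 1 1" using SL2Z_GG g by blast
    have d: "det (rmat g) = 1" by (rule GG_det[OF M])
    have "growth_bounded k (slash k (rmat g) f)" using f d by (intro growth_bounded_slash) (auto simp: forms_def)
    then obtain C where C: "\<And>z. Im z > 0 \<Longrightarrow> cmod (slash k (rmat g) f z) * Im z powr (real k / 2) \<le> C" by (auto simp: growth_bounded_def)
    have C0: "C \<ge> 0" using order_trans[OF norm_ge_zero C[of \<i>, simplified]] by simp
    \<comment> \<open>Chosen so that \<open>Y powr (k / 2) = (C + 1) / \<epsilon>\<close>. Positive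
      weight is what turns the bound \<open>C y^(-k/2)\<close> into decay; the added 1 makes the
      final inequality strict.\<close>
    define Y where "Y = ((C + 1) / \<epsilon>) powr (2 / real k)"
    have Y: "Y > 0" using \<epsilon> C0 by (simp add: Y_def)
    have "dist (f (act g z) / autfactor g z ^ k) 0 < \<epsilon>" if z: "Im z > Y" for z
    proof -
      have z0: "Im z > 0" using z Y by simp
      have "(C + 1) / \<epsilon> = Y powr (real k / 2)" unfolding Y_def using \<epsilon> C0 k by (simp add: powr_powr)
      also have "\<dots> < Im z powr (real k / 2)" using z Y k by (intro powr_less_mono2) auto
      finally have "C + 1 < \<epsilon> * Im z powr (real k / 2)" using \<epsilon> by (simp add: field_simps)
      then have "cmod (slash k (rmat g) f z) * Im z powr (real k / 2) < \<epsilon> * Im z powr (real k / 2)" using C[OF z0] by linarith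
      then have "cmod (slash k (rmat g) f z) < \<epsilon>" using z0 by (simp add: mult_less_cancel_right)
      then show ?thesis using z0 d by (simp add: slash_def act_eq_mob autfactor_eq_den)
    qed
    then show "eventually (\<lambda>z. dist (f (act g z) / autfactor g z ^ k) 0 < \<epsilon>) (filtercomap Im at_top)"
      unfolding eventually_filtercomap_at_top_dense by blast
  qed
  show "f \<in> cusp_forms k l" unfolding cusp_forms_def using f inv lim
    by (auto simp: forms_def upper_half_plane_def)
qed

section \<open>Averaging operators\<close>

lemma formsI:
  assumes "\<And>z. \<not> Im z > 0 \<Longrightarrow> f z = 0" "f holomorphic_on upper_half_plane" "growth_bounded k f" "\<And>M. M \<in> G \<Longrightarrow> slash k M f = f"
  shows "f \<in> forms k G"
  using assms by (auto simp: forms_def)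

lemma formsD:
  assumes "f \<in> forms k G"
  shows "\<And>z. \<not> Im z > 0 \<Longrightarrow> f z = 0" "f holomorphic_on upper_half_plane" "growth_bounded k f" "\<And>M. M \<in> G \<Longrightarrow> slash k M f = f"
  using assms by (auto simp: forms_def)

lemma forms_mono: "H \<subseteq> G \<Longrightarrow> forms k G \<subseteq> forms k H"
  by (auto simp: forms_def)

lemma forms_empty: "f \<in> forms k G \<Longrightarrow> f \<in> forms k {}"
  using forms_mono[of "{}" G k] by auto

lemma growth_bounded_cmult: "growth_bounded k f \<Longrightarrow> growth_bounded k (\<lambda>z. c * f z)"
proof -
  assume "growth_bounded k f"
  then obtain C where C: "\<And>z. Im z > 0 \<Longrightarrow> cmod (f z) * Im z powr (real k / 2) \<le> C" unfolding growth_bounded_def by blast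
  have "cmod (c * f z) * Im z powr (real k / 2) \<le> cmod c * C" if "Im z > 0" for z
    using mult_left_mono[OF C[OF that] norm_ge_zero[of c]] by (simp add: norm_mult mult.assoc)
  then show ?thesis unfolding growth_bounded_def by blast
qed

lemma growth_bounded_add: "growth_bounded k f \<Longrightarrow> growth_bounded k g \<Longrightarrow> growth_bounded k (\<lambda>z. f z + g z)"
proof -
  assume "growth_bounded k f" "growth_bounded k g"
  then obtain C D where C: "\<And>z. Im z > 0 \<Longrightarrow> cmod (f z) * Im z powr (real k / 2) \<le> C"
    and D: "\<And>z. Im z > 0 \<Longrightarrow> cmod (g z) * Im z powr (real k / 2) \<le> D" unfolding growth_bounded_def by blast
  have "cmod (f z + g z) * Im z powr (real k / 2) \<le> C + D" if "Im z > 0" for z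
    using mult_right_mono[OF norm_triangle_ineq[of "f z" "g z"], of "Im z powr (real k / 2)"] C[OF that] D[OF that]
    by (simp add: distrib_right)
  then show ?thesis unfolding growth_bounded_def by blast
qed

lemma forms_cmult: "f \<in> forms k G \<Longrightarrow> (\<lambda>z. c * f z) \<in> forms k G"
  by (rule formsI) (auto dest: formsD intro!: holomorphic_intros growth_bounded_cmult simp: slash_cmult)

lemma forms_add: "f \<in> forms k G \<Longrightarrow> g \<in> forms k G \<Longrightarrow> (\<lambda>z. f z + g z) \<in> forms k G"
proof -
  assume f: "f \<in> forms k G" and g: "g \<in> forms k G"
  show ?thesis
    by (rule formsI) (auto simp: formsD(1,4)[OF f] formsD(1,4)[OF g] slash_add
        intro!: holomorphic_on_add growth_bounded_add formsD(2,3)[OF f] formsD(2,3)[OF g])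
qed

lemma forms_zero: "(\<lambda>z. 0) \<in> forms k G"
  by (rule formsI) (auto simp: growth_bounded_def slash_def)

lemma forms_sum: "(\<And>i. i \<in> I \<Longrightarrow> f i \<in> forms k G) \<Longrightarrow> (\<lambda>z. \<Sum>i\<in>I. f i z) \<in> forms k G"
  by (induction I rule: infinite_finite_induct) (auto simp: forms_zero forms_add)

lemma forms_slash: "f \<in> forms k {} \<Longrightarrow> det M > 0 \<Longrightarrow> slash k M f \<in> forms k {}"
  by (rule formsI) (auto dest: formsD intro: slash_hol growth_bounded_slash)

lemma forms_meas: assumes "f \<in> forms k G" shows "f \<in> borel_measurable borel"
proof -
  have o: "open upper_half_plane" unfolding upper_half_plane_def by (rule open_halfspace_Im_gt)
  have "(\<lambda>z. indicator upper_half_plane z *\<^sub>R f z) \<in> borel_measurable borel"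
    by (rule borel_measurable_continuous_on_indicator)
       (use o formsD(2)[OF assms] holomorphic_on_imp_continuous_on in auto)
  moreover have "(\<lambda>z. indicator upper_half_plane z *\<^sub>R f z) = f"
    using formsD(1)[OF assms] by (auto simp: fun_eq_iff indicator_def upper_half_plane_def)
  ultimately show ?thesis by simp
qed

section \<open>The integrand of the Petersson product and sesquilinearity\<close>

definition pairing_density :: "nat \<Rightarrow> (complex \<Rightarrow> complex) \<Rightarrow> (complex \<Rightarrow> complex) \<Rightarrow> complex \<Rightarrow> complex" where
  "pairing_density k f g z = f z * cnj (g z) * of_real (Im z ^ k)"

lemma powr_half_sq: "y > 0 \<Longrightarrow> y powr (real k / 2) * y powr (real k / 2) = y ^ k"
  by (simp flip: powr_add add: powr_realpow)

lemma pairing_density_bounded: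
  assumes "f \<in> forms k {}" "g \<in> forms k {}"
  obtains C where "\<And>z. cmod (pairing_density k f g z) \<le> C"
proof -
  from formsD(3)[OF assms(1)] formsD(3)[OF assms(2)] obtain C D
    where C: "\<And>z. Im z > 0 \<Longrightarrow> cmod (f z) * Im z powr (real k / 2) \<le> C"
    and D: "\<And>z. Im z > 0 \<Longrightarrow> cmod (g z) * Im z powr (real k / 2) \<le> D" unfolding growth_bounded_def by blast
  have "cmod (pairing_density k f g z) \<le> max 0 (C * D)" for z
  proof (cases "Im z > 0")
    case True
    have "cmod (pairing_density k f g z) = (cmod (f z) * Im z powr (real k / 2)) * (cmod (g z) * Im z powr (real k / 2))"
      using True powr_half_sq[OF True, of k] by (simp add: pairing_density_def norm_mult norm_power mult_ac)
    also have "\<dots> \<le> C * D"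
      using C[OF True] D[OF True] by (intro mult_mono) (auto intro: order_trans[rotated])
    finally show ?thesis by simp
  qed (simp add: pairing_density_def formsD(1)[OF assms(1)])
  then show thesis by (rule that)
qed

text \<open>\<open>Im (mob M z)^k\<close> supplies exactly the powers of \<open>det M\<close> and
  \<open>|den|\<close> that the two slashes carry. For \<open>M\<close> fixing both forms this is
  invariance of the integrand.\<close>

lemma pairing_density_mob:
  assumes "det M > 0" "Im z > 0"
  shows "pairing_density k f g (mob M z) = pairing_density k (slash k M f) (slash k M g) z"
proof -
  have n: "cmod (den M z) > 0" "den M z \<noteq> 0" using den_nonzero[OF assms] by auto
  have e: "complex_of_real (cmod (den M z)) ^ (2 * k) = den M z ^ k * cnj (den M z) ^ k"
    unfolding power_mult of_real_power[symmetric] complex_norm_square power_mult_distrib ..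
  have p: "complex_of_real (det M powr (real k / 2)) * complex_of_real (det M powr (real k / 2)) = of_real (det M) ^ k"
    using powr_half_sq[OF assms(1), of k] by (simp flip: of_real_mult of_real_power)
  have "pairing_density k (slash k M f) (slash k M g) z = (complex_of_real (det M powr (real k / 2)) * complex_of_real (det M powr (real k / 2)))
     * (f (mob M z) * cnj (g (mob M z))) * of_real (Im z) ^ k / (den M z ^ k * cnj (den M z) ^ k)"
    using assms by (simp add: pairing_density_def slash_def)
  also have "\<dots> = of_real (det M) ^ k * (f (mob M z) * cnj (g (mob M z))) * of_real (Im z) ^ k / complex_of_real (cmod (den M z)) ^ (2 * k)"
    unfolding p e ..
  also have "\<dots> = pairing_density k f g (mob M z)"
    by (simp add: pairing_density_def Im_mob power_divide power_mult_distrib power_mult)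
  finally show ?thesis by simp
qed

lemma pairing_density_meas [measurable (raw)]: "f \<in> borel_measurable borel \<Longrightarrow> g \<in> borel_measurable borel \<Longrightarrow> pairing_density k f g \<in> borel_measurable borel"
proof -
  assume [measurable]: "f \<in> borel_measurable borel" "g \<in> borel_measurable borel"
  have [measurable]: "cnj \<in> borel_measurable borel" "(\<lambda>z. complex_of_real (Im z ^ k)) \<in> borel_measurable borel"
    by (intro borel_measurable_continuous_onI continuous_intros)+
  show ?thesis unfolding pairing_density_def[abs_def] by measurable
qed

lemma integrable_gamma0_weight_bounded:
  fixes F :: "complex \<Rightarrow> complex"
  assumes l: "l > 0" and F: "F \<in> borel_measurable borel" and C: "\<And>z. cmod (F z) \<le> C"
  shows "integrable hyp_H (\<lambda>z. gamma0_weight l z *\<^sub>R F z)" "quotient_integral l F = weighted_int (gamma0_weight l) F"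
proof -
  have "integrable hyp_H (\<lambda>z. indicator fund_domain z *\<^sub>R F (mob r z))" for r
    using measurable_compose[OF mob_meas F] by (intro integrable_fund_bounded[where C=C]) (auto simp: C)
  then show "integrable hyp_H (\<lambda>z. gamma0_weight l z *\<^sub>R F z)" "quotient_integral l F = weighted_int (gamma0_weight l) F"
    using quotient_integral_weighted_int[OF F] by auto
qed

lemma petersson_weighted_int:
  assumes "l > 0" "f \<in> forms k {}" "g \<in> forms k {}"
  shows "petersson V k l f g = of_real (V / covolume l) * weighted_int (gamma0_weight l) (pairing_density k f g)"
    "integrable hyp_H (\<lambda>z. gamma0_weight l z *\<^sub>R pairing_density k f g z)"
proof -
  obtain C where C: "\<And>z. cmod (pairing_density k f g z) \<le> C" by (rule pairing_density_bounded[OF assms(2,3)]) (rule that; assumption)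
  have m: "pairing_density k f g \<in> borel_measurable borel" using assms forms_meas by (intro pairing_density_meas) auto
  show "petersson V k l f g = of_real (V / covolume l) * weighted_int (gamma0_weight l) (pairing_density k f g)"
    using integrable_gamma0_weight_bounded(2)[OF assms(1) m C] by (simp add: petersson_def pairing_density_def[abs_def])
  show "integrable hyp_H (\<lambda>z. gamma0_weight l z *\<^sub>R pairing_density k f g z)" by (rule integrable_gamma0_weight_bounded(1)[OF assms(1) m C])
qed

lemma petersson_cnj: 
  assumes "l > 0" "f \<in> forms k {}" "g \<in> forms k {}"
  shows "petersson V k l g f = cnj (petersson V k l f g)"
proof -
  have "weighted_int (gamma0_weight l) (pairing_density k g f) = (\<integral>z. cnj (gamma0_weight l z *\<^sub>R pairing_density k f g z) \<partial>hyp_H)"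
    unfolding weighted_int_def by (rule Bochner_Integration.integral_cong) (auto simp: pairing_density_def mult_ac)
  also have "\<dots> = cnj (weighted_int (gamma0_weight l) (pairing_density k f g))" unfolding weighted_int_def by (rule Bochner_Integration.integral_cnj)
  finally show ?thesis using assms by (simp add: petersson_weighted_int)
qed

lemma petersson_add_left:
  assumes "l > 0" "f \<in> forms k {}" "f' \<in> forms k {}" "g \<in> forms k {}"
  shows "petersson V k l (\<lambda>z. f z + f' z) g = petersson V k l f g + petersson V k l f' g"
proof -
  have "weighted_int (gamma0_weight l) (pairing_density k (\<lambda>z. f z + f' z) g) = (\<integral>z. gamma0_weight l z *\<^sub>R pairing_density k f g z + gamma0_weight l z *\<^sub>R pairing_density k f' g z \<partial>hyp_H)"
    unfolding weighted_int_def by (rule Bochner_Integration.integral_cong) (auto simp: pairing_density_def algebra_simps)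
  also have "\<dots> = weighted_int (gamma0_weight l) (pairing_density k f g) + weighted_int (gamma0_weight l) (pairing_density k f' g)"
    unfolding weighted_int_def by (intro Bochner_Integration.integral_add petersson_weighted_int assms)
  finally show ?thesis using assms by (simp add: petersson_weighted_int forms_add algebra_simps)
qed

lemma petersson_cmult_left:
  assumes "l > 0" "f \<in> forms k {}" "g \<in> forms k {}"
  shows "petersson V k l (\<lambda>z. c * f z) g = c * petersson V k l f g"
proof -
  have "weighted_int (gamma0_weight l) (pairing_density k (\<lambda>z. c * f z) g) = (\<integral>z. c * (gamma0_weight l z *\<^sub>R pairing_density k f g z) \<partial>hyp_H)"
    unfolding weighted_int_def by (rule Bochner_Integration.integral_cong) (auto simp: pairing_density_def algebra_simps)
  also have "\<dots> = c * weighted_int (gamma0_weight l) (pairing_density k f g)"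
    unfolding weighted_int_def by (rule integral_mult_right_zero)
  finally show ?thesis using assms by (simp add: petersson_weighted_int forms_cmult)
qed

section \<open>Averages over coset representatives as orthogonal projections\<close>

definition slash_average :: "nat \<Rightarrow> (real^2^2) set \<Rightarrow> (complex \<Rightarrow> complex) \<Rightarrow> complex \<Rightarrow> complex" where
  "slash_average k R f z = (\<Sum>r\<in>R. slash k r f z) / of_nat (card R)"

lemma slash_average_eq: "slash_average k R f = (\<lambda>z. (1 / of_nat (card R)) * (\<Sum>r\<in>R. slash k r f z))"
  by (simp add: slash_average_def fun_eq_iff)

lemma slash_slash_average: "slash k M (slash_average k R f) = (\<lambda>z. (1 / of_nat (card R)) * (\<Sum>r\<in>R. slash k M (slash k r f) z))"
  unfolding slash_average_eq slash_cmult slash_sum ..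

lemma transversal_subset:
  assumes "transversal H R G" "mat 1 \<in> H" shows "R \<subseteq> G"
proof
  fix r assume r: "r \<in> R"
  have "bij_betw (\<lambda>(r,x). x ** r) (R \<times> H) G" using assms(1) by (simp add: transversal_def)
  from bij_betwE[OF this, rule_format, of "(r, mat 1)"] r assms(2) show "r \<in> G" by simp
qed

text \<open>Right multiplication by \<open>M\<close> in \<open>G\<close> permutes the cosets:
  \<open>r ** M = x r ** \<sigma> r\<close> with \<open>x r\<close> in \<open>H\<close>. As
  \<open>f\<close> is fixed by \<open>H\<close>, slashing by \<open>M\<close> only permutes the
  summands.\<close>

lemma slash_average_forms:
  assumes t: "transversal H R G" "R \<noteq> {}" and H: "invgroup H" "mat 1 \<in> H" "\<And>x y. x \<in> H \<Longrightarrow> y \<in> H \<Longrightarrow> x ** y \<in> H"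
    and G: "invgroup G" "\<And>x y. x \<in> G \<Longrightarrow> y \<in> G \<Longrightarrow> x ** y \<in> G"
    and f: "f \<in> forms k H"
  shows "slash_average k R f \<in> forms k G"
proof (rule formsI)
  have R: "R \<subseteq> G" by (rule transversal_subset[OF t(1) H(2)])
  have fin: "finite R" and b: "bij_betw (\<lambda>(r,x). x ** r) (R \<times> H) G" and d: "\<And>r. r \<in> R \<Longrightarrow> det r = 1" using t by (auto simp: transversal_def)
  have "slash_average k R f \<in> forms k {}" unfolding slash_average_eq
    by (intro forms_cmult forms_sum forms_slash forms_empty[OF f]) (use d in auto)
  then show "\<And>z. \<not> Im z > 0 \<Longrightarrow> slash_average k R f z = 0" "slash_average k R f holomorphic_on upper_half_plane" "growth_bounded k (slash_average k R f)" by (auto dest: formsD)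
  fix M assume M: "M \<in> G"
  have dG: "det x = 1" if "x \<in> G" for x using G(1) that by (auto simp: invgroup_def)
  have dH: "det x = 1" "minv x \<in> H" if "x \<in> H" for x using H(1) that by (auto simp: invgroup_def)
  have "\<forall>r\<in>R. \<exists>s x. s \<in> R \<and> x \<in> H \<and> r ** M = x ** s"
  proof
    fix r assume "r \<in> R"
    then have "r ** M \<in> G" using R M G(2) by blast
    then show "\<exists>s x. s \<in> R \<and> x \<in> H \<and> r ** M = x ** s" using b unfolding bij_betw_def by force
  qed
  then obtain \<sigma> x where s: "\<And>r. r \<in> R \<Longrightarrow> \<sigma> r \<in> R" "\<And>r. r \<in> R \<Longrightarrow> x r \<in> H" "\<And>r. r \<in> R \<Longrightarrow> r ** M = x r ** \<sigma> r"
    by metis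
  have "inj_on \<sigma> R"
  proof (rule inj_onI)
    fix r r' assume r: "r \<in> R" "r' \<in> R" "\<sigma> r = \<sigma> r'"
    have e: "u = x u ** \<sigma> u ** minv M" if "u \<in> R" for u
      using arg_cong[OF s(3)[OF that], of "\<lambda>N. N ** minv M"] dG[OF M] by (simp add: matrix_mul_assoc[symmetric] minv_mult)
    have "(x r' ** minv (x r)) ** r = (x r' ** minv (x r)) ** (x r ** \<sigma> r ** minv M)" using e[OF r(1)] by simp
    also have "\<dots> = x r' ** ((minv (x r) ** x r) ** \<sigma> r) ** minv M" by (simp only: matrix_mul_assoc)
    also have "\<dots> = r'" using e[OF r(2)] dH[OF s(2)[OF r(1)]] r(3) by (simp add: minv_mult)
    finally have e1: "(\<lambda>(r,x). x ** r) (r, x r' ** minv (x r)) = (\<lambda>(r,x). x ** r) (r', mat 1)" by simp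
    have e2: "x r' ** minv (x r) \<in> H" by (rule H(3)[OF s(2)[OF r(2)] dH(2)[OF s(2)[OF r(1)]]])
    have "(r, x r' ** minv (x r)) = (r', mat 1)"
      by (rule inj_onD[OF bij_betw_imp_inj_on[OF b] e1]) (use r H(2) e2 in auto)
    then show "r = r'" by simp
  qed
  moreover have "\<sigma> ` R \<subseteq> R" using s(1) by blast
  ultimately have bs: "bij_betw \<sigma> R R" using fin by (simp add: bij_betw_def endo_inj_surj)
  have sl: "slash k M (slash k r f) = slash k (\<sigma> r) f" if "r \<in> R" for r
  proof -
    have "slash k M (slash k r f) = slash k (x r ** \<sigma> r) f" using d[OF that] dG[OF M] s(3)[OF that] by (simp add: slash_slash)
    also have "\<dots> = slash k (\<sigma> r) (slash k (x r) f)" using dH[OF s(2)[OF that]] d[OF s(1)[OF that]] by (simp add: slash_slash)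
    also have "slash k (x r) f = f" by (rule formsD(4)[OF f s(2)[OF that]])
    finally show ?thesis .
  qed
  have "(\<Sum>r\<in>R. slash k M (slash k r f) z) = (\<Sum>r\<in>R. slash k r f z)" for z
    using sum.reindex_bij_betw[OF bs, of "\<lambda>r. slash k r f z"] sl by simp
  then show "slash k M (slash_average k R f) = slash_average k R f" unfolding slash_slash_average by (simp add: slash_average_eq)
qed

text \<open>Since \<open>r\<close> fixes \<open>h\<close>, pairing \<open>slash k r f\<close> with
  \<open>h\<close> amounts to evaluating the invariant density of \<open>f\<close> and
  \<open>h\<close> at \<open>mob r z\<close>; summed over the representatives, its integral is
  multiplied by their number by \<open>weighted_int_average\<close>.\<close>

lemma slash_average_adjoint:
  assumes q: "q > 0" and t: "transversal (GG 1 q) R G" "R \<noteq> {}" and G: "invgroup G"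
    and f: "f \<in> forms k (GG 1 q)" and h: "h \<in> forms k G" "h \<in> forms k (GG 1 q)"
  shows "petersson V k q (slash_average k R f) h = petersson V k q f h"
proof -
  have fin: "finite R" and d: "\<And>r. r \<in> R \<Longrightarrow> det r = 1" using t by (auto simp: transversal_def)
  have RG: "R \<subseteq> G" by (rule transversal_subset[OF t(1) GG_one])
  have f0: "f \<in> forms k {}" "h \<in> forms k {}" using f h forms_empty by auto
  have m: "pairing_density k f h \<in> borel_measurable borel" using forms_meas[OF f] forms_meas[OF h(1)] by (rule pairing_density_meas)
  obtain C where C: "\<And>z. cmod (pairing_density k f h z) \<le> C" by (rule pairing_density_bounded[OF f0]) (rule that; assumption)
  have sl: "pairing_density k (slash k r f) h z = pairing_density k f h (mob r z)" if "r \<in> R" for r z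
  proof (cases "Im z > 0")
    case True
    have "slash k r h = h" using formsD(4)[OF h(1)] that RG by blast
    then show ?thesis using pairing_density_mob[of r z k f h] d[OF that] True by simp
  next
    case False
    then have "\<not> Im (mob r z) > 0" using d[OF that] by (simp add: Im_mob divide_nonpos_nonneg not_less)
    then show ?thesis using False formsD(1)[OF f] by (simp add: pairing_density_def)
  qed
  have "pairing_density k (slash_average k R f) h z = (1 / of_nat (card R)) * (\<Sum>r\<in>R. pairing_density k f h (mob r z))" for z
  proof -
    have "(\<Sum>r\<in>R. pairing_density k f h (mob r z)) = (\<Sum>r\<in>R. pairing_density k (slash k r f) h z)" by (rule sum.cong) (simp_all add: sl)
    then show ?thesis by (simp add: pairing_density_def slash_average_def sum_distrib_right sum_divide_distrib)
  qed
  then have "weighted_int (gamma0_weight q) (pairing_density k (slash_average k R f) h) = (\<integral>z. (1 / of_nat (card R)) * (gamma0_weight q z *\<^sub>R (\<Sum>r\<in>R. pairing_density k f h (mob r z))) \<partial>hyp_H)"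
    unfolding weighted_int_def by simp
  also have "\<dots> = (1 / of_nat (card R)) * weighted_int (gamma0_weight q) (\<lambda>z. \<Sum>r\<in>R. pairing_density k f h (mob r z))"
    unfolding weighted_int_def by (rule integral_mult_right_zero)
  also have "weighted_int (gamma0_weight q) (\<lambda>z. \<Sum>r\<in>R. pairing_density k f h (mob r z)) = of_nat (card R) * weighted_int (gamma0_weight q) (pairing_density k f h)"
  proof (rule weighted_int_average[OF invgroup_GG G t weight_gamma0_weight[OF q] _ m])
    show "integrable hyp_H (\<lambda>z. gamma0_weight q z *\<^sub>R pairing_density k f h (mob r z))" for r
      by (rule integrable_gamma0_weight_bounded(1)[OF q measurable_compose[OF mob_meas m]]) (rule C)
    fix M z assume M: "M \<in> GG 1 q" "Im z > 0"
    then show "pairing_density k f h (mob M z) = pairing_density k f h z"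
      using pairing_density_mob[of M z k f h] GG_det[OF M(1)] formsD(4)[OF f M(1)] formsD(4)[OF h(2) M(1)] by simp
  qed simp
  also have "1 / of_nat (card R) * (of_nat (card R) * weighted_int (gamma0_weight q) (pairing_density k f h)) = weighted_int (gamma0_weight q) (pairing_density k f h)"
    using t(2) fin by simp
  finally have e: "weighted_int (gamma0_weight q) (pairing_density k (slash_average k R f) h) = weighted_int (gamma0_weight q) (pairing_density k f h)" .
  have "slash_average k R f \<in> forms k {}" unfolding slash_average_eq
    by (intro forms_cmult forms_sum forms_slash f0) (use d in auto)
  then show ?thesis using q f0 e by (simp add: petersson_weighted_int)
qed

section \<open>Unipotent matrices with real parameter and their commutators\<close>

definition upper_shear :: "real \<Rightarrow> real^2^2" where "upper_shear x = mat22 1 x 0 1"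
definition lower_shear :: "real \<Rightarrow> real^2^2" where "lower_shear y = mat22 1 0 y 1"

lemma up_eq_upper_shear: "up d i = upper_shear (real i / real d)" and lo_eq_lower_shear: "lo y j = lower_shear (real j * real y)"
  by (simp_all add: up_def upper_shear_def lo_def lower_shear_def)

lemma det_upper_shear [simp]: "det (upper_shear x) = 1" and det_lower_shear [simp]: "det (lower_shear x) = 1"
  by (simp_all add: upper_shear_def lower_shear_def)

text \<open>The parameters of a one-parameter group that fix \<open>f\<close> form an additive
  group. With Bezout coefficients this yields invariance under \<open>1/(pd)\<close> from invariance
  under \<open>1/p\<close> and \<open>1/d\<close>.\<close>

lemma one_param_inv:
  fixes s :: "real \<Rightarrow> real^2^2"
  assumes s: "\<And>x y. s x ** s y = s (x + y)" "s 0 = mat 1" "\<And>x. det (s x) = 1" and f: "f \<in> forms k {}"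
    and x: "slash k (s x) f = f" and y: "slash k (s y) f = f"
  shows "slash k (s (of_int m * x + of_int n * y)) f = f"
proof -
  have add: "slash k (s (a + b)) f = f" if "slash k (s a) f = f" "slash k (s b) f = f" for a b
    using that slash_slash[of "s a" "s b" k f] by (simp add: s)
  have neg: "slash k (s (- a)) f = f" if "slash k (s a) f = f" for a
  proof -
    have "slash k (s (- a)) (slash k (s a) f) = slash k (mat 1) f" by (simp add: slash_slash s)
    then show ?thesis using that formsD(1)[OF f] by simp
  qed
  have zero: "slash k (s 0) f = f" using formsD(1)[OF f] by (simp add: s)
  have nat: "slash k (s (real n * a)) f = f" if "slash k (s a) f = f" for a and n :: nat
    by (induction n) (use zero add that in \<open>simp_all add: distrib_right add.commute\<close>)
  have int: "slash k (s (of_int n * a)) f = f" if "slash k (s a) f = f" for a n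
  proof (cases "n \<ge> 0")
    case True then show ?thesis using nat[OF that, of "nat n"] by simp
  next
    case False then show ?thesis using nat[OF neg[OF that], of "nat (- n)"] by simp
  qed
  show ?thesis by (intro add int x y)
qed

lemma upper_shear_inv: "f \<in> forms k {} \<Longrightarrow> slash k (upper_shear x) f = f \<Longrightarrow> slash k (upper_shear y) f = f \<Longrightarrow> slash k (upper_shear (of_int m * x + of_int n * y)) f = f"
  by (rule one_param_inv) (auto simp: upper_shear_def mat_1_eq_mat22)

lemma lower_shear_inv: "f \<in> forms k {} \<Longrightarrow> slash k (lower_shear x) f = f \<Longrightarrow> slash k (lower_shear y) f = f \<Longrightarrow> slash k (lower_shear (of_int m * x + of_int n * y)) f = f"
  by (rule one_param_inv) (auto simp: lower_shear_def mat_1_eq_mat22)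

lemma upper_shear_inv_nat: "f \<in> forms k {} \<Longrightarrow> slash k (upper_shear x) f = f \<Longrightarrow> slash k (upper_shear (real m * x)) f = f"
  using upper_shear_inv[of f k x x "int m" 0] by simp

lemma lower_shear_inv_nat: "f \<in> forms k {} \<Longrightarrow> slash k (lower_shear x) f = f \<Longrightarrow> slash k (lower_shear (real m * x)) f = f"
  using lower_shear_inv[of f k x x "int m" 0] by simp

text \<open>The commutator of the two unipotent matrices lies in \<open>\<Gamma>\<^sub>0(q)\<close>; this is where \<open>p\<^sup>3 | q\<close> enters.\<close>
lemma upper_shear_lower_shear_commute:
  assumes f: "f \<in> forms k (GG 1 q)" and q: "q > 0" and x: "x * y \<in> \<int>" "x * x * y \<in> \<int>" "x * y * y / real q \<in> \<int>"
  shows "slash k (lower_shear y) (slash k (upper_shear x) f) = slash k (upper_shear x) (slash k (lower_shear y) f)"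
proof -
  \<comment> \<open>The commutator \<open>u l u^(-1) l^(-1)\<close> of
    \<open>u = upper_shear x\<close> and \<open>l = lower_shear y\<close>, multiplied out; the three
    integrality assumptions are read off its entries.\<close>
  define C where "C = mat22 (1 + x * y + x * y * (x * y)) (- (x * x * y)) (x * y * y) (1 - x * y)"
  have "C \<in> GG 1 q"
  proof (rule GG_memI)
    show "det C = 1" by (simp add: C_def algebra_simps)
    show "C $ 1 $ 1 \<in> \<int>" unfolding C_def mat22_nth by (intro Ints_add Ints_mult[OF x(1) x(1)] x Ints_1)
    show "C $ 1 $ 2 * of_nat 1 \<in> \<int>" using x(2) by (simp add: C_def)
    show "C $ 2 $ 1 / of_nat q \<in> \<int>" using x(3) by (simp add: C_def)
    show "C $ 2 $ 2 \<in> \<int>" unfolding C_def mat22_nth by (intro Ints_diff x Ints_1)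
  qed (use q in auto)
  then have Cf: "slash k C f = f" "det C = 1" using formsD(4)[OF f] GG_det by auto
  have e: "upper_shear x ** lower_shear y = C ** (lower_shear y ** upper_shear x)"
    by (simp add: C_def upper_shear_def lower_shear_def algebra_simps)
  have "slash k (lower_shear y) (slash k (upper_shear x) f) = slash k (C ** (lower_shear y ** upper_shear x)) f" by (simp add: slash_slash e)
  also have "\<dots> = slash k (lower_shear y ** upper_shear x) (slash k C f)" by (subst slash_slash) (simp_all add: Cf det_mul)
  also have "\<dots> = slash k (upper_shear x) (slash k (lower_shear y) f)" by (simp add: Cf slash_slash)
  finally show ?thesis .
qed

lemma upper_shear_upper_shear_commute: "slash k (upper_shear x) (slash k (upper_shear y) f) = slash k (upper_shear y) (slash k (upper_shear x) f)"
  by (simp add: slash_slash, simp add: upper_shear_def add.commute)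

lemma lower_shear_lower_shear_commute: "slash k (lower_shear x) (slash k (lower_shear y) f) = slash k (lower_shear y) (slash k (lower_shear x) f)"
  by (simp add: slash_slash, simp add: lower_shear_def add.commute)

section \<open>Projections onto spaces of old forms\<close>

text \<open>For \<open>x = i/d\<close> and \<open>y = jq/e\<close> the two divisibilities make the
  commutator entries \<open>x^2 y\<close> and \<open>x y^2 / q\<close> integral. They also provide
  the divisibilities needed for the two transversals.\<close>

definition cube_adm :: "nat \<Rightarrow> nat \<Rightarrow> nat \<Rightarrow> bool" where
  "cube_adm q d e \<longleftrightarrow> q > 0 \<and> d > 0 \<and> e > 0 \<and> d * d * e dvd q \<and> d * e * e dvd q"

lemma cube_admE:
  assumes "cube_adm q d e"
  obtains y where "q > 0" "d > 0" "e > 0" "y > 0" "q = e * y" "q div e = y" "d * d dvd y" "d * e dvd y" "e dvd y" "d dvd y" "d * d dvd q"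
proof -
  have pos: "q > 0" "d > 0" "e > 0" and dv: "d * d * e dvd q" "d * e * e dvd q" using assms by (auto simp: cube_adm_def)
  have "e dvd q" by (rule dvd_mult_right[OF dv(2)])
  then obtain y where y: "q = e * y" by blast
  have "e * (d * d) dvd e * y" "e * (d * e) dvd e * y" using dv y by (simp_all only: mult_ac)
  then have dd: "d * d dvd y" "d * e dvd y" using pos by (simp_all only: nat_mult_dvd_cancel1)
  show thesis
  proof (rule that[OF pos _ y _ dd])
    show "y > 0" using pos(1) y by (cases y) auto
    show "q div e = y" using y pos by simp
    show "e dvd y" by (rule dvd_mult_right[OF dd(2)])
    show "d dvd y" by (rule dvd_mult_right[OF dd(1)])
    show "d * d dvd q" unfolding y by (rule dvd_mult[OF dd(1)])
  qed
qed

lemma slash_slash_average_commute: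
  "(\<And>r. r \<in> R \<Longrightarrow> slash k M (slash k r f) = slash k r (slash k M f)) \<Longrightarrow> slash k M (slash_average k R f) = slash_average k R (slash k M f)"
  unfolding slash_slash_average unfolding slash_average_eq by simp

lemma slash_average_commute:
  assumes "\<And>r s. r \<in> R \<Longrightarrow> s \<in> S \<Longrightarrow> slash k r (slash k s f) = slash k s (slash k r f)"
  shows "slash_average k R (slash_average k S f) = slash_average k S (slash_average k R f)"
proof
  fix z
  have "slash_average k R (slash_average k S f) z = (1 / of_nat (card R)) * ((1 / of_nat (card S)) * (\<Sum>r\<in>R. \<Sum>s\<in>S. slash k r (slash k s f) z))"
    unfolding slash_average_eq[of k R] slash_slash_average by (simp add: sum_distrib_left sum_divide_distrib)
  also have "(\<Sum>r\<in>R. \<Sum>s\<in>S. slash k r (slash k s f) z) = (\<Sum>s\<in>S. \<Sum>r\<in>R. slash k s (slash k r f) z)"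
    using assms by (subst sum.swap) simp
  also have "(1 / of_nat (card R)) * ((1 / of_nat (card S)) * \<dots>) = slash_average k S (slash_average k R f) z"
    unfolding slash_average_eq[of k S] slash_slash_average by (simp add: sum_distrib_left sum_divide_distrib mult.commute)
  finally show "slash_average k R (slash_average k S f) z = slash_average k S (slash_average k R f) z" .
qed

lemma up_lo_commute:
  assumes f: "f \<in> forms k (GG 1 q)" and q: "q = e * y" and pos: "d > 0" "e > 0" "y > 0" and dv: "d * d dvd y" "d * e dvd y"
  shows "slash k (lo y j) (slash k (up d i) f) = slash k (up d i) (slash k (lo y j) f)"
proof -
  obtain m1 where m1: "y = d * d * m1" using dv(1) by blast
  obtain m2 where m2: "y = d * e * m2" using dv(2) by blast
  let ?x = "real i / real d" and ?y = "real j * real y"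
  have "?x * ?y = of_nat (i * j * (d * m1))" using pos by (simp add: m1 field_simps)
  then have 1: "?x * ?y \<in> \<int>" by (metis Ints_of_nat)
  have "?x * ?x * ?y = of_nat (i * i * j * m1)" using pos by (simp add: m1 field_simps)
  then have 2: "?x * ?x * ?y \<in> \<int>" by (metis Ints_of_nat)
  have "?x * ?y * ?y / real q = real i * real j * real j * (real y / (real d * real e))" using pos by (simp add: q field_simps)
  also have "real y / (real d * real e) = real m2" using pos by (simp add: m2)
  finally have "?x * ?y * ?y / real q = of_nat (i * j * j * m2)" by simp
  then have 3: "?x * ?y * ?y / real q \<in> \<int>" by (metis Ints_of_nat)
  show ?thesis unfolding up_eq_upper_shear lo_eq_lower_shear
    by (rule upper_shear_lower_shear_commute[OF f _ 1 2 3]) (use q pos in simp)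
qed

text \<open>\<open>GG d (q div e)\<close> is generated by \<open>\<Gamma>\<^sub>0(q)\<close> and the
  two unipotents: the transversals write each of its elements as an element of
  \<open>\<Gamma>\<^sub>0(q)\<close> times a power of each. Membership thus reduces to two extra
  invariances.\<close>

lemma forms_GG_iff:
  assumes a: "cube_adm q d e"
  shows "f \<in> forms k (GG d (q div e)) \<longleftrightarrow>
    f \<in> forms k (GG 1 q) \<and> slash k (upper_shear (1 / real d)) f = f \<and> slash k (lower_shear (real q / real e)) f = f"
proof -
  obtain y where y: "q > 0" "d > 0" "e > 0" "y > 0" "q = e * y" "q div e = y" "d * d dvd y" "d * e dvd y" "e dvd y" "d dvd y" "d * d dvd q"
    by (rule cube_admE[OF a])
  have qe: "real q / real e = real y" using y(3,5) by simp
  show ?thesis unfolding y(6) qe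
  proof (intro iffI conjI)
    assume f: "f \<in> forms k (GG d y)"
    have "GG 1 q \<subseteq> GG d y" using y by (intro GG_mono) auto
    then show "f \<in> forms k (GG 1 q)" using forms_mono f by blast
    have "upper_shear (1 / real d) \<in> GG d y" by (rule GG_memI) (use y in \<open>auto simp: upper_shear_def\<close>)
    then show "slash k (upper_shear (1 / real d)) f = f" by (rule formsD(4)[OF f])
    have "lower_shear (real y) \<in> GG d y" by (rule GG_memI) (use y in \<open>auto simp: lower_shear_def\<close>)
    then show "slash k (lower_shear (real y)) f = f" by (rule formsD(4)[OF f])
  next
    assume f: "f \<in> forms k (GG 1 q) \<and> slash k (upper_shear (1 / real d)) f = f \<and> slash k (lower_shear (real y)) f = f"
    then have f1: "f \<in> forms k (GG 1 q)" and u: "slash k (upper_shear (1 / real d)) f = f" and l: "slash k (lower_shear (real y)) f = f" by auto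
    have f0: "f \<in> forms k {}" by (rule forms_empty[OF f1])
    show "f \<in> forms k (GG d y)"
    proof (rule formsI)
      show "\<And>z. \<not> Im z > 0 \<Longrightarrow> f z = 0" "f holomorphic_on upper_half_plane" "growth_bounded k f" using formsD[OF f1] by auto
      fix M assume M: "M \<in> GG d y"
      have "bij_betw (\<lambda>(r, x). x ** r) (up d ` {..<d} \<times> GG 1 y) (GG d y)"
        using transversal_up[OF y(2,4,7)] by (simp add: transversal_def)
      then obtain i x where x: "x \<in> GG 1 y" "M = x ** up d i" using M unfolding bij_betw_def by force
      have "bij_betw (\<lambda>(r, x). x ** r) (lo y ` {..<e} \<times> GG 1 q) (GG 1 y)"
        using transversal_lo[OF y(3,4,9)] by (simp add: transversal_def y(5))
      then obtain j x' where x': "x' \<in> GG 1 q" "x = x' ** lo y j" using x(1) unfolding bij_betw_def by force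
      have "slash k M f = slash k (up d i) (slash k (lo y j) (slash k x' f))"
        using GG_det[OF x'(1)] by (simp add: x x' slash_slash det_mul)
      also have "slash k x' f = f" by (rule formsD(4)[OF f1 x'(1)])
      also have "slash k (lo y j) f = f" unfolding lo_eq_lower_shear by (rule lower_shear_inv_nat[OF f0 l])
      also have "slash k (up d i) f = f" unfolding up_eq_upper_shear using upper_shear_inv_nat[OF f0 u, of i] by simp
      finally show "slash k M f = f" .
    qed
  qed
qed

text \<open>Under \<open>cube_adm\<close> this is the orthogonal projection of the forms of level
  \<open>q\<close> onto \<open>forms k (GG d (q div e))\<close>, the span of the old forms attached
  to \<open>(d, e)\<close>.\<close>

definition old_proj :: "nat \<Rightarrow> nat \<Rightarrow> nat \<Rightarrow> nat \<Rightarrow> (complex \<Rightarrow> complex) \<Rightarrow> complex \<Rightarrow> complex" where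
  "old_proj k q d e f = slash_average k (up d ` {..<d}) (slash_average k (lo (q div e) ` {..<e}) f)"

lemma slash_average_up_forms:
  assumes "d > 0" "q > 0" "d * d dvd q" "f \<in> forms k (GG 1 q)"
  shows "slash_average k (up d ` {..<d}) f \<in> forms k (GG d q)" "slash_average k (up d ` {..<d}) f \<in> forms k (GG 1 q)"
proof -
  have "d dvd q" using assms(3) dvd_mult_left by blast
  then show "slash_average k (up d ` {..<d}) f \<in> forms k (GG d q)"
    using assms by (intro slash_average_forms[OF transversal_up _ invgroup_GG GG_one GG_mult invgroup_GG GG_mult]) auto
  moreover have "GG 1 q \<subseteq> GG d q" using assms by (intro GG_mono) auto
  ultimately show "slash_average k (up d ` {..<d}) f \<in> forms k (GG 1 q)" using forms_mono by blast
qed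

lemma slash_average_lo_forms:
  assumes "e > 0" "y > 0" "e dvd y" "f \<in> forms k (GG 1 (e * y))"
  shows "slash_average k (lo y ` {..<e}) f \<in> forms k (GG 1 y)" "slash_average k (lo y ` {..<e}) f \<in> forms k (GG 1 (e * y))"
proof -
  show "slash_average k (lo y ` {..<e}) f \<in> forms k (GG 1 y)"
    using assms by (intro slash_average_forms[OF transversal_lo _ invgroup_GG GG_one GG_mult invgroup_GG GG_mult]) auto
  moreover have "GG 1 (e * y) \<subseteq> GG 1 y" using assms by (intro GG_mono) auto
  ultimately show "slash_average k (lo y ` {..<e}) f \<in> forms k (GG 1 (e * y))" using forms_mono by blast
qed

lemma old_proj_commute:
  assumes a: "cube_adm q d e" and f: "f \<in> forms k (GG 1 q)"
  shows "old_proj k q d e f = slash_average k (lo (q div e) ` {..<e}) (slash_average k (up d ` {..<d}) f)"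
proof -
  obtain y where y: "q > 0" "d > 0" "e > 0" "y > 0" "q = e * y" "q div e = y" "d * d dvd y" "d * e dvd y" "e dvd y" "d dvd y" "d * d dvd q"
    by (rule cube_admE[OF a])
  show ?thesis unfolding old_proj_def y(6)
    by (rule slash_average_commute) (auto intro!: up_lo_commute[OF f y(5,2,3,4,7,8), symmetric])
qed

text \<open>The outer average makes its own invariance visible. Performed in one order this is the
  upper unipotent, in the other order the lower one, and the two averages commute.\<close>

lemma old_proj_forms:
  assumes a: "cube_adm q d e" and f: "f \<in> forms k (GG 1 q)"
  shows "old_proj k q d e f \<in> forms k (GG d (q div e))"
proof -
  obtain y where y: "q > 0" "d > 0" "e > 0" "y > 0" "q = e * y" "q div e = y" "d * d dvd y" "d * e dvd y" "e dvd y" "d dvd y" "d * d dvd q"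
    by (rule cube_admE[OF a])
  have lo: "slash_average k (lo y ` {..<e}) f \<in> forms k (GG 1 q)" using slash_average_lo_forms(2)[OF y(3,4,9)] f y(5) by simp
  have 1: "old_proj k q d e f \<in> forms k (GG d q)" unfolding old_proj_def y(6) by (rule slash_average_up_forms(1)[OF y(2,1,11) lo])
  have up: "slash_average k (up d ` {..<d}) f \<in> forms k (GG 1 q)" by (rule slash_average_up_forms(2)[OF y(2,1,11) f])
  have 2: "old_proj k q d e f \<in> forms k (GG 1 y)" unfolding old_proj_commute[OF a f] y(6)
    using slash_average_lo_forms(1)[OF y(3,4,9)] up y(5) by simp
  have "GG 1 q \<subseteq> GG d q" using y by (intro GG_mono) auto
  then have f1: "old_proj k q d e f \<in> forms k (GG 1 q)" using 1 forms_mono by blast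
  have "upper_shear (1 / real d) \<in> GG d q" by (rule GG_memI) (use y in \<open>auto simp: upper_shear_def\<close>)
  then have u: "slash k (upper_shear (1 / real d)) (old_proj k q d e f) = old_proj k q d e f" by (rule formsD(4)[OF 1])
  have "lower_shear (real y) \<in> GG 1 y" by (rule GG_memI) (use y in \<open>auto simp: lower_shear_def\<close>)
  then have l: "slash k (lower_shear (real y)) (old_proj k q d e f) = old_proj k q d e f" by (rule formsD(4)[OF 2])
  show ?thesis unfolding forms_GG_iff[OF a] using f1 u l y by simp
qed

lemma old_proj_adjoint:
  assumes a: "cube_adm q d e" and f: "f \<in> forms k (GG 1 q)" and h: "h \<in> forms k (GG d (q div e))"
  shows "petersson V k q (old_proj k q d e f) h = petersson V k q f h"
proof -
  obtain y where y: "q > 0" "d > 0" "e > 0" "y > 0" "q = e * y" "q div e = y" "d * d dvd y" "d * e dvd y" "e dvd y" "d dvd y" "d * d dvd q"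
    by (rule cube_admE[OF a])
  have sub: "GG 1 q \<subseteq> GG d y" "GG d q \<subseteq> GG d y" "GG 1 y \<subseteq> GG d y" using y by (intro GG_mono; auto)+
  have h1: "h \<in> forms k (GG 1 q)" and h2: "h \<in> forms k (GG d q)" and h3: "h \<in> forms k (GG 1 y)"
    using h sub forms_mono unfolding y(6) by blast+
  have lo: "slash_average k (lo y ` {..<e}) f \<in> forms k (GG 1 q)" using slash_average_lo_forms(2)[OF y(3,4,9)] f y(5) by simp
  have tl: "transversal (GG 1 q) (lo y ` {..<e}) (GG 1 y)" using transversal_lo[OF y(3,4,9)] y(5) by simp
  have "petersson V k q (old_proj k q d e f) h = petersson V k q (slash_average k (lo y ` {..<e}) f) h"
    unfolding old_proj_def y(6)
    by (rule slash_average_adjoint[OF y(1) transversal_up[OF y(2,1,11)] _ invgroup_GG lo h2 h1]) (use y in auto)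
  also have "\<dots> = petersson V k q f h"
    by (rule slash_average_adjoint[OF y(1) tl _ invgroup_GG f h3 h1]) (use y in auto)
  finally show ?thesis .
qed

lemma old_proj_selfadjoint:
  assumes a: "cube_adm q d e" and f: "f \<in> forms k (GG 1 q)" and g: "g \<in> forms k (GG 1 q)"
  shows "petersson V k q (old_proj k q d e f) g = petersson V k q f (old_proj k q d e g)"
proof -
  have q: "q > 0" using a by (simp add: cube_adm_def)
  note Pf = old_proj_forms[OF a f] and Pg = old_proj_forms[OF a g]
  note e = forms_empty[OF f] forms_empty[OF g] forms_empty[OF Pf] forms_empty[OF Pg]
  have "petersson V k q (old_proj k q d e f) g = cnj (petersson V k q g (old_proj k q d e f))" by (rule petersson_cnj[OF q e(2,3)])
  also have "\<dots> = cnj (petersson V k q (old_proj k q d e g) (old_proj k q d e f))" by (simp add: old_proj_adjoint[OF a g Pf])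
  also have "\<dots> = petersson V k q (old_proj k q d e f) (old_proj k q d e g)" by (rule petersson_cnj[OF q e(4,3), symmetric])
  also have "\<dots> = petersson V k q f (old_proj k q d e g)" by (rule old_proj_adjoint[OF a f Pg])
  finally show ?thesis .
qed

text \<open>Translation by \<open>1/p\<close> commutes with both averages, so the projection of
  \<open>g\<close> inherits this invariance. It is also fixed by \<open>1/d\<close>, and Bezout for
  the coprime pair gives \<open>1/(pd)\<close>.\<close>

lemma old_proj_up_step:
  assumes a: "cube_adm q d e" "cube_adm q (p * d) e" and p: "coprime p d" and g: "g \<in> forms k (GG p q)"
  shows "old_proj k q d e g \<in> forms k (GG (p * d) (q div e))"
proof -
  obtain y where y: "q > 0" "d > 0" "e > 0" "y > 0" "q = e * y" "q div e = y" "d * d dvd y" "d * e dvd y" "e dvd y" "d dvd y" "d * d dvd q"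
    by (rule cube_admE[OF a(1)])
  obtain y' where y': "q > 0" "p * d > 0" "e > 0" "y' > 0" "q = e * y'" "q div e = y'" "(p*d) * (p*d) dvd y'" "(p*d) * e dvd y'" "e dvd y'" "p*d dvd y'" "(p*d) * (p*d) dvd q"
    by (rule cube_admE[OF a(2)])
  have yy: "y' = y" using y y' by simp
  have p0: "p > 0" using y'(2) by auto
  have "p * p dvd (p*d) * (p*d)" "p * e dvd (p*d) * e" by (simp_all add: mult_dvd_mono)
  then have pp: "p * p dvd y" "p * e dvd y" using y'(7,8) yy dvd_trans by blast+
  have "GG 1 q \<subseteq> GG p q" using p0 y by (intro GG_mono) auto
  then have g1: "g \<in> forms k (GG 1 q)" using g forms_mono by blast
  have "up p 1 \<in> GG p q" by (rule GG_memI) (use y p0 in \<open>auto simp: up_def\<close>)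
  then have gu: "slash k (up p 1) g = g" by (rule formsD(4)[OF g])
  have P1: "old_proj k q d e g \<in> forms k (GG 1 q)" "slash k (upper_shear (1 / real d)) (old_proj k q d e g) = old_proj k q d e g"
     "slash k (lower_shear (real q / real e)) (old_proj k q d e g) = old_proj k q d e g"
    using old_proj_forms[OF a(1) g1] unfolding forms_GG_iff[OF a(1)] by auto
  have lo: "slash k (up p 1) (slash_average k (lo y ` {..<e}) g) = slash_average k (lo y ` {..<e}) g"
    using up_lo_commute[OF g1 y(5) p0 y(3,4) pp, symmetric] by (subst slash_slash_average_commute) (auto simp: gu simp del: One_nat_def)
  have Pp: "slash k (up p 1) (old_proj k q d e g) = old_proj k q d e g"
  proof -
    have "slash k (up p 1) (old_proj k q d e g) = slash_average k (up d ` {..<d}) (slash k (up p 1) (slash_average k (lo y ` {..<e}) g))"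
      unfolding old_proj_def y(6) by (rule slash_slash_average_commute) (auto simp: up_eq_upper_shear upper_shear_upper_shear_commute)
    then show ?thesis unfolding lo by (simp add: old_proj_def y(6))
  qed
  then have Pp': "slash k (upper_shear (1 / real p)) (old_proj k q d e g) = old_proj k q d e g" by (simp add: up_eq_upper_shear)
  obtain u v where uv: "u * int p + v * int d = 1" using bezout_int[of "int p" "int d"] p by (auto simp: coprime_iff_gcd_eq_1 gcd_int_int_eq)
  then have "real_of_int (u * int p + v * int d) = 1" by simp
  then have e: "1 / real (p * d) = of_int u * (1 / real d) + of_int v * (1 / real p)"
    using p0 y(2) by (simp add: field_simps)
  have "slash k (upper_shear (1 / real (p * d))) (old_proj k q d e g) = old_proj k q d e g"
    unfolding e by (rule upper_shear_inv[OF forms_empty[OF P1(1)] P1(2) Pp'])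
  then show ?thesis unfolding forms_GG_iff[OF a(2)] using P1 by simp
qed

text \<open>The mirror image for lower unipotents. The averages are taken in the opposite order, so
  that the outer one is over lower unipotents, which commute with each other.\<close>

lemma old_proj_lo_step:
  assumes a: "cube_adm q d e" "cube_adm q d (p * e)" and p: "coprime p e" and g: "g \<in> forms k (GG 1 (q div p))"
  shows "old_proj k q d e g \<in> forms k (GG d (q div (p * e)))"
proof -
  obtain y where y: "q > 0" "d > 0" "e > 0" "y > 0" "q = e * y" "q div e = y" "d * d dvd y" "d * e dvd y" "e dvd y" "d dvd y" "d * d dvd q"
    by (rule cube_admE[OF a(1)])
  have dv: "d * d * (p * e) dvd q" "d * (p * e) * (p * e) dvd q" "p > 0" using a(2) by (auto simp: cube_adm_def)
  have "d * d * p dvd d * d * (p * e)" "d * p * p dvd d * (p * e) * (p * e)" by (simp_all add: mult_dvd_mono)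
  then have "d * d * p dvd q" "d * p * p dvd q" using dv dvd_trans by blast+
  then have ap: "cube_adm q d p" using y dv by (simp add: cube_adm_def)
  obtain w where w: "q > 0" "d > 0" "p > 0" "w > 0" "q = p * w" "q div p = w" "d * d dvd w" "d * p dvd w" "p dvd w" "d dvd w" "d * d dvd q"
    by (rule cube_admE[OF ap])
  have "GG 1 q \<subseteq> GG 1 w" using w by (intro GG_mono) auto
  then have g1: "g \<in> forms k (GG 1 q)" using g forms_mono w(6) by blast
  have "lo w 1 \<in> GG 1 w" by (rule GG_memI) (use w in \<open>auto simp: lo_def\<close>)
  then have gl: "slash k (lo w 1) g = g" using formsD(4)[OF g] w(6) by simp
  have P1: "old_proj k q d e g \<in> forms k (GG 1 q)" "slash k (upper_shear (1 / real d)) (old_proj k q d e g) = old_proj k q d e g"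
     "slash k (lower_shear (real q / real e)) (old_proj k q d e g) = old_proj k q d e g"
    using old_proj_forms[OF a(1) g1] unfolding forms_GG_iff[OF a(1)] by auto
  have up: "slash k (lo w 1) (slash_average k (up d ` {..<d}) g) = slash_average k (up d ` {..<d}) g"
    using up_lo_commute[OF g1 w(5,2,3,4,7,8)] by (subst slash_slash_average_commute) (auto simp: gl simp del: One_nat_def)
  have "slash k (lo w 1) (old_proj k q d e g) = old_proj k q d e g"
  proof -
    have "slash k (lo w 1) (old_proj k q d e g) = slash_average k (lo (q div e) ` {..<e}) (slash k (lo w 1) (slash_average k (up d ` {..<d}) g))"
      unfolding old_proj_commute[OF a(1) g1] by (rule slash_slash_average_commute) (auto simp: lo_eq_lower_shear lower_shear_lower_shear_commute)
    then show ?thesis unfolding up by (simp add: old_proj_commute[OF a(1) g1])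
  qed
  moreover have "real q / real p = real w" using w by simp
  ultimately have Pp: "slash k (lower_shear (real q / real p)) (old_proj k q d e g) = old_proj k q d e g" by (simp add: lo_eq_lower_shear)
  obtain u v where uv: "u * int p + v * int e = 1" using bezout_int[of "int p" "int e"] p by (auto simp: coprime_iff_gcd_eq_1 gcd_int_int_eq)
  then have "real_of_int (u * int p + v * int e) = 1" by simp
  then have uv': "real_of_int u * real p + of_int v * real e = 1" by simp
  \<comment> \<open>Bezout for \<open>p\<close> and \<open>e\<close>, scaled by
    \<open>q / (p * e)\<close>.\<close>
  have "of_int u * (real q / real e) + of_int v * (real q / real p) = (real_of_int u * real p + of_int v * real e) * real q / real (p * e)"
    using w(3) y(3) by (simp add: field_simps)
  then have e: "real q / real (p * e) = of_int u * (real q / real e) + of_int v * (real q / real p)"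
    unfolding uv' by simp
  have "slash k (lower_shear (real q / real (p * e))) (old_proj k q d e g) = old_proj k q d e g"
    unfolding e by (rule lower_shear_inv[OF forms_empty[OF P1(1)] P1(3) Pp])
  then show ?thesis unfolding forms_GG_iff[OF a(2)] using P1 by simp
qed

section \<open>Dilated forms\<close>

lemma dilate_slash:
  assumes "d > 0" "\<And>z. \<not> Im z > 0 \<Longrightarrow> f z = 0"
  shows "dilate k d f = slash k (dilation d) f"
proof
  fix z
  show "dilate k d f z = slash k (dilation d) f z"
  proof (cases "Im z > 0")
    case True then show ?thesis by (simp add: dilate_def slash_def mob_dilation) (simp add: dilation_def den_def)
  next
    case False
    then have "\<not> Im (of_nat d * z) > 0" using assms(1) by (simp add: zero_less_mult_iff)
    then show ?thesis using False assms(2) by (simp add: dilate_def)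
  qed
qed

text \<open>Conjugation by the dilation carries one invariance group to the other; the slash by
  \<open>diag(1/d, 1)\<close> inverts the map, and boundedness survives both directions.\<close>

lemma dilate_forms:
  assumes d: "d > 0" "L > 0"
  shows "dilate k d ` forms k (GG 1 L) = forms k (GG d (d * L))"
proof (intro equalityI subsetI)
  fix f assume "f \<in> dilate k d ` forms k (GG 1 L)"
  then obtain \<phi> where \<phi>: "\<phi> \<in> forms k (GG 1 L)" "f = dilate k d \<phi>" by auto
  then have f: "f = slash k (dilation d) \<phi>" using dilate_slash[OF d(1)] formsD(1) by blast
  have f0: "f \<in> forms k {}" unfolding f using forms_empty[OF \<phi>(1)] d by (intro forms_slash) auto
  show "f \<in> forms k (GG d (d * L))"
  proof (rule formsI)
    fix M assume M: "M \<in> GG d (d * L)"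
    have c: "conj_dilation d M \<in> GG 1 L" using bij_conj_dilation[OF d] M by (auto simp: bij_betw_def)
    have "slash k M f = slash k (conj_dilation d M ** dilation d) \<phi>" unfolding f using d GG_det[OF M] by (simp add: slash_slash dilation_conj_dilation)
    also have "\<dots> = slash k (dilation d) (slash k (conj_dilation d M) \<phi>)" using d GG_det[OF c] by (simp add: slash_slash)
    also have "\<dots> = f" using formsD(4)[OF \<phi>(1) c] f by simp
    finally show "slash k M f = f" .
  qed (use formsD[OF f0] in auto)
next
  fix f assume f: "f \<in> forms k (GG d (d * L))"
  define dgi where "dgi = mat22 (1 / real d) 0 0 1"
  have di: "det dgi > 0" "dgi ** dilation d = mat 1" using d by (auto simp: dgi_def dilation_def mat_1_eq_mat22)
  define \<phi> where "\<phi> = slash k dgi f"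
  have \<phi>0: "\<phi> \<in> forms k {}" unfolding \<phi>_def by (rule forms_slash[OF forms_empty[OF f] di(1)])
  have "\<phi> \<in> forms k (GG 1 L)"
  proof (rule formsI)
    fix N assume N: "N \<in> GG 1 L"
    then obtain M where M: "M \<in> GG d (d * L)" "N = conj_dilation d M" using bij_conj_dilation[OF d] by (auto simp: bij_betw_def)
    have e: "dgi ** N = M ** dgi" unfolding M(2) using d
      by (simp add: vec_eq_iff forall_2 matrix_mul_nth dgi_def conj_dilation_def)
    have "slash k N \<phi> = slash k (M ** dgi) f" unfolding \<phi>_def using di GG_det[OF N] by (simp add: slash_slash e)
    also have "\<dots> = slash k dgi (slash k M f)" using di GG_det[OF M(1)] by (simp add: slash_slash)
    also have "slash k M f = f" by (rule formsD(4)[OF f M(1)])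
    finally show "slash k N \<phi> = \<phi>" by (simp add: \<phi>_def)
  qed (use formsD[OF \<phi>0] in auto)
  moreover have "dilate k d \<phi> = f"
    using d di formsD(1)[OF \<phi>0] formsD(1)[OF f] by (subst dilate_slash) (auto simp: \<phi>_def slash_slash)
  ultimately show "f \<in> dilate k d ` forms k (GG 1 L)" by blast
qed

lemma dilate_inj: "d > 0 \<Longrightarrow> inj_on (dilate k d) (forms k G)"
proof (rule inj_onI)
  fix f g assume d: "d > 0" and e: "dilate k d f = dilate k d g"
  show "f = g"
  proof
    fix z
    have "dilate k d f (z / of_nat d) = dilate k d g (z / of_nat d)" using e by simp
    then show "f z = g z" using d by (simp add: dilate_def)
  qed
qed

text \<open>The factor \<open>de\<close> gained by the integral cancels against the same growth of
  the covolume. The normalisation of the total volume independently of the level is used exactly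
  here.\<close>

lemma dilate_isometry:
  assumes pos: "d > 0" "e > 0" "L > 0" and dv: "d dvd L" "e dvd d * L"
    and f: "f \<in> forms k (GG 1 L)" and g: "g \<in> forms k (GG 1 L)"
  shows "petersson V k (e * (d * L)) (dilate k d f) (dilate k d g) = petersson V k L f g"
proof -
  note e = forms_empty[OF f] forms_empty[OF g]
  have s: "dilate k d f = slash k (dilation d) f" "dilate k d g = slash k (dilation d) g"
    using dilate_slash[OF pos(1)] formsD(1)[OF f] formsD(1)[OF g] by blast+
  have fs: "slash k (dilation d) f \<in> forms k {}" "slash k (dilation d) g \<in> forms k {}"
    using e pos by (auto intro!: forms_slash)
  have p: "pairing_density k (slash k (dilation d) f) (slash k (dilation d) g) z = pairing_density k f g (mob (dilation d) z)" for z
  proof (cases "Im z > 0")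
    case True then show ?thesis using pos by (subst pairing_density_mob) auto
  next
    case False
    then have "\<not> Im (mob (dilation d) z) > 0" using pos(1) by (simp add: mob_dilation zero_less_mult_iff)
    then show ?thesis using False formsD(1)[OF f] by (simp add: pairing_density_def)
  qed
  have q: "e * (d * L) > 0" using pos by simp
  have "weighted_int (gamma0_weight (e * (d * L))) (pairing_density k (slash k (dilation d) f) (slash k (dilation d) g)) = weighted_int (gamma0_weight (e * (d * L))) (\<lambda>z. pairing_density k f g (mob (dilation d) z))"
    by (rule arg_cong[of _ _ "weighted_int (gamma0_weight (e * (d * L)))"]) (rule ext, rule p)
  also have "\<dots> = of_nat (d * e) * weighted_int (gamma0_weight L) (pairing_density k f g)"
  proof (rule weighted_int_dilate[OF pos dv])
    show "pairing_density k f g \<in> borel_measurable borel" using forms_meas[OF f] forms_meas[OF g] by (rule pairing_density_meas)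
    fix M z assume M: "M \<in> GG 1 L" "Im z > 0"
    then show "pairing_density k f g (mob M z) = pairing_density k f g z"
      using pairing_density_mob[of M z k f g] GG_det[OF M(1)] formsD(4)[OF f M(1)] formsD(4)[OF g M(1)] by simp
  qed
  finally show ?thesis unfolding s using pos
    by (simp add: petersson_weighted_int[OF q fs] petersson_weighted_int[OF pos(3) e] covolume_dilate[OF pos dv])
qed

section \<open>Traces of sesquilinear forms\<close>

lemma sum_fun_apply: "(\<Sum>i\<in>I. f i) z = (\<Sum>i\<in>I. f i z :: complex)"
  by (induction I rule: infinite_finite_induct) auto

lemma cfun_span_finite:
  assumes "finite B" shows "f \<in> cfun_span B \<longleftrightarrow> (\<exists>c. f = (\<lambda>z. \<Sum>b\<in>B. c b * b z))"
proof -
  have "cfun_span B = range (\<lambda>u. \<Sum>v\<in>B. (\<lambda>z. u v * v z))" by (rule cfun.span_finite[OF assms])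
  moreover have "(\<Sum>v\<in>B. (\<lambda>z. u v * v z)) = (\<lambda>z. \<Sum>v\<in>B. u v * v z)" for u
    by (simp add: fun_eq_iff sum_fun_apply)
  ultimately show ?thesis by auto
qed

lemma petersson_sum_left:
  assumes l: "l > 0" and f: "\<And>i. i \<in> I \<Longrightarrow> f i \<in> forms k {}" and g: "g \<in> forms k {}"
  shows "petersson V k l (\<lambda>z. \<Sum>i\<in>I. c i * f i z) g = (\<Sum>i\<in>I. c i * petersson V k l (f i) g)"
proof -
  have zero: "petersson V k l (\<lambda>z. 0) g = 0" using petersson_cmult_left[OF l g g, of V 0] by simp
  show ?thesis using f
  proof (induction I rule: infinite_finite_induct)
    case (insert i I)
    have "petersson V k l (\<lambda>z. c i * f i z + (\<Sum>i\<in>I. c i * f i z)) g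
      = petersson V k l (\<lambda>z. c i * f i z) g + petersson V k l (\<lambda>z. \<Sum>i\<in>I. c i * f i z) g"
      using insert.prems by (intro petersson_add_left l g forms_cmult forms_sum) auto
    then show ?case using insert l g by (simp add: petersson_cmult_left)
  qed (simp_all add: zero)
qed

lemma orthonormal_expansion:
  assumes l: "l > 0" and B: "finite B" "B \<subseteq> forms k {}" and on: "\<And>f g. f \<in> B \<Longrightarrow> g \<in> B \<Longrightarrow> petersson V k l f g = (if f = g then 1 else 0)"
    and f: "f \<in> cfun_span B"
  shows "f = (\<lambda>z. \<Sum>b\<in>B. petersson V k l f b * b z)"
proof -
  obtain c where c: "f = (\<lambda>z. \<Sum>b\<in>B. c b * b z)" using f cfun_span_finite[OF B(1)] by blast
  have "petersson V k l f b = c b" if b: "b \<in> B" for b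
  proof -
    have "petersson V k l f b = (\<Sum>b'\<in>B. c b' * petersson V k l b' b)"
      unfolding c by (rule petersson_sum_left[OF l, of B "\<lambda>b. b"]) (use B b in auto)
    also have "\<dots> = (\<Sum>b'\<in>B. if b' = b then c b' else 0)" using b by (intro sum.cong refl) (simp add: on)
    also have "\<dots> = c b" using B(1) b by simp
    finally show ?thesis .
  qed
  then show ?thesis by (subst (1) c) simp
qed

text \<open>Expand the second argument in \<open>B0\<close>, exchange the sums, and recognise the
  sum of \<open><\<psi>, \<phi>> \<phi>\<close> over \<open>B\<close> as \<open>P \<psi>\<close>.
  The right-hand side mentions the subspace only through \<open>P\<close>, so identities between
  projections become identities between traces.\<close>

lemma trace_projection:
  assumes l: "l > 0" and A: "A \<subseteq> forms k {}"
    and B0: "finite B0" "B0 \<subseteq> A" "A \<subseteq> cfun_span B0" "\<And>f g. f \<in> B0 \<Longrightarrow> g \<in> B0 \<Longrightarrow> petersson V k l f g = (if f = g then 1 else 0)"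
    and B: "finite B" "B \<subseteq> A" "\<And>f g. f \<in> B \<Longrightarrow> g \<in> B \<Longrightarrow> petersson V k l f g = (if f = g then 1 else 0)"
    and P: "\<And>f. f \<in> A \<Longrightarrow> P f \<in> cfun_span B" "\<And>f h. f \<in> A \<Longrightarrow> h \<in> B \<Longrightarrow> petersson V k l (P f) h = petersson V k l f h"
    and b1: "\<And>c g. g \<in> A \<Longrightarrow> b (\<lambda>z. \<Sum>\<phi>\<in>B. c \<phi> * \<phi> z) g = (\<Sum>\<phi>\<in>B. c \<phi> * b \<phi> g)"
    and b2: "\<And>c f. f \<in> A \<Longrightarrow> b f (\<lambda>z. \<Sum>\<phi>\<in>B0. c \<phi> * \<phi> z) = (\<Sum>\<phi>\<in>B0. cnj (c \<phi>) * b f \<phi>)"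
  shows "(\<Sum>\<phi>\<in>B. b \<phi> \<phi>) = (\<Sum>\<psi>\<in>B0. b (P \<psi>) \<psi>)"
proof -
  have "(\<Sum>\<phi>\<in>B. b \<phi> \<phi>) = (\<Sum>\<phi>\<in>B. \<Sum>\<psi>\<in>B0. petersson V k l \<psi> \<phi> * b \<phi> \<psi>)"
  proof (rule sum.cong[OF refl])
    fix \<phi> assume \<phi>: "\<phi> \<in> B"
    have e: "\<phi> = (\<lambda>z. \<Sum>\<psi>\<in>B0. petersson V k l \<phi> \<psi> * \<psi> z)"
      by (rule orthonormal_expansion[OF l B0(1) _ B0(4)]) (use \<phi> B B0 A in auto)
    have "b \<phi> \<phi> = (\<Sum>\<psi>\<in>B0. cnj (petersson V k l \<phi> \<psi>) * b \<phi> \<psi>)"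
      by (subst (2) e) (rule b2, use \<phi> B in auto)
    also have "\<dots> = (\<Sum>\<psi>\<in>B0. petersson V k l \<psi> \<phi> * b \<phi> \<psi>)"
    proof (rule sum.cong[OF refl])
      fix \<psi> assume "\<psi> \<in> B0"
      then show "cnj (petersson V k l \<phi> \<psi>) * b \<phi> \<psi> = petersson V k l \<psi> \<phi> * b \<phi> \<psi>"
        using petersson_cnj[OF l, of \<phi> k \<psi> V] \<phi> B(2) B0(2) A by (simp add: subset_iff)
    qed
    finally show "b \<phi> \<phi> = \<dots>" .
  qed
  also have "\<dots> = (\<Sum>\<psi>\<in>B0. \<Sum>\<phi>\<in>B. petersson V k l \<psi> \<phi> * b \<phi> \<psi>)" by (rule sum.swap)
  also have "\<dots> = (\<Sum>\<psi>\<in>B0. b (P \<psi>) \<psi>)"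
  proof (rule sum.cong[OF refl])
    fix \<psi> assume "\<psi> \<in> B0"
    then have \<psi>: "\<psi> \<in> A" using B0 by auto
    have "P \<psi> = (\<lambda>z. \<Sum>\<phi>\<in>B. petersson V k l (P \<psi>) \<phi> * \<phi> z)"
      by (rule orthonormal_expansion[OF l B(1) _ B(3) P(1)[OF \<psi>]]) (use B A in auto)
    also have "\<dots> = (\<lambda>z. \<Sum>\<phi>\<in>B. petersson V k l \<psi> \<phi> * \<phi> z)" using P(2)[OF \<psi>] by simp
    finally show "(\<Sum>\<phi>\<in>B. petersson V k l \<psi> \<phi> * b \<phi> \<psi>) = b (P \<psi>) \<psi>" using b1[OF \<psi>] by simp
  qed
  finally show ?thesis .
qed

section \<open>The pairing twisted by \<open>\<Psi>\<close> and the Hecke operator\<close>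

lemma hecke_meas:
  assumes "g \<in> borel_measurable borel" shows "hecke k n g \<in> borel_measurable borel"
proof -
  note [measurable] = assms
  show ?thesis unfolding hecke_def[abs_def] case_prod_unfold by measurable
qed

lemma hecke_sum: "hecke k n (\<lambda>z. \<Sum>i\<in>I. c i * f i z) z = (\<Sum>i\<in>I. c i * hecke k n (f i) z)"
proof -
  have "hecke k n (\<lambda>z. \<Sum>i\<in>I. c i * f i z) z =
    (\<Sum>p\<in>{(a, c). a * c = n}. \<Sum>b<snd p. \<Sum>i\<in>I. c i * (of_real (1 / sqrt (real n)) * (of_real ((real (fst p) / real (snd p)) powr (real k / 2)) *
        f i ((of_nat (fst p) * z + of_nat b) / of_nat (snd p)))))"
    unfolding hecke_def case_prod_unfold by (simp only: sum_distrib_left mult_ac)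
  also have "\<dots> = (\<Sum>i\<in>I. \<Sum>p\<in>{(a, c). a * c = n}. \<Sum>b<snd p. c i * (of_real (1 / sqrt (real n)) * (of_real ((real (fst p) / real (snd p)) powr (real k / 2)) *
        f i ((of_nat (fst p) * z + of_nat b) / of_nat (snd p)))))"
    by (subst sum.swap[of _ I], subst (2) sum.swap) rule
  also have "\<dots> = (\<Sum>i\<in>I. c i * hecke k n (f i) z)"
    unfolding hecke_def case_prod_unfold by (simp only: sum_distrib_left)
  finally show ?thesis .
qed

text \<open>The point \<open>(az + b)/c\<close> has imaginary part \<open>(a/c) Im z\<close>, so the
  factor \<open>(a/c)^(k/2)\<close> makes each summand a value of \<open>|g| y^(k/2)\<close>,
  bounded by \<open>D\<close>.\<close>

lemma hecke_growth_bounded: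
  assumes g: "growth_bounded k g" and n: "n > 0"
  shows "growth_bounded k (hecke k n g)"
proof -
  obtain D where D: "\<And>z. Im z > 0 \<Longrightarrow> cmod (g z) * Im z powr (real k / 2) \<le> D" using g unfolding growth_bounded_def by blast
  have "cmod (hecke k n g z) * Im z powr (real k / 2) \<le> 1 / sqrt (real n) * (\<Sum>p\<in>{(a, c). a * c = n}. \<Sum>b<snd p. D)" if z: "Im z > 0" for z
  proof -
    let ?t = "\<lambda>p b. of_real ((real (fst p) / real (snd p)) powr (real k / 2)) * g ((of_nat (fst p) * z + of_nat b) / of_nat (snd p))"
    have tm: "cmod (?t p b) * Im z powr (real k / 2) \<le> D" if p: "p \<in> {(a, c). a * c = n}" for p b
    proof -
      have pos: "fst p > 0" "snd p > 0" using p n by (cases p, auto)+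
      let ?w = "(of_nat (fst p) * z + of_nat b) / of_nat (snd p)"
      have Imw: "Im ?w = real (fst p) / real (snd p) * Im z" using pos by (simp add: Im_divide_of_nat)
      have "cmod (?t p b) * Im z powr (real k / 2) = cmod (g ?w) * Im ?w powr (real k / 2)"
      proof -
        have "(real (fst p) / real (snd p) * Im z) powr (real k / 2) = (real (fst p) / real (snd p)) powr (real k / 2) * Im z powr (real k / 2)"
          by (rule powr_mult)
        then show ?thesis unfolding Imw by (simp add: norm_mult del: times_divide_eq_left)
      qed
      also have "\<dots> \<le> D" by (rule D) (use pos z in \<open>simp add: Imw\<close>)
      finally show ?thesis .
    qed
    have "cmod (hecke k n g z) \<le> 1 / sqrt (real n) * (\<Sum>p\<in>{(a, c). a * c = n}. \<Sum>b<snd p. cmod (?t p b))"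
      unfolding hecke_def case_prod_unfold norm_mult norm_of_real
      by (intro mult_mono order_trans[OF norm_sum] sum_mono order_trans[OF norm_sum]) (auto simp: norm_mult intro!: sum_nonneg)
    then have "cmod (hecke k n g z) * Im z powr (real k / 2) \<le> (1 / sqrt (real n) * (\<Sum>p\<in>{(a, c). a * c = n}. \<Sum>b<snd p. cmod (?t p b))) * Im z powr (real k / 2)"
      by (rule mult_right_mono) simp
    also have "\<dots> = 1 / sqrt (real n) * (\<Sum>p\<in>{(a, c). a * c = n}. \<Sum>b<snd p. cmod (?t p b) * Im z powr (real k / 2))"
      by (simp only: mult.assoc sum_distrib_right)
    also have "\<dots> \<le> 1 / sqrt (real n) * (\<Sum>p\<in>{(a, c). a * c = n}. \<Sum>b<snd p. D)"
      by (intro mult_left_mono sum_mono tm) auto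
    finally show ?thesis .
  qed
  then show ?thesis unfolding growth_bounded_def by blast
qed

text \<open>Absolute convergence: on each translate of the standard domain the exponential decay of
  \<open>f\<close> beats the polynomial growth of \<open>\<Psi>\<close>, and for the Hecke image
  boundedness of its modulus times \<open>y^(k/2)\<close> suffices.\<close>

lemma twisted_pairing_weighted_int:
  assumes k: "k > 0" and q: "q > 0" and n: "n > 0"
    and \<Psi>: "\<Psi> \<in> borel_measurable (restrict_space borel upper_half_plane)" "moderate_growth \<Psi>"
    and f: "f \<in> forms k (GG 1 q)" and g: "g \<in> forms k (GG 1 q)"
  shows "petersson V k q f (\<lambda>z. \<Psi> z * hecke k n g z) = of_real (V / covolume q) * weighted_int (gamma0_weight q) (pairing_density k f (\<lambda>z. \<Psi> z * hecke k n g z))"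
    "integrable hyp_H (\<lambda>z. gamma0_weight q z *\<^sub>R pairing_density k f (\<lambda>z. \<Psi> z * hecke k n g z) z)"
proof -
  let ?F = "pairing_density k f (\<lambda>z. \<Psi> z * hecke k n g z)"
  have H: "upper_half_plane \<in> sets borel" unfolding upper_half_plane_def by measurable
  \<comment> \<open>Measurability of \<open>\<Psi>\<close> is given only on the upper half-plane;
    cutting it off elsewhere leaves the integrand unchanged because \<open>f\<close> vanishes
    there.\<close>
  define \<Psi>' where "\<Psi>' z = \<Psi> z * indicator upper_half_plane z" for z
  have m\<Psi>: "\<Psi>' \<in> borel_measurable borel"
    using \<Psi>(1) H unfolding \<Psi>'_def[abs_def] by (subst (asm) borel_measurable_restrict_space_iff) (auto simp: scaleR_conv_of_real mult.commute of_real_indicator)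
  have mg: "hecke k n g \<in> borel_measurable borel" by (rule hecke_meas[OF forms_meas[OF g]])
  have "?F = pairing_density k f (\<lambda>z. \<Psi>' z * hecke k n g z)"
    using formsD(1)[OF f] by (auto simp: fun_eq_iff pairing_density_def \<Psi>'_def upper_half_plane_def indicator_def)
  then have mF: "?F \<in> borel_measurable borel" using m\<Psi> mg forms_meas[OF f] by (auto intro!: pairing_density_meas borel_measurable_times)
  obtain D where D: "\<And>z. Im z > 0 \<Longrightarrow> cmod (hecke k n g z) * Im z powr (real k / 2) \<le> D"
    using hecke_growth_bounded[OF formsD(3)[OF g] n] unfolding growth_bounded_def by blast
  have fc: "f \<in> cusp_forms k q" using f cusp_forms_eq[OF k q] by simp
  have int: "integrable hyp_H (\<lambda>z. indicator fund_domain z *\<^sub>R ?F (mob r z))" if r: "r \<in> coset_reps q" for r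
  proof -
    have r1: "r \<in> GG 1 1" by (rule coset_reps_SL2Z[OF r])
    have dr: "det r = 1" by (rule GG_det[OF r1])
    obtain \<gamma> where \<gamma>: "\<gamma> \<in> SL2Z" "r = rmat \<gamma>" by (rule GG_1_1_rmatE[OF r1])
    obtain C1 N where C1: "\<And>z. z \<in> fund_domain \<Longrightarrow> cmod (\<Psi> (mob r z)) \<le> C1 * Im z ^ N"
      using \<Psi>(2) \<gamma> unfolding moderate_growth_def act_eq_mob by blast
    obtain c C where C: "c > 0" "C \<ge> 0" "\<And>z. Im z \<ge> 1/2 \<Longrightarrow> cmod (slash k r f z) \<le> C * exp (- c * Im z)"
      by (rule cusp_slash_decay[OF fc q r1]) (rule that; assumption)
    obtain K where K: "K \<ge> 0" "\<And>y. y \<ge> 0 \<Longrightarrow> y ^ (k + N) * exp (- c * y) \<le> K" by (rule pow_exp_bound[OF C(1)]) (rule that; assumption)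
    have "cmod (?F (mob r z)) \<le> (C * 2 ^ k * \<bar>C1\<bar> * \<bar>D\<bar>) * K" if z: "z \<in> fund_domain" for z
    proof -
      have z1: "Im z \<ge> 1/2" "Im z > 0" using fund_domain_Im_ge[OF z] by auto
      let ?w = "mob r z"
      have w: "Im ?w > 0" using Im_mob_pos[of r z] dr z1 by simp
      have "cmod (?F ?w) = (cmod (f ?w) * Im ?w powr (real k / 2)) * (cmod (\<Psi> ?w) * (cmod (hecke k n g ?w) * Im ?w powr (real k / 2)))"
        using w powr_half_sq[OF w, of k] by (simp add: pairing_density_def norm_mult norm_power mult_ac)
      also have "cmod (f ?w) * Im ?w powr (real k / 2) = cmod (slash k r f z) * Im z powr (real k / 2)"
        using slash_norm[of r z k f] dr z1 by simp
      also have "(cmod (slash k r f z) * Im z powr (real k / 2)) * (cmod (\<Psi> ?w) * (cmod (hecke k n g ?w) * Im ?w powr (real k / 2)))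
         \<le> ((C * exp (- c * Im z)) * (2 ^ k * Im z ^ k)) * ((\<bar>C1\<bar> * Im z ^ N) * \<bar>D\<bar>)"
      proof (intro mult_mono)
        show "cmod (slash k r f z) \<le> C * exp (- c * Im z)" by (rule C(3)[OF z1(1)])
        show "Im z powr (real k / 2) \<le> 2 ^ k * Im z ^ k" by (rule powr_half_le[OF z1(1)])
        have "C1 * Im z ^ N \<le> \<bar>C1\<bar> * Im z ^ N" using z1 by (intro mult_right_mono) auto
        then show "cmod (\<Psi> ?w) \<le> \<bar>C1\<bar> * Im z ^ N" using C1[OF z] by linarith
        show "cmod (hecke k n g ?w) * Im ?w powr (real k / 2) \<le> \<bar>D\<bar>" using D[OF w] by linarith
      qed (use z1 C(2) in auto)
      also have "\<dots> = (C * 2 ^ k * \<bar>C1\<bar> * \<bar>D\<bar>) * (Im z ^ (k + N) * exp (- c * Im z))" by (simp add: power_add)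
      also have "\<dots> \<le> (C * 2 ^ k * \<bar>C1\<bar> * \<bar>D\<bar>) * K" using K(2)[of "Im z"] z1 C(2) by (intro mult_left_mono) auto
      finally show ?thesis .
    qed
    then show ?thesis using measurable_compose[OF mob_meas mF] by (intro integrable_fund_bounded) auto
  qed
  show "petersson V k q f (\<lambda>z. \<Psi> z * hecke k n g z) = of_real (V / covolume q) * weighted_int (gamma0_weight q) ?F"
    using quotient_integral_weighted_int(1)[OF mF int] by (simp add: petersson_def pairing_density_def[abs_def])
  show "integrable hyp_H (\<lambda>z. gamma0_weight q z *\<^sub>R ?F z)" by (rule quotient_integral_weighted_int(2)[OF mF int])
qed

lemma twisted_pairing_linear:
  assumes k: "k > 0" and q: "q > 0" and n: "n > 0"
    and \<Psi>: "\<Psi> \<in> borel_measurable (restrict_space borel upper_half_plane)" "moderate_growth \<Psi>"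
    and f: "\<And>i. i \<in> I \<Longrightarrow> f i \<in> forms k (GG 1 q)" and g: "g \<in> forms k (GG 1 q)"
  shows "petersson V k q (\<lambda>z. \<Sum>i\<in>I. c i * f i z) (\<lambda>z. \<Psi> z * hecke k n g z) = (\<Sum>i\<in>I. c i * petersson V k q (f i) (\<lambda>z. \<Psi> z * hecke k n g z))"
    "petersson V k q g (\<lambda>z. \<Psi> z * hecke k n (\<lambda>z. \<Sum>i\<in>I. c i * f i z) z) = (\<Sum>i\<in>I. cnj (c i) * petersson V k q g (\<lambda>z. \<Psi> z * hecke k n (f i) z))"
proof -
  note tw = twisted_pairing_weighted_int[OF k q n \<Psi>]
  have S: "(\<lambda>z. \<Sum>i\<in>I. c i * f i z) \<in> forms k (GG 1 q)" by (intro forms_sum forms_cmult f)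
  have "weighted_int (gamma0_weight q) (pairing_density k (\<lambda>z. \<Sum>i\<in>I. c i * f i z) (\<lambda>z. \<Psi> z * hecke k n g z))
    = (\<integral>z. (\<Sum>i\<in>I. c i * (gamma0_weight q z *\<^sub>R pairing_density k (f i) (\<lambda>z. \<Psi> z * hecke k n g z) z)) \<partial>hyp_H)"
    unfolding weighted_int_def by (rule Bochner_Integration.integral_cong) (simp_all add: pairing_density_def sum_distrib_right sum_distrib_left scaleR_conv_of_real mult_ac)
  also have "\<dots> = (\<Sum>i\<in>I. c i * weighted_int (gamma0_weight q) (pairing_density k (f i) (\<lambda>z. \<Psi> z * hecke k n g z)))"
    unfolding weighted_int_def by (subst Bochner_Integration.integral_sum) (auto intro!: integrable_mult_right tw(2) f g simp: integral_mult_right_zero simp del: mult_scaleR_right)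
  finally show "petersson V k q (\<lambda>z. \<Sum>i\<in>I. c i * f i z) (\<lambda>z. \<Psi> z * hecke k n g z) = (\<Sum>i\<in>I. c i * petersson V k q (f i) (\<lambda>z. \<Psi> z * hecke k n g z))"
    using tw(1)[OF S g] tw(1)[OF f g] by (simp add: sum_distrib_left mult_ac)
  have "weighted_int (gamma0_weight q) (pairing_density k g (\<lambda>z. \<Psi> z * hecke k n (\<lambda>z. \<Sum>i\<in>I. c i * f i z) z))
    = (\<integral>z. (\<Sum>i\<in>I. cnj (c i) * (gamma0_weight q z *\<^sub>R pairing_density k g (\<lambda>z. \<Psi> z * hecke k n (f i) z) z)) \<partial>hyp_H)"
    unfolding weighted_int_def hecke_sum by (rule Bochner_Integration.integral_cong) (simp_all add: pairing_density_def sum_distrib_right sum_distrib_left scaleR_conv_of_real mult_ac)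
  also have "\<dots> = (\<Sum>i\<in>I. cnj (c i) * weighted_int (gamma0_weight q) (pairing_density k g (\<lambda>z. \<Psi> z * hecke k n (f i) z)))"
    unfolding weighted_int_def by (subst Bochner_Integration.integral_sum) (auto intro!: integrable_mult_right tw(2) f g simp: integral_mult_right_zero simp del: mult_scaleR_right)
  finally show "petersson V k q g (\<lambda>z. \<Psi> z * hecke k n (\<lambda>z. \<Sum>i\<in>I. c i * f i z) z) = (\<Sum>i\<in>I. cnj (c i) * petersson V k q g (\<lambda>z. \<Psi> z * hecke k n (f i) z))"
    using tw(1)[OF g S] tw(1)[OF g f] by (simp add: sum_distrib_left mult_ac)
qed

section \<open>Squarefree divisors and the Moebius function\<close>

lemma cube_adm_of_cubes:
  assumes q: "q > 0" and cube: "\<And>p. prime p \<Longrightarrow> p dvd q \<Longrightarrow> p ^ 3 dvd q"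
    and d: "d dvd q" "squarefree d" and e: "e dvd q" "squarefree e"
  shows "cube_adm q d e"
proof -
  have pos: "d > 0" "e > 0" using d e q by (auto intro: dvd_pos_nat)
  \<comment> \<open>Each of three squarefree factors contributes at most one factor
    \<open>p\<close>, and \<open>q\<close> has at least three whenever \<open>p\<close> divides
    it.\<close>
  have *: "a * b * c dvd q" if abc: "a dvd q" "squarefree a" "b dvd q" "squarefree b" "c dvd q" "squarefree c" for a b c
  proof (rule multiplicity_le_imp_dvd)
    have nz: "a \<noteq> 0" "b \<noteq> 0" "c \<noteq> 0" using abc q by (auto intro!: Nat.gr0I)
    then show "a * b * c \<noteq> 0" by simp
    fix p :: nat assume p: "prime p"
    have m1: "multiplicity p a \<le> (if p dvd q then 1 else 0)" if "a dvd q" "squarefree a" for a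
    proof (cases "p dvd q")
      case True
      moreover have "a \<noteq> 0" using that(2) by (intro notI) simp
      ultimately show ?thesis using that(2) p squarefree_factorial_semiring''[of a] by auto
    next
      case False
      then have "\<not> p dvd a" using that(1) dvd_trans by blast
      then show ?thesis by (simp add: not_dvd_imp_multiplicity_0)
    qed
    have "multiplicity p (a * b * c) = multiplicity p a + multiplicity p b + multiplicity p c"
      using p nz by (simp add: prime_elem_multiplicity_mult_distrib)
    also have "\<dots> \<le> (if p dvd q then 3 else 0)" using m1[OF abc(1,2)] m1[OF abc(3,4)] m1[OF abc(5,6)] by (auto split: if_splits)
    also have "\<dots> \<le> multiplicity p q"
      using cube[OF p] p q by (auto intro!: multiplicity_geI)
    finally show "multiplicity p (a * b * c) \<le> multiplicity p q" .
  qed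
  show ?thesis unfolding cube_adm_def using *[OF d d e] *[OF d e e] pos q by simp
qed

lemma mu_prime_mult:
  assumes p: "prime p" and d: "squarefree d" "\<not> p dvd d"
  shows "mu (p * d) = - mu d" "squarefree (p * d)"
proof -
  have c: "coprime p d" using p d by (simp add: prime_imp_coprime)
  show s: "squarefree (p * d)" using c d p by (simp add: squarefree_mult_coprime squarefree_prime)
  have "d \<noteq> 0" using d(2) by (intro notI) simp
  then have "prime_factors (p * d) = insert p (prime_factors d)" using p by (simp add: prime_factors_product prime_prime_factors)
  moreover have "p \<notin> prime_factors d" using d(2) by auto
  ultimately show "mu (p * d) = - mu d" using s d by (simp add: mu_def)
qed

text \<open>The divisors prime to \<open>p\<close> are paired with their multiples by
  \<open>p\<close>: \<open>h\<close> agrees on a pair and \<open>mu\<close> changes sign.\<close>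

lemma mu_sum_cancel:
  fixes h :: "nat \<Rightarrow> complex"
  assumes q: "q > 0" and p: "prime p" "p dvd q"
    and h: "\<And>d. squarefree d \<Longrightarrow> d dvd q \<Longrightarrow> \<not> p dvd d \<Longrightarrow> h (p * d) = h d"
  shows "(\<Sum>d | d dvd q \<and> squarefree d. of_int (mu d) * h d) = 0"
proof -
  let ?D = "{d. d dvd q \<and> squarefree d}"
  have fin: "finite ?D" using finite_divisors_nat[OF q] by (rule finite_subset[rotated]) auto
  have p0: "p > 0" using p prime_gt_0_nat by blast
  have split: "?D = {d \<in> ?D. \<not> p dvd d} \<union> {d \<in> ?D. p dvd d}" by auto
  have img: "{d \<in> ?D. p dvd d} = (*) p ` {d \<in> ?D. \<not> p dvd d}"
  proof (intro equalityI subsetI)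
    fix x assume "x \<in> {d \<in> ?D. p dvd d}"
    then obtain d where d: "x = p * d" "x dvd q" "squarefree x" by auto
    have "\<not> p dvd d"
    proof
      assume "p dvd d"
      then have "p ^ 2 dvd x" by (simp add: d power2_eq_square)
      then have "p dvd 1" using d(3) unfolding squarefree_def by blast
      then show False using p by simp
    qed
    moreover have "squarefree d" using squarefree_multD(2) d by blast
    moreover have "d dvd q" using d(1,2) dvd_mult_right by blast
    ultimately show "x \<in> (*) p ` {d \<in> ?D. \<not> p dvd d}" using d by auto
  next
    fix x assume "x \<in> (*) p ` {d \<in> ?D. \<not> p dvd d}"
    then obtain d where d: "x = p * d" "d dvd q" "squarefree d" "\<not> p dvd d" by auto
    have "coprime p d" using p d by (simp add: prime_imp_coprime)
    then have "p * d dvd q" using p d by (simp add: divides_mult)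
    then show "x \<in> {d \<in> ?D. p dvd d}" using d mu_prime_mult(2)[OF p(1) d(3,4)] by simp
  qed
  have "(\<Sum>d\<in>?D. of_int (mu d) * h d) = (\<Sum>d\<in>{d \<in> ?D. \<not> p dvd d}. of_int (mu d) * h d) + (\<Sum>d\<in>{d \<in> ?D. p dvd d}. of_int (mu d) * h d)"
    by (subst split, rule sum.union_disjoint; (rule finite_subset[OF _ fin])?) auto
  also have "(\<Sum>d\<in>{d \<in> ?D. p dvd d}. of_int (mu d) * h d) = (\<Sum>d\<in>{d \<in> ?D. \<not> p dvd d}. of_int (mu (p * d)) * h (p * d))"
    unfolding img by (subst sum.reindex) (use p0 in \<open>auto simp: inj_on_def\<close>)
  also have "\<dots> = (\<Sum>d\<in>{d \<in> ?D. \<not> p dvd d}. - (of_int (mu d) * h d))"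
    by (rule sum.cong[OF refl]) (use h mu_prime_mult(1)[OF p(1)] in auto)
  finally show ?thesis by (simp add: sum_negf)
qed

section \<open>The sieve\<close>

lemma cfun_span_dilate:
  assumes "finite B" "\<phi> \<in> cfun_span B" shows "dilate k d \<phi> \<in> cfun_span (dilate k d ` B)"
proof -
  obtain c where c: "\<phi> = (\<lambda>z. \<Sum>b\<in>B. c b * b z)" using assms cfun_span_finite by blast
  have "dilate k d \<phi> = (\<Sum>b\<in>B. (\<lambda>z. c b * dilate k d b z))"
    unfolding c by (simp add: fun_eq_iff dilate_def sum_fun_apply sum_distrib_left mult_ac)
  also have "\<dots> \<in> cfun_span (dilate k d ` B)"
    by (intro cfun.span_sum cfun.span_scale cfun.span_base) auto
  finally show ?thesis .
qed

text \<open>Take a prime \<open>p\<close> dividing \<open>q / l\<close>. Either \<open>p\<close>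
  divides \<open>d\<close>, and the form is fixed by translation by \<open>1/p\<close>, or
  \<open>d * l\<close> divides \<open>q / p\<close>, and the form already has level
  \<open>q / p\<close>. The sieve thus needs only two types of old forms for each prime.\<close>

lemma oldspace_generator:
  assumes k: "k > 0" and q: "q > 0" and l: "l dvd q" "l \<noteq> q" "d dvd q div l" and \<phi>: "\<phi> \<in> cusp_forms k l"
  obtains p where "prime p" "p dvd q" "dilate k d \<phi> \<in> forms k (GG p q) \<or> dilate k d \<phi> \<in> forms k (GG 1 (q div p))"
proof -
  obtain m where m: "q = l * m" using l(1) by blast
  have l0: "l > 0" and m0: "m > 0" using q m by auto
  have "m \<noteq> 1" using m l(2) by auto
  then obtain p where p: "prime p" "p dvd m" using prime_factor_nat by blast
  have p0: "p > 0" using p(1) prime_gt_0_nat by blast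
  have pq: "p dvd q" unfolding m by (rule dvd_mult[OF p(2)])
  have "d dvd m" using l(3) m l0 by simp
  then obtain m' where m': "m = d * m'" by blast
  have d0: "d > 0" using m0 m' by auto
  have dl: "d * l dvd q" unfolding m m' by (simp add: mult_ac)
  have f: "dilate k d \<phi> \<in> forms k (GG d (d * l))"
    using dilate_forms[OF d0 l0, of k] \<phi> cusp_forms_eq[OF k l0] by blast
  show thesis
  proof (cases "p dvd d")
    case True
    have "GG p q \<subseteq> GG d (d * l)" using True dl p0 q d0 l0 by (intro GG_mono) auto
    then show ?thesis using that[OF p(1) pq] f forms_mono by blast
  next
    case False
    then have "p dvd m'" using p m' prime_dvd_mult_iff by blast
    then obtain t where t: "m' = p * t" by blast
    have "q = p * (d * l * t)" unfolding m m' t by (simp add: mult_ac)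
    then have qp: "q div p = d * l * t" using p0 by simp
    have "d * l * t > 0" using q \<open>q = p * (d * l * t)\<close> by (metis gr0I mult_0_right)
    then have "GG 1 (q div p) \<subseteq> GG d (d * l)" using d0 l0 unfolding qp by (intro GG_mono) auto
    then show ?thesis using that[OF p(1) pq] f forms_mono by blast
  qed
qed

lemma cube_adm_level:
  assumes "cube_adm q d e"
  shows "q div (d * e) > 0" "q = e * (d * (q div (d * e)))" "d * (q div (d * e)) = q div e" "d dvd q div (d * e)" "e dvd d * (q div (d * e))"
proof -
  obtain y where y: "q > 0" "d > 0" "e > 0" "y > 0" "q = e * y" "q div e = y" "d * d dvd y" "d * e dvd y" "e dvd y" "d dvd y" "d * d dvd q"
    by (rule cube_admE[OF assms])
  obtain m where m: "y = d * m" using y(10) by blast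
  have "q = d * e * m" using y(5) m by simp
  then have L: "q div (d * e) = m" using y(2,3) by simp
  show "q div (d * e) > 0" using y(4) m L by (metis gr0I mult_0_right)
  show "q = e * (d * (q div (d * e)))" "d * (q div (d * e)) = q div e" "e dvd d * (q div (d * e))"
    using y m L by simp_all
  show "d dvd q div (d * e)" using y(2,7) unfolding L m by simp
qed

text \<open>Such a form is dilated from level \<open>q div (d * e)\<close>, a proper divisor of
  \<open>q\<close> because \<open>d * e \<noteq> 1\<close>.\<close>

lemma forms_in_oldspace:
  assumes k: "k > 0" and a: "cube_adm q d e" and ne: "d * e \<noteq> 1" and f: "f \<in> forms k (GG d (q div e))"
  shows "f \<in> oldspace k q"
proof -
  let ?L = "q div (d * e)"
  note L = cube_adm_level[OF a]
  have pos: "d > 0" "e > 0" "q > 0" using a by (auto simp: cube_adm_def)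
  obtain \<phi> where \<phi>: "\<phi> \<in> forms k (GG 1 ?L)" "f = dilate k d \<phi>"
    using f dilate_forms[OF pos(1) L(1), of k] unfolding L(3) by blast
  have q: "q = ?L * (d * e)" using L(2) by (simp add: mult_ac)
  have "?L dvd q" using q by (metis dvd_triv_left)
  moreover have "?L \<noteq> q" using q ne pos by (metis mult_cancel1 mult.right_neutral not_gr0)
  moreover have "q div ?L = d * e" using L(1) q by (metis nonzero_mult_div_cancel_left not_gr0)
  then have "d dvd q div ?L" by simp
  moreover have "\<phi> \<in> cusp_forms k ?L" using \<phi>(1) cusp_forms_eq[OF k L(1)] by simp
  ultimately show ?thesis unfolding oldspace_def \<phi>(2) by (intro cfun.span_base) blast
qed

text \<open>Write \<open>P\<close> and \<open>P'\<close> for the projections for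
  \<open>(d, e)\<close> and \<open>(d', e')\<close>. Since \<open>P' f\<close> is in the image of
  \<open>P\<close>, and \<open>P g\<close> in that of \<open>P'\<close>, one gets
  \<open><P' f, g> = <P' f, P g> = <f, P g> = <P f, g>\<close>.\<close>

lemma old_proj_pairing_eq:
  assumes a: "cube_adm q d e" "cube_adm q d' e'" and f: "f \<in> forms k (GG 1 q)" and g: "g \<in> forms k (GG 1 q)"
    and Y: "old_proj k q d' e' f \<in> forms k (GG d (q div e))"
    and Pg: "old_proj k q d e g \<in> forms k (GG d' (q div e'))"
  shows "petersson V k q (old_proj k q d' e' f) g = petersson V k q (old_proj k q d e f) g"
proof -
  let ?Y = "old_proj k q d' e' f"
  have q: "q > 0" using a by (simp add: cube_adm_def)
  note e = forms_empty[OF Y] forms_empty[OF g] forms_empty[OF Pg]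
  have "petersson V k q ?Y g = cnj (petersson V k q g ?Y)" by (rule petersson_cnj[OF q e(2,1)])
  also have "\<dots> = cnj (petersson V k q (old_proj k q d e g) ?Y)" by (simp add: old_proj_adjoint[OF a(1) g Y])
  also have "\<dots> = petersson V k q ?Y (old_proj k q d e g)" by (rule petersson_cnj[OF q e(3,1), symmetric])
  also have "\<dots> = petersson V k q f (old_proj k q d e g)" by (rule old_proj_adjoint[OF a(2) f Pg])
  also have "\<dots> = petersson V k q (old_proj k q d e f) g" by (rule old_proj_selfadjoint[OF a(1) f g, symmetric])
  finally show ?thesis .
qed

text \<open>One inclusion is monotonicity of the groups, valid for every form; the other, for
  \<open>g\<close> alone, is \<open>old_proj_up_step\<close>.\<close>

lemma old_proj_pairing_up:
  assumes a: "cube_adm q d e" "cube_adm q (p * d) e" and p: "coprime p d" and f: "f \<in> forms k (GG 1 q)" and g: "g \<in> forms k (GG p q)"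
  shows "petersson V k q (old_proj k q (p * d) e f) g = petersson V k q (old_proj k q d e f) g"
proof -
  have pos: "q > 0" "d > 0" "p * d > 0" using a by (auto simp: cube_adm_def)
  have qe: "q div e > 0" using a(1) by (elim cube_admE) simp
  have p0: "p > 0" using pos(3) by auto
  let ?Y = "old_proj k q (p * d) e f"
  have Y: "?Y \<in> forms k (GG (p * d) (q div e))" by (rule old_proj_forms[OF a(2) f])
  have "GG d (q div e) \<subseteq> GG (p * d) (q div e)" using pos qe by (intro GG_mono) auto
  then have Y': "?Y \<in> forms k (GG d (q div e))" using Y forms_mono by blast
  have "GG 1 q \<subseteq> GG p q" using pos p0 by (intro GG_mono) auto
  then have g1: "g \<in> forms k (GG 1 q)" using g forms_mono by blast
  have Pg: "old_proj k q d e g \<in> forms k (GG (p * d) (q div e))" by (rule old_proj_up_step[OF a p g])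
  show ?thesis by (rule old_proj_pairing_eq[OF a f g1 Y' Pg])
qed

lemma old_proj_pairing_lo:
  assumes a: "cube_adm q d e" "cube_adm q d (p * e)" and p: "coprime p e" and pq: "p dvd q" and f: "f \<in> forms k (GG 1 q)" and g: "g \<in> forms k (GG 1 (q div p))"
  shows "petersson V k q (old_proj k q d (p * e) f) g = petersson V k q (old_proj k q d e f) g"
proof -
  have pos: "q > 0" "d > 0" "e > 0" "p * e > 0" using a by (auto simp: cube_adm_def)
  have p0: "p > 0" using pos(4) by auto
  have qe: "q div e > 0" "q = e * (q div e)" using a(1) by (elim cube_admE; simp)+
  have qpe: "q div (p * e) > 0" "q = (p * e) * (q div (p * e))" using a(2) by (elim cube_admE; simp)+
  have qp: "q = p * (q div p)" "q div p > 0" using pq p0 pos(1) by (auto elim!: dvdE)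
  let ?Y = "old_proj k q d (p * e) f"
  have Y: "?Y \<in> forms k (GG d (q div (p * e)))" by (rule old_proj_forms[OF a(2) f])
  have "e * (q div e) = e * (p * (q div (p * e)))" using qe(2) qpe(2) by (metis mult.assoc mult.commute)
  then have "q div e = p * (q div (p * e))" using pos(3) by simp
  then have "q div (p * e) dvd q div e" by simp
  then have "GG d (q div e) \<subseteq> GG d (q div (p * e))" using pos qe(1) qpe(1) by (intro GG_mono) auto
  then have Y': "?Y \<in> forms k (GG d (q div e))" using Y forms_mono by blast
  have "q div p dvd q" using qp(1) by (metis dvd_triv_right)
  then have "GG 1 q \<subseteq> GG 1 (q div p)" using pos qp(2) by (intro GG_mono) auto
  then have g1: "g \<in> forms k (GG 1 q)" using g forms_mono by blast
  have Pg: "old_proj k q d e g \<in> forms k (GG d (q div (p * e)))" by (rule old_proj_lo_step[OF a p g])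
  show ?thesis by (rule old_proj_pairing_eq[OF a f g1 Y' Pg])
qed

theorem mainTheorem5:
  fixes k q n :: nat and V :: real and \<Psi> :: "complex \<Rightarrow> complex"
    and B :: "nat \<Rightarrow> (complex \<Rightarrow> complex) set" and Bnew :: "(complex \<Rightarrow> complex) set"
  assumes "k > 0" and "q > 0" and "n > 0" and "V > 0"
    and "\<And>p. prime p \<Longrightarrow> p dvd q \<Longrightarrow> p ^ 3 dvd q"
    and "coprime n q"
    and "\<Psi> \<in> borel_measurable (restrict_space borel upper_half_plane)"
    and "\<And>g z. g \<in> Gamma0 q \<Longrightarrow> z \<in> upper_half_plane \<Longrightarrow> \<Psi> (act g z) = \<Psi> z"
    and "moderate_growth \<Psi>"
    and "\<And>l. l > 0 \<Longrightarrow> orthonormal_basis V k l (cusp_forms k l) (B l)"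
    and "orthonormal_basis V k q (newspace V k q) Bnew"
  shows "(\<Sum>\<phi>\<in>Bnew. petersson V k q \<phi> (\<lambda>z. \<Psi> z * hecke k n \<phi> z)) =
         (\<Sum>d | d dvd q. \<Sum>e | e dvd q. of_int (mu d * mu e) *
            (\<Sum>\<phi>\<in>B (q div (d * e)).
               petersson V k q (dilate k d \<phi>) (\<lambda>z. \<Psi> z * hecke k n (dilate k d \<phi>) z)))"
proof -
  note k = assms(1) and q = assms(2) and n = assms(3) and cube = assms(5) and \<Psi> = assms(7,9)
  define A where "A = forms k (GG 1 q)"
  have A0: "A \<subseteq> forms k {}" unfolding A_def using forms_empty by blast
  have Aeq: "cusp_forms k q = A" unfolding A_def by (rule cusp_forms_eq[OF k q])
  define b where "b f g = petersson V k q f (\<lambda>z. \<Psi> z * hecke k n g z)" for f g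
  have b_left: "b (\<lambda>z. \<Sum>i\<in>I. c i * f i z) g = (\<Sum>i\<in>I. c i * b (f i) g)"
    if "\<And>i. i \<in> I \<Longrightarrow> f i \<in> A" "g \<in> A" for I :: "(nat \<times> nat) set" and c f g
    unfolding b_def by (rule twisted_pairing_linear(1)[OF k q n \<Psi>]) (use that in \<open>auto simp: A_def\<close>)
  have b1: "b (\<lambda>z. \<Sum>\<phi>\<in>X. c \<phi> * \<phi> z) g = (\<Sum>\<phi>\<in>X. c \<phi> * b \<phi> g)" if "X \<subseteq> A" "g \<in> A" for X c g
    unfolding b_def by (rule twisted_pairing_linear(1)[OF k q n \<Psi>, of X "\<lambda>\<phi>. \<phi>"]) (use that in \<open>auto simp: A_def\<close>)
  have b2: "b f (\<lambda>z. \<Sum>\<phi>\<in>X. c \<phi> * \<phi> z) = (\<Sum>\<phi>\<in>X. cnj (c \<phi>) * b f \<phi>)" if "X \<subseteq> A" "f \<in> A" for X c f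
    unfolding b_def by (rule twisted_pairing_linear(2)[OF k q n \<Psi>, of X "\<lambda>\<phi>. \<phi>"]) (use that in \<open>auto simp: A_def\<close>)
  have Bl: "finite (B l)" "B l \<subseteq> forms k (GG 1 l)" "cfun_span (B l) = forms k (GG 1 l)"
    "\<And>f g. f \<in> B l \<Longrightarrow> g \<in> B l \<Longrightarrow> petersson V k l f g = (if f = g then 1 else 0)" if l: "l > 0" for l
  proof -
    note o = assms(10)[OF l, unfolded orthonormal_basis_def cusp_forms_eq[OF k l]]
    show "finite (B l)" "cfun_span (B l) = forms k (GG 1 l)" using o by auto
    then show "B l \<subseteq> forms k (GG 1 l)" using cfun.span_superset by blast
    show "\<And>f g. f \<in> B l \<Longrightarrow> g \<in> B l \<Longrightarrow> petersson V k l f g = (if f = g then 1 else 0)" using o by auto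
  qed
  have B0: "finite (B q)" "B q \<subseteq> A" "A \<subseteq> cfun_span (B q)"
    "\<And>f g. f \<in> B q \<Longrightarrow> g \<in> B q \<Longrightarrow> petersson V k q f g = (if f = g then 1 else 0)"
    using Bl[OF q] unfolding A_def by auto
  \<comment> \<open>Only squarefree divisors satisfy \<open>cube_adm\<close> by the cube condition;
    for the remaining divisors \<open>mu\<close> is zero, and they are restored at the very
    end.\<close>
  define D where "D = {d. d dvd q \<and> squarefree d}"
  have fD: "finite D" unfolding D_def using finite_divisors_nat[OF q] by (rule finite_subset[rotated]) auto
  have cube_adm: "cube_adm q d e" if "d \<in> D" "e \<in> D" for d e
    using cube_adm_of_cubes[OF q cube] that by (auto simp: D_def)
  have sub: "forms k (GG d (q div e)) \<subseteq> A" if "cube_adm q d e" for d e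
    unfolding A_def using forms_GG_iff[OF that] by blast
  \<comment> \<open>The dilated basis is an orthonormal basis of the image of
    \<open>old_proj k q d e\<close>, so the inner sum of the claim is a trace over that
    image.\<close>
  have trace_old: "(\<Sum>\<phi>\<in>B (q div (d * e)). b (dilate k d \<phi>) (dilate k d \<phi>)) = (\<Sum>\<psi>\<in>B q. b (old_proj k q d e \<psi>) \<psi>)"
    if de: "d \<in> D" "e \<in> D" for d e
  proof -
    let ?L = "q div (d * e)"
    note a = cube_adm[OF de]
    note L = cube_adm_level[OF a]
    have d0: "d > 0" "e > 0" using a by (auto simp: cube_adm_def)
    have img: "dilate k d ` forms k (GG 1 ?L) = forms k (GG d (q div e))" using dilate_forms[OF d0(1) L(1), of k] unfolding L(3) .
    have inj: "inj_on (dilate k d) (B ?L)" using dilate_inj[OF d0(1)] Bl(2)[OF L(1)] by (rule inj_on_subset)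
    have "(\<Sum>\<phi>\<in>B ?L. b (dilate k d \<phi>) (dilate k d \<phi>)) = (\<Sum>\<phi>\<in>dilate k d ` B ?L. b \<phi> \<phi>)"
      by (simp add: sum.reindex[OF inj])
    also have "\<dots> = (\<Sum>\<psi>\<in>B q. b (old_proj k q d e \<psi>) \<psi>)"
    proof (rule trace_projection[OF q A0 B0])
      show "finite (dilate k d ` B ?L)" using Bl(1)[OF L(1)] by simp
      show subA: "dilate k d ` B ?L \<subseteq> A" using Bl(2)[OF L(1)] img sub[OF a] by blast
      show "petersson V k q f g = (if f = g then 1 else 0)" if fg: "f \<in> dilate k d ` B ?L" "g \<in> dilate k d ` B ?L" for f g
      proof -
        obtain \<phi> \<psi> where fg': "\<phi> \<in> B ?L" "f = dilate k d \<phi>" "\<psi> \<in> B ?L" "g = dilate k d \<psi>" using fg by auto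
        have "petersson V k (e * (d * ?L)) (dilate k d \<phi>) (dilate k d \<psi>) = petersson V k ?L \<phi> \<psi>"
          by (rule dilate_isometry[OF d0 L(1,4,5)]) (use fg' Bl(2)[OF L(1)] in auto)
        then have "petersson V k q f g = (if \<phi> = \<psi> then 1 else 0)" using fg' Bl(4)[OF L(1)] L(2) by simp
        then show ?thesis using fg' inj by (auto dest: inj_onD)
      qed
      show "old_proj k q d e f \<in> cfun_span (dilate k d ` B ?L)" if "f \<in> A" for f
      proof -
        have "old_proj k q d e f \<in> forms k (GG d (q div e))" using old_proj_forms[OF a] that by (simp add: A_def)
        then obtain \<phi> where "\<phi> \<in> forms k (GG 1 ?L)" "old_proj k q d e f = dilate k d \<phi>" using img by blast
        then show ?thesis using cfun_span_dilate[OF Bl(1)[OF L(1)]] Bl(3)[OF L(1)] by simp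
      qed
      show "petersson V k q (old_proj k q d e f) h = petersson V k q f h" if "f \<in> A" "h \<in> dilate k d ` B ?L" for f h
        using old_proj_adjoint[OF a, of f k h V] that Bl(2)[OF L(1)] img by (auto simp: A_def)
      show "\<And>c g. g \<in> A \<Longrightarrow> b (\<lambda>z. \<Sum>\<phi>\<in>dilate k d ` B ?L. c \<phi> * \<phi> z) g = (\<Sum>\<phi>\<in>dilate k d ` B ?L. c \<phi> * b \<phi> g)"
        by (rule b1[OF subA])
      show "\<And>c f. f \<in> A \<Longrightarrow> b f (\<lambda>z. \<Sum>\<phi>\<in>B q. c \<phi> * \<phi> z) = (\<Sum>\<phi>\<in>B q. cnj (c \<phi>) * b f \<phi>)"
        by (rule b2[OF B0(2)])
    qed
    finally show ?thesis .
  qed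
  \<comment> \<open>The expansion of the product over all primes dividing \<open>q\<close> of
    \<open>(1 - P_{p,1}) (1 - P_{1,p})\<close>, where \<open>P_{d,e}\<close> stands for
    \<open>old_proj k q d e\<close>.\<close>
  define Q where "Q f z = (\<Sum>p\<in>D \<times> D. of_int (mu (fst p) * mu (snd p)) * old_proj k q (fst p) (snd p) f z)" for f z
  have PA: "old_proj k q (fst p) (snd p) f \<in> A" if "p \<in> D \<times> D" "f \<in> A" for p f
    using old_proj_forms[OF cube_adm, of "fst p" "snd p" f k] sub[OF cube_adm, of "fst p" "snd p"] that by (auto simp: A_def)
  have QA: "Q f \<in> A" if "f \<in> A" for f
    unfolding Q_def[abs_def] A_def by (intro forms_sum forms_cmult) (use PA that in \<open>auto simp: A_def\<close>)
  have Q_pair: "petersson V k q (Q f) g = (\<Sum>d\<in>D. \<Sum>e\<in>D. of_int (mu d * mu e) * petersson V k q (old_proj k q d e f) g)"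
    if "f \<in> A" "g \<in> A" for f g
  proof -
    have "petersson V k q (Q f) g = (\<Sum>p\<in>D \<times> D. of_int (mu (fst p) * mu (snd p)) * petersson V k q (old_proj k q (fst p) (snd p) f) g)"
      unfolding Q_def[abs_def] by (rule petersson_sum_left[OF q]) (use PA that A0 in auto)
    then show ?thesis by (simp add: sum.cartesian_product case_prod_unfold)
  qed
  have Q_old: "petersson V k q (Q f) g = 0" if f: "f \<in> A" and p: "prime p" "p dvd q"
    and g: "g \<in> forms k (GG p q) \<or> g \<in> forms k (GG 1 (q div p))" for f g p
  proof -
    have p0: "p > 0" using p prime_gt_0_nat by blast
    have qp: "q div p > 0" "q div p dvd q" using p q p0 by (auto elim!: dvdE)
    have "GG 1 q \<subseteq> GG p q" "GG 1 q \<subseteq> GG 1 (q div p)" using q p0 qp by (intro GG_mono; auto)+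
    then have gA: "g \<in> A" using g forms_mono unfolding A_def by blast
    have pD: "p * d \<in> D" "coprime p d" if "d \<in> D" "\<not> p dvd d" for d
    proof -
      show c: "coprime p d" using p that by (simp add: prime_imp_coprime)
      then show "p * d \<in> D" using that p mu_prime_mult(2)[OF p(1)] by (auto simp: D_def divides_mult)
    qed
    show ?thesis using g
    proof
      assume g: "g \<in> forms k (GG p q)"
      \<comment> \<open>A form fixed by translation by \<open>1/p\<close> does not distinguish
        \<open>d\<close> from \<open>p * d\<close>, so the cancellation takes place in
        \<open>d\<close> for each fixed \<open>e\<close>; in the other case the roles are
        exchanged.\<close>
      have "(\<Sum>d\<in>D. of_int (mu d) * petersson V k q (old_proj k q d e f) g) = 0" if e: "e \<in> D" for e
        unfolding D_def
      proof (rule mu_sum_cancel[OF q p])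
        fix d assume "squarefree d" "d dvd q" "\<not> p dvd d"
        then have d: "d \<in> D" "p * d \<in> D" "coprime p d" using pD by (auto simp: D_def)
        show "petersson V k q (old_proj k q (p * d) e f) g = petersson V k q (old_proj k q d e f) g"
          by (rule old_proj_pairing_up[OF cube_adm cube_adm d(3) _ g]) (use d e f in \<open>auto simp: A_def\<close>)
      qed
      then have "(\<Sum>e\<in>D. of_int (mu e) * (\<Sum>d\<in>D. of_int (mu d) * petersson V k q (old_proj k q d e f) g)) = 0" by simp
      then show ?thesis unfolding Q_pair[OF f gA] by (subst sum.swap) (simp add: sum_distrib_left mult_ac)
    next
      assume g: "g \<in> forms k (GG 1 (q div p))"
      have "(\<Sum>e\<in>D. of_int (mu e) * petersson V k q (old_proj k q d e f) g) = 0" if d: "d \<in> D" for d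
        unfolding D_def
      proof (rule mu_sum_cancel[OF q p])
        fix e assume "squarefree e" "e dvd q" "\<not> p dvd e"
        then have e: "e \<in> D" "p * e \<in> D" "coprime p e" using pD by (auto simp: D_def)
        show "petersson V k q (old_proj k q d (p * e) f) g = petersson V k q (old_proj k q d e f) g"
          by (rule old_proj_pairing_lo[OF cube_adm cube_adm e(3) p(2) _ g]) (use d e f in \<open>auto simp: A_def\<close>)
      qed
      then have "(\<Sum>d\<in>D. of_int (mu d) * (\<Sum>e\<in>D. of_int (mu e) * petersson V k q (old_proj k q d e f) g)) = 0" by simp
      then show ?thesis unfolding Q_pair[OF f gA] by (simp add: sum_distrib_left mult_ac)
    qed
  qed
  have Q_new: "Q f \<in> newspace V k q" if f: "f \<in> A" for f
  proof -
    let ?T = "{g \<in> A. petersson V k q (Q f) g = 0}"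
    have Qf: "Q f \<in> forms k {}" using QA[OF f] A0 by blast
    have flip: "petersson V k q (Q f) g = cnj (petersson V k q g (Q f))" if "g \<in> A" for g
      by (rule petersson_cnj[OF q _ Qf]) (use that A0 in auto)
    \<comment> \<open>With \<open>Q f\<close> in the second argument, linearity in the first
      argument shows that the orthogonal forms make up a subspace. Checking the generators of the
      oldspace then suffices.\<close>
    have T: "?T = {g \<in> A. petersson V k q g (Q f) = 0}" using flip by auto
    have zero: "petersson V k q (\<lambda>z. 0) (Q f) = 0" using petersson_cmult_left[OF q Qf Qf, of V 0] by simp
    have "cfun.subspace ?T" unfolding cfun.subspace_def T
    proof (intro conjI ballI allI)
      show "0 \<in> {g \<in> A. petersson V k q g (Q f) = 0}" using zero forms_zero by (simp add: A_def zero_fun_def)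
      show "x + y \<in> {g \<in> A. petersson V k q g (Q f) = 0}" if "x \<in> {g \<in> A. petersson V k q g (Q f) = 0}" "y \<in> {g \<in> A. petersson V k q g (Q f) = 0}" for x y
        using that petersson_add_left[OF q _ _ Qf, of x y V] forms_add[of x k "GG 1 q" y] A0 by (auto simp: A_def plus_fun_def)
      show "(\<lambda>z. c * x z) \<in> {g \<in> A. petersson V k q g (Q f) = 0}" if "x \<in> {g \<in> A. petersson V k q g (Q f) = 0}" for x c
        using that petersson_cmult_left[OF q _ Qf, of x V c] forms_cmult[of x k "GG 1 q" c] A0 by (auto simp: A_def)
    qed
    moreover have "{dilate k d \<phi> | l' d \<phi>. l' dvd q \<and> l' \<noteq> q \<and> d dvd q div l' \<and> \<phi> \<in> cusp_forms k l'} \<subseteq> ?T"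
    proof
      fix g assume "g \<in> {dilate k d \<phi> | l' d \<phi>. l' dvd q \<and> l' \<noteq> q \<and> d dvd q div l' \<and> \<phi> \<in> cusp_forms k l'}"
      then obtain l d \<phi> where g: "g = dilate k d \<phi>" "l dvd q" "l \<noteq> q" "d dvd q div l" "\<phi> \<in> cusp_forms k l" by blast
      obtain p where p: "prime p" "p dvd q" "g \<in> forms k (GG p q) \<or> g \<in> forms k (GG 1 (q div p))"
        unfolding g(1) by (rule oldspace_generator[OF k q g(2-5)])
      have p0: "p > 0" using p prime_gt_0_nat by blast
      have qp: "q div p > 0" "q div p dvd q" using p q p0 by (auto elim!: dvdE)
      have "GG 1 q \<subseteq> GG p q" "GG 1 q \<subseteq> GG 1 (q div p)" using q p0 qp by (intro GG_mono; auto)+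
      then have "g \<in> A" using p(3) forms_mono unfolding A_def by blast
      then show "g \<in> ?T" using Q_old[OF f p] by simp
    qed
    ultimately have "oldspace k q \<subseteq> ?T" unfolding oldspace_def by (rule cfun.span_minimal[rotated])
    then show ?thesis unfolding newspace_def using QA[OF f] Aeq by blast
  qed
  have Bn: "finite Bnew" "cfun_span Bnew = newspace V k q" "\<And>f g. f \<in> Bnew \<Longrightarrow> g \<in> Bnew \<Longrightarrow> petersson V k q f g = (if f = g then 1 else 0)"
    using assms(11) unfolding orthonormal_basis_def by auto
  then have Bnew_new: "Bnew \<subseteq> newspace V k q" using cfun.span_superset by blast
  then have BnA: "Bnew \<subseteq> A" unfolding newspace_def Aeq by blast
  have one: "1 \<in> D" by (simp add: D_def)
  have Q_adj: "petersson V k q (Q f) h = petersson V k q f h" if f: "f \<in> A" and h: "h \<in> Bnew" for f h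
  proof -
    have hA: "h \<in> A" using BnA h by blast
    \<comment> \<open>Every term of \<open>Q f\<close> except the one for \<open>(1, 1)\<close> is
      an old form, hence orthogonal to the newform \<open>h\<close>.\<close>
    have z: "petersson V k q (old_proj k q d e f) h = 0" if de: "d \<in> D" "e \<in> D" "(d, e) \<noteq> (1, 1)" for d e
    proof -
      have F: "old_proj k q d e f \<in> forms k (GG d (q div e))" using old_proj_forms[OF cube_adm[OF de(1,2)]] f by (simp add: A_def)
      have "old_proj k q d e f \<in> oldspace k q"
        by (rule forms_in_oldspace[OF k cube_adm[OF de(1,2)] _ F]) (use de(3) in auto)
      then have "petersson V k q h (old_proj k q d e f) = 0" using h Bnew_new unfolding newspace_def by blast
      then show ?thesis using petersson_cnj[OF q _ forms_empty[OF F], of h V] hA A0 by auto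
    qed
    have "petersson V k q (Q f) h = (\<Sum>p\<in>D \<times> D. of_int (mu (fst p) * mu (snd p)) * petersson V k q (old_proj k q (fst p) (snd p) f) h)"
      unfolding Q_pair[OF f hA] by (simp add: sum.cartesian_product case_prod_unfold)
    also have "\<dots> = (\<Sum>p\<in>{(1, 1)}. of_int (mu (fst p) * mu (snd p)) * petersson V k q (old_proj k q (fst p) (snd p) f) h)"
    proof (rule sum.mono_neutral_right)
      show "\<forall>p\<in>D \<times> D - {(1, 1)}. of_int (mu (fst p) * mu (snd p)) * petersson V k q (old_proj k q (fst p) (snd p) f) h = 0"
      proof
        fix p assume "p \<in> D \<times> D - {(1::nat, 1::nat)}"
        then have "petersson V k q (old_proj k q (fst p) (snd p) f) h = 0" by (intro z) (auto simp: prod_eq_iff)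
        then show "of_int (mu (fst p) * mu (snd p)) * petersson V k q (old_proj k q (fst p) (snd p) f) h = 0" by simp
      qed
    qed (use fD one in auto)
    also have "\<dots> = petersson V k q (old_proj k q 1 1 f) h" by (simp add: mu_def)
    \<comment> \<open>For \<open>d = e = 1\<close> the group is \<open>\<Gamma>\<^sub>0(q)\<close>
      itself, so \<open>h\<close> qualifies for the adjointness.\<close>
    also have "\<dots> = petersson V k q f h"
      by (rule old_proj_adjoint[OF cube_adm[OF one one]]) (use f hA in \<open>auto simp: A_def\<close>)
    finally show ?thesis .
  qed
  \<comment> \<open>\<open>Q\<close> takes values in the newspace and differs from the identity only
    by forms orthogonal to it, which is what the trace formula needs of the projection.\<close>
  have "(\<Sum>\<phi>\<in>Bnew. b \<phi> \<phi>) = (\<Sum>\<psi>\<in>B q. b (Q \<psi>) \<psi>)"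
  proof (rule trace_projection[OF q A0 B0 Bn(1) BnA Bn(3)])
    show "Q f \<in> cfun_span Bnew" if "f \<in> A" for f using Q_new[OF that] Bn(2) by simp
    show "petersson V k q (Q f) h = petersson V k q f h" if "f \<in> A" "h \<in> Bnew" for f h by (rule Q_adj[OF that])
    show "\<And>c g. g \<in> A \<Longrightarrow> b (\<lambda>z. \<Sum>\<phi>\<in>Bnew. c \<phi> * \<phi> z) g = (\<Sum>\<phi>\<in>Bnew. c \<phi> * b \<phi> g)"
      by (rule b1[OF BnA])
    show "\<And>c f. f \<in> A \<Longrightarrow> b f (\<lambda>z. \<Sum>\<phi>\<in>B q. c \<phi> * \<phi> z) = (\<Sum>\<phi>\<in>B q. cnj (c \<phi>) * b f \<phi>)"
      by (rule b2[OF B0(2)])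
  qed
  also have "\<dots> = (\<Sum>\<psi>\<in>B q. \<Sum>p\<in>D \<times> D. of_int (mu (fst p) * mu (snd p)) * b (old_proj k q (fst p) (snd p) \<psi>) \<psi>)"
    unfolding Q_def[abs_def] by (rule sum.cong[OF refl], rule b_left) (use PA B0(2) in auto)
  also have "\<dots> = (\<Sum>p\<in>D \<times> D. of_int (mu (fst p) * mu (snd p)) * (\<Sum>\<psi>\<in>B q. b (old_proj k q (fst p) (snd p) \<psi>) \<psi>))"
    by (subst sum.swap) (simp add: sum_distrib_left)
  also have "\<dots> = (\<Sum>d\<in>D. \<Sum>e\<in>D. of_int (mu d * mu e) * (\<Sum>\<phi>\<in>B (q div (d * e)). b (dilate k d \<phi>) (dilate k d \<phi>)))"
    by (simp add: sum.cartesian_product case_prod_unfold trace_old mem_Times_iff)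
  \<comment> \<open>Passage from squarefree to all divisors: the added terms vanish since
    \<open>mu\<close> is zero there.\<close>
  also have "\<dots> = (\<Sum>d | d dvd q. \<Sum>e | e dvd q. of_int (mu d * mu e) * (\<Sum>\<phi>\<in>B (q div (d * e)). b (dilate k d \<phi>) (dilate k d \<phi>)))"
  proof -
    have fin: "finite {d. d dvd q}" by (rule finite_divisors_nat[OF q])
    have mu0: "mu d = 0" if "d \<in> {d. d dvd q} - D" for d using that by (simp add: D_def mu_def)
    have DD: "D \<subseteq> {d. d dvd q}" by (auto simp: D_def)
    have "(\<Sum>e\<in>D. of_int (mu d * mu e) * X e) = (\<Sum>e | e dvd q. of_int (mu d * mu e) * (X e :: complex))" for d X
      by (rule sum.mono_neutral_left[OF fin DD]) (simp add: mu0)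
    moreover have "(\<Sum>d\<in>D. Y d) = (\<Sum>d | d dvd q. Y d)" if "\<And>d. mu d = 0 \<Longrightarrow> Y d = 0" for Y :: "nat \<Rightarrow> complex"
      by (rule sum.mono_neutral_left[OF fin DD]) (use mu0 that in auto)
    ultimately show ?thesis by simp
  qed
  finally show ?thesis unfolding b_def .
qed

end
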